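(* (Third Calderón formula) Let $d\ge1$ be an integer, $\alpha>-1/2$, $\sigma>0$, and let $\zeta$ be a positive measurable function on $\mathbb{R}^{d+1}_+$ with $\zeta(\xi)\ge1$ for all $\xi\in\mathbb{R}^{d+1}_+$ and $\zeta^{-1}\in L^1_\alpha(\mathbb{R}^{d+1}_+)$. Let $m\in L^\infty_\alpha(\mathbb{R}^{d+1}_+)$ and $\varphi\in\mathcal{H}_\zeta(\mathbb{R}^{d+1}_+)$. For $\eta>0$, the extremal function given by $$\varphi^*_{\eta,\sigma}(y)=\int_{\mathbb{R}^{d+1}_+}\mathcal{T}_{w,m,\sigma}\varphi(x)\,\overline{\Theta_{\zeta,\eta}(x,y)}\,d\mu_\alpha(x)$$ satisfies $$\lim_{\eta\to0^+}\|\varphi^*_{\eta,\sigma}-\varphi\|_\zeta=0.$$ Moreover, $(\varphi^*_{\eta,\sigma})_{\eta>0}$ converges to $\varphi$ uniformly on $\mathbb{R}^{d+1}_+$ as $\eta\to0^+$.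
   Context: Notation: $\mathbb{R}^{d+1}_+=\mathbb{R}^d\times(0,\infty)$; $x=(x',x_{d+1})$; $-x$ denotes $(-x',x_{d+1})$ (only the first $d$ coordinates change sign). Functions are complex-valued. $L^p_\alpha(\mathbb{R}^{d+1}_+)$ is the $L^p$ space, with norm $\|\cdot\|_{\alpha,p}$, of the measure $$d\mu_\alpha(x)=\frac{x_{d+1}^{2\alpha+1}}{(2\pi)^{d/2}2^{\alpha}\Gamma(\alpha+1)}\,dx\quad\text{on }\mathbb{R}^{d+1}_+.$$ The Weinstein kernel is $\Lambda^d_\alpha(\lambda,x)=e^{-i\langle x',\lambda'\rangle}j_\alpha(x_{d+1}\lambda_{d+1})$, where $j_\alpha(t)=\Gamma(\alpha+1)\sum_{k\ge0}\frac{(-1)^k t^{2k}}{2^{2k}k!\,\Gamma(\alpha+k+1)}$. The Weinstein transform is $\mathcal{F}_{W,\alpha}(\varphi)(\lambda)=\int_{\mathbb{R}^{d+1}_+}\varphi(x)\Lambda^d_\alpha(\lambda,x)\,d\mu_\alpha(x)$ for $\varphi\in L^1_\alpha$; it extends uniquely from $L^1_\alpha\cap L^2_\alpha$ to an isometric isomorphism of $L^2_\alpha(\mathbb{R}^{d+1}_+)$ (Plancherel theorem), with inverse $\mathcal{F}^{-1}_{W,\alpha}g(\lambda)=\mathcal{F}_{W,\alpha}g(-\lambda)$. Multiplier operators: $m_\sigma(x)=m(\sigma x)$ and $\mathcal{T}_{w,m,\sigma}\varphi=\mathcal{F}^{-1}_{W,\alpha}\big(m_\sigma\,\mathcal{F}_{W,\alpha}(\varphi)\big)$.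 The Hilbert space $\mathcal{H}_\zeta(\mathbb{R}^{d+1}_+)=\{\varphi\in L^2_\alpha(\mathbb{R}^{d+1}_+):\sqrt\zeta\,\mathcal{F}_{W,\alpha}(\varphi)\in L^2_\alpha(\mathbb{R}^{d+1}_+)\}$ has norm $\|\varphi\|_\zeta^2=\int_{\mathbb{R}^{d+1}_+}\zeta(\xi)|\mathcal{F}_{W,\alpha}(\varphi)(\xi)|^2\,d\mu_\alpha(\xi)$. For $\varphi\in\mathcal{H}_\zeta(\mathbb{R}^{d+1}_+)$ one has $\mathcal{F}_{W,\alpha}(\varphi)\in L^1_\alpha$, and $\varphi$ is identified with its continuous representative $\varphi(y)=\int\mathcal{F}_{W,\alpha}(\varphi)(\xi)\Lambda^d_\alpha(-y,\xi)\,d\mu_\alpha(\xi)$. The kernel $\Theta_{\zeta,\eta}$ is $$\Theta_{\zeta,\eta}(x,y)=\int_{\mathbb{R}^{d+1}_+}\frac{m_\sigma(\xi)\Lambda^d_\alpha(-x,\xi)\Lambda^d_\alpha(y,\xi)}{\eta\zeta(\xi)+|m_\sigma(\xi)|^2}\,d\mu_\alpha(\xi).$$ The function $\varphi^*_{\eta,\sigma}$ is the minimizer over $\psi\in\mathcal{H}_\zeta(\mathbb{R}^{d+1}_+)$ of $\eta\|\psi\|_\zeta^2+\|h-\mathcal{T}_{w,m,\sigma}\psi\|_{\alpha,2}^2$ with $h=\mathcal{T}_{w,m,\sigma}\varphi$.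
   Formalization: The formal theorem additionally assumes that m is nonzero almost everywhere; without this the claim fails, e.g. for m = 0 and φ ≠ 0 one has φ* = 0, so neither convergence holds. *)

theory Defs
  imports "HOL-Analysis.Analysis"
begin

text \<open>
  A point \<open>x = (x', x_(d+1))\<close> of \<open>\<real>\<^sup>d \<times> \<real>\<close> is a pair of type \<open>(real ^ 'n) \<times> real\<close>, with
  \<open>d = CARD('n)\<close>.  Elements of function spaces are represented by functions on the whole type;
  every measure and every supremum below only sees the half-space, so that values outside it are
  irrelevant.
\<close>

definition half_space :: "((real ^ 'n::finite) \<times> real) set" where
  "half_space = UNIV \<times> {0<..}"

definition reflect :: "(real ^ 'n::finite) \<times> real \<Rightarrow> (real ^ 'n) \<times> real" where
  "reflect x = (- fst x, snd x)"

definition weinstein_measure :: "real \<Rightarrow> ((real ^ 'n::finite) \<times> real) measure" where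
  "weinstein_measure \<alpha> =
     density (restrict_space lborel half_space)
       (\<lambda>x. ennreal (snd x powr (2 * \<alpha> + 1) /
              ((2 * pi) powr (real CARD('n) / 2) * 2 powr \<alpha> * Gamma (\<alpha> + 1))))"

definition L1 :: "real \<Rightarrow> ((real ^ 'n::finite) \<times> real \<Rightarrow> complex) set" where
  "L1 \<alpha> = {f. integrable (weinstein_measure \<alpha>) f}"

definition L2 :: "real \<Rightarrow> ((real ^ 'n::finite) \<times> real \<Rightarrow> complex) set" where
  "L2 \<alpha> = {f \<in> borel_measurable (weinstein_measure \<alpha>).
              integrable (weinstein_measure \<alpha>) (\<lambda>x. (cmod (f x))\<^sup>2)}"

definition Linfty :: "real \<Rightarrow> ((real ^ 'n::finite) \<times> real \<Rightarrow> complex) set" where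
  "Linfty \<alpha> = {f \<in> borel_measurable (weinstein_measure \<alpha>).
                  \<exists>C. AE x in weinstein_measure \<alpha>. cmod (f x) \<le> C}"

definition L2_norm :: "real \<Rightarrow> ((real ^ 'n::finite) \<times> real \<Rightarrow> complex) \<Rightarrow> real" where
  "L2_norm \<alpha> f = sqrt (LINT x|weinstein_measure \<alpha>. (cmod (f x))\<^sup>2)"

definition bessel_j :: "real \<Rightarrow> real \<Rightarrow> real" where
  "bessel_j \<alpha> t = Gamma (\<alpha> + 1) *
     (\<Sum>k. (-1) ^ k * t ^ (2 * k) / (2 ^ (2 * k) * fact k * Gamma (\<alpha> + real k + 1)))"

definition weinstein_kernel ::
    "real \<Rightarrow> (real ^ 'n::finite) \<times> real \<Rightarrow> (real ^ 'n) \<times> real \<Rightarrow> complex" where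
  "weinstein_kernel \<alpha> l x =
     exp (- \<i> * complex_of_real (fst x \<bullet> fst l)) * complex_of_real (bessel_j \<alpha> (snd x * snd l))"

definition weinstein_transform_L1 ::
    "real \<Rightarrow> ((real ^ 'n::finite) \<times> real \<Rightarrow> complex) \<Rightarrow> (real ^ 'n) \<times> real \<Rightarrow> complex" where
  "weinstein_transform_L1 \<alpha> f l =
     (LINT x|weinstein_measure \<alpha>. f x * weinstein_kernel \<alpha> l x)"

text \<open>
  The extension by continuity from \<open>L1 \<inter> L2\<close> to \<open>L2\<close>: a representative of the common limit in
  \<open>L2\<close> of the transforms of all sequences in \<open>L1 \<inter> L2\<close> that approximate \<open>f\<close>.  By the Plancherel
  theorem this limit exists; it is unique up to null sets, because every \<open>f\<close> in \<open>L2\<close> is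
  approximated by its truncations.
\<close>

definition weinstein_transform ::
    "real \<Rightarrow> ((real ^ 'n::finite) \<times> real \<Rightarrow> complex) \<Rightarrow> (real ^ 'n) \<times> real \<Rightarrow> complex" where
  "weinstein_transform \<alpha> f =
     (SOME g. g \<in> L2 \<alpha> \<and>
        (\<forall>u :: nat \<Rightarrow> _.
           (\<forall>n. u n \<in> L1 \<alpha> \<inter> L2 \<alpha>) \<and> (\<lambda>n. L2_norm \<alpha> (\<lambda>x. u n x - f x)) \<longlonglongrightarrow> 0 \<longrightarrow>
           (\<lambda>n. L2_norm \<alpha> (\<lambda>l. weinstein_transform_L1 \<alpha> (u n) l - g l)) \<longlonglongrightarrow> 0))"

definition inv_weinstein_transform ::
    "real \<Rightarrow> ((real ^ 'n::finite) \<times> real \<Rightarrow> complex) \<Rightarrow> (real ^ 'n) \<times> real \<Rightarrow> complex" where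
  "inv_weinstein_transform \<alpha> g l = weinstein_transform \<alpha> g (reflect l)"

definition multiplier_op ::
    "real \<Rightarrow> ((real ^ 'n::finite) \<times> real \<Rightarrow> complex) \<Rightarrow> real \<Rightarrow>
     ((real ^ 'n) \<times> real \<Rightarrow> complex) \<Rightarrow> (real ^ 'n) \<times> real \<Rightarrow> complex" where
  "multiplier_op \<alpha> m \<sigma> f =
     inv_weinstein_transform \<alpha> (\<lambda>\<xi>. m (\<sigma> *\<^sub>R \<xi>) * weinstein_transform \<alpha> f \<xi>)"

definition H_space ::
    "real \<Rightarrow> ((real ^ 'n::finite) \<times> real \<Rightarrow> real) \<Rightarrow> ((real ^ 'n) \<times> real \<Rightarrow> complex) set" where
  "H_space \<alpha> \<zeta> = {f \<in> L2 \<alpha>.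
     (\<lambda>\<xi>. complex_of_real (sqrt (\<zeta> \<xi>)) * weinstein_transform \<alpha> f \<xi>) \<in> L2 \<alpha>}"

definition H_norm ::
    "real \<Rightarrow> ((real ^ 'n::finite) \<times> real \<Rightarrow> real) \<Rightarrow> ((real ^ 'n) \<times> real \<Rightarrow> complex) \<Rightarrow> real" where
  "H_norm \<alpha> \<zeta> f =
     sqrt (LINT \<xi>|weinstein_measure \<alpha>. \<zeta> \<xi> * (cmod (weinstein_transform \<alpha> f \<xi>))\<^sup>2)"

definition continuous_rep ::
    "real \<Rightarrow> ((real ^ 'n::finite) \<times> real \<Rightarrow> complex) \<Rightarrow> (real ^ 'n) \<times> real \<Rightarrow> complex" where
  "continuous_rep \<alpha> f y =
     (LINT \<xi>|weinstein_measure \<alpha>.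
        weinstein_transform \<alpha> f \<xi> * weinstein_kernel \<alpha> (reflect y) \<xi>)"

definition Theta ::
    "real \<Rightarrow> ((real ^ 'n::finite) \<times> real \<Rightarrow> complex) \<Rightarrow> real \<Rightarrow> ((real ^ 'n) \<times> real \<Rightarrow> real) \<Rightarrow>
     real \<Rightarrow> (real ^ 'n) \<times> real \<Rightarrow> (real ^ 'n) \<times> real \<Rightarrow> complex" where
  "Theta \<alpha> m \<sigma> \<zeta> \<eta> x y =
     (LINT \<xi>|weinstein_measure \<alpha>.
        m (\<sigma> *\<^sub>R \<xi>) * weinstein_kernel \<alpha> (reflect x) \<xi> * weinstein_kernel \<alpha> y \<xi> /
        complex_of_real (\<eta> * \<zeta> \<xi> + (cmod (m (\<sigma> *\<^sub>R \<xi>)))\<^sup>2))"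

definition tikhonov ::
    "real \<Rightarrow> ((real ^ 'n::finite) \<times> real \<Rightarrow> complex) \<Rightarrow> real \<Rightarrow> ((real ^ 'n) \<times> real \<Rightarrow> real) \<Rightarrow>
     real \<Rightarrow> ((real ^ 'n) \<times> real \<Rightarrow> complex) \<Rightarrow> ((real ^ 'n) \<times> real \<Rightarrow> complex) \<Rightarrow> real" where
  "tikhonov \<alpha> m \<sigma> \<zeta> \<eta> h \<psi> =
     \<eta> * (H_norm \<alpha> \<zeta> \<psi>)\<^sup>2 + (L2_norm \<alpha> (\<lambda>x. h x - multiplier_op \<alpha> m \<sigma> \<psi> x))\<^sup>2"

text \<open>
  The minimizer, unique as an element of \<open>H_space\<close>, that is up to equality almost everywhere.
\<close>

definition is_extremal ::
    "real \<Rightarrow> ((real ^ 'n::finite) \<times> real \<Rightarrow> complex) \<Rightarrow> real \<Rightarrow> ((real ^ 'n) \<times> real \<Rightarrow> real) \<Rightarrow>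
     real \<Rightarrow> ((real ^ 'n) \<times> real \<Rightarrow> complex) \<Rightarrow> ((real ^ 'n) \<times> real \<Rightarrow> complex) \<Rightarrow> bool" where
  "is_extremal \<alpha> m \<sigma> \<zeta> \<eta> h f \<longleftrightarrow>
     f \<in> H_space \<alpha> \<zeta> \<and>
     (\<forall>\<psi> \<in> H_space \<alpha> \<zeta>.
        tikhonov \<alpha> m \<sigma> \<zeta> \<eta> h f \<le> tikhonov \<alpha> m \<sigma> \<zeta> \<eta> h \<psi> \<and>
        (tikhonov \<alpha> m \<sigma> \<zeta> \<eta> h \<psi> = tikhonov \<alpha> m \<sigma> \<zeta> \<eta> h f \<longrightarrow>
           (AE x in weinstein_measure \<alpha>. \<psi> x = f x)))"

definition phi_star ::
    "real \<Rightarrow> ((real ^ 'n::finite) \<times> real \<Rightarrow> complex) \<Rightarrow> real \<Rightarrow> ((real ^ 'n) \<times> real \<Rightarrow> real) \<Rightarrow>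
     ((real ^ 'n) \<times> real \<Rightarrow> complex) \<Rightarrow> real \<Rightarrow> (real ^ 'n) \<times> real \<Rightarrow> complex" where
  "phi_star \<alpha> m \<sigma> \<zeta> \<phi> \<eta> y =
     (LINT x|weinstein_measure \<alpha>. multiplier_op \<alpha> m \<sigma> \<phi> x * cnj (Theta \<alpha> m \<sigma> \<zeta> \<eta> x y))"

end

theory Submission
  imports Defs "HOL-Probability.Characteristic_Functions"
begin

text \<open>
  The heart of the matter is the Plancherel theorem.  The Gaussians
  \<open>exp (i v \<cdot> x') exp (- \<bar>x'\<bar>\<^sup>2 / 2) exp (- s x_(d+1)\<^sup>2 / 2)\<close> with \<open>v\<close> in \<open>\<real>\<^sup>d\<close> and \<open>s > 0\<close> have explicit
  transforms, for which Fourier inversion is visible; together with the symmetry of the kernel, inversion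
  gives the isometry on their span.  The span is dense in \<open>L1 \<inter> L2\<close>: the bounded functions that map its
  closure into itself form an algebra closed under bounded pointwise limits, which contains the
  characters \<open>exp (i v \<cdot> x')\<close> and the Gaussians of \<open>x_(d+1)\<close>, hence all bounded measurable functions.

  With \<open>p\<close> and \<open>a\<close> the transforms of \<open>\<phi>\<close> and \<open>\<psi>\<close>, \<open>M = \<bar>m_\<sigma>\<bar>\<^sup>2\<close> and \<open>D = \<eta> \<zeta> + M\<close>, completing the square
  turns the functional into \<open>\<integral> D \<bar>a - M p / D\<bar>\<^sup>2\<close> plus a constant, so that the minimizer has transform
  \<open>M p / D\<close>.  Both limits are then instances of dominated convergence, since \<open>M / D\<close> tends to \<open>1\<close> wherever
  \<open>m_\<sigma>\<close> does not vanish, and \<open>p\<close> is integrable.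
\<close>

section \<open>Square integrable functions\<close>

text \<open>The transform on \<open>L2\<close> is a \<open>SOME\<close> choice of a limit, and the
  existence of that limit is already part of the Plancherel theorem. Nothing is known about the
  transform before this is proved, and afterwards its rules hold only almost everywhere. Density is
  needed in the \<open>L1\<close> and the \<open>L2\<close> norm at once: \<open>L1\<close>
  convergence makes the transforms of the approximants converge at every point, \<open>L2\<close>
  convergence carries the norms. Hence the single error functional \<open>err\<close>. The
  multipliers reduce density to one division: \<open>f\<close> is the limit of truncations of
  \<open>f / g\<close> times a fixed Gaussian \<open>g\<close> without zeros, so it only has to be
  known that every bounded measurable function is a multiplier. The assumption that \<open>m\<close>
  is nonzero almost everywhere decides what the limit is. Where \<open>m_\<sigma>\<close> vanishes,
  the transform of the minimizer is zero for every \<eta>, and the corresponding part of \<phi>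
  could not be recovered.\<close>

definition sqint :: "'a measure \<Rightarrow> ('a \<Rightarrow> complex) \<Rightarrow> bool" where
  "sqint M f \<longleftrightarrow> f \<in> borel_measurable M \<and> integrable M (\<lambda>x. (cmod (f x))\<^sup>2)"

definition nrm2 :: "'a measure \<Rightarrow> ('a \<Rightarrow> complex) \<Rightarrow> real" where
  "nrm2 M f = sqrt (LINT x|M. (cmod (f x))\<^sup>2)"

lemma sqint_measurable [measurable_dest]: "sqint M f \<Longrightarrow> f \<in> borel_measurable M"
  and sqint_integrable: "sqint M f \<Longrightarrow> integrable M (\<lambda>x. (cmod (f x))\<^sup>2)"
  by (auto simp: sqint_def)

lemma cmod_add_square_le: "(cmod (a + b))\<^sup>2 \<le> 2 * (cmod a)\<^sup>2 + 2 * (cmod b)\<^sup>2"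
proof -
  have "(cmod (a + b))\<^sup>2 \<le> (cmod a + cmod b)\<^sup>2"
    by (intro power_mono norm_triangle_ineq) auto
  also have "\<dots> \<le> 2 * (cmod a)\<^sup>2 + 2 * (cmod b)\<^sup>2"
    using zero_le_power2[of "cmod a - cmod b"] by (simp add: power2_eq_square algebra_simps)
  finally show ?thesis .
qed

lemma sqint_bound:
  assumes "integrable M g" "f \<in> borel_measurable M" "AE x in M. (cmod (f x))\<^sup>2 \<le> g x"
  shows "sqint M f"
  unfolding sqint_def
proof (intro conjI assms(2) Bochner_Integration.integrable_bound[OF assms(1)])
  show "(\<lambda>x. (cmod (f x))\<^sup>2) \<in> borel_measurable M" using assms(2) by measurable
  show "AE x in M. norm ((cmod (f x))\<^sup>2) \<le> norm (g x)"
    using assms(3) by eventually_elim auto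
qed

lemma sqint_add [intro]:
  assumes "sqint M f" "sqint M g" shows "sqint M (\<lambda>x. f x + g x)"
proof (rule sqint_bound)
  show "integrable M (\<lambda>x. 2 * (cmod (f x))\<^sup>2 + 2 * (cmod (g x))\<^sup>2)"
    using assms by (auto simp: sqint_def)
qed (use assms cmod_add_square_le in \<open>auto simp: sqint_def\<close>)

lemma sqint_mult_bounded:
  assumes f: "sqint M f" and b: "b \<in> borel_measurable M" "AE x in M. cmod (b x) \<le> K"
  shows "sqint M (\<lambda>x. b x * f x)"
proof (rule sqint_bound)
  show "integrable M (\<lambda>x. K\<^sup>2 * (cmod (f x))\<^sup>2)"
    using f by (auto simp: sqint_def)
  show "AE x in M. (cmod (b x * f x))\<^sup>2 \<le> K\<^sup>2 * (cmod (f x))\<^sup>2"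
    using b(2) by eventually_elim
      (auto simp: norm_mult power_mult_distrib intro!: mult_right_mono power_mono)
qed (use f b in \<open>auto simp: sqint_def\<close>)

lemma sqint_cmult [intro]: "sqint M f \<Longrightarrow> sqint M (\<lambda>x. c * f x)"
  by (rule sqint_mult_bounded[where K = "cmod c"]) auto

lemma sqint_diff [intro]: "sqint M f \<Longrightarrow> sqint M g \<Longrightarrow> sqint M (\<lambda>x. f x - g x)"
  using sqint_add[of M f "\<lambda>x. -1 * g x"] sqint_cmult[of M g "-1"] by simp

lemma borel_measurable_cnj [measurable (raw)]:
  "f \<in> borel_measurable M \<Longrightarrow> (\<lambda>x. cnj (f x)) \<in> borel_measurable M"
  by (rule borel_measurable_continuous_on) (intro continuous_intros)

lemma nrm2_nonneg [simp]: "nrm2 M f \<ge> 0"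
  by (simp add: nrm2_def)

lemma nrm2_square: "(nrm2 M f)\<^sup>2 = (LINT x|M. (cmod (f x))\<^sup>2)"
  by (simp add: nrm2_def)

lemma nrm2_cong_AE:
  assumes "f \<in> borel_measurable M" "g \<in> borel_measurable M" "AE x in M. f x = g x"
  shows "nrm2 M f = nrm2 M g"
  unfolding nrm2_def using assms
  by (intro arg_cong[where f = sqrt] integral_cong_AE) auto

lemma nrm2_cmult: "nrm2 M (\<lambda>x. c * f x) = cmod c * nrm2 M f"
  by (simp add: nrm2_def norm_mult power_mult_distrib real_sqrt_mult)

lemma nrm2_minus_commute: "nrm2 M (\<lambda>x. f x - g x) = nrm2 M (\<lambda>x. g x - f x)"
  by (simp add: nrm2_def norm_minus_commute)

lemma nrm2_eq_0_iff:
  assumes "sqint M f" shows "nrm2 M f = 0 \<longleftrightarrow> (AE x in M. f x = 0)"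
  using integral_nonneg_eq_0_iff_AE[OF sqint_integrable[OF assms]]
  by (auto simp: nrm2_def)

text \<open>
  With \<open>a > \<parallel>f\<parallel>\<close> and \<open>b > \<parallel>g\<parallel>\<close>, integrate the pointwise bound
  \<open>\<bar>f + g\<bar>\<^sup>2 \<le> (1 + b / a) \<bar>f\<bar>\<^sup>2 + (1 + a / b) \<bar>g\<bar>\<^sup>2\<close>.
\<close>

lemma nrm2_triangle:
  assumes f: "sqint M f" and g: "sqint M g"
  shows "nrm2 M (\<lambda>x. f x + g x) \<le> nrm2 M f + nrm2 M g"
proof (rule field_le_epsilon)
  fix e :: real assume e: "e > 0"
  \<comment> \<open>The slack \<open>e / 2\<close> keeps \<open>a\<close> and \<open>b\<close>
    positive even if a norm vanishes, and the two halves add up to \<open>e\<close>.\<close>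
  define a where "a = nrm2 M f + e / 2"
  define b where "b = nrm2 M g + e / 2"
  have ab: "a > 0" "b > 0" using e by (auto simp: a_def b_def add_nonneg_pos)
  have If: "(LINT x|M. (cmod (f x))\<^sup>2) \<le> a\<^sup>2"
    unfolding nrm2_square[symmetric] a_def by (rule power_mono) (use e in auto)
  have Ig: "(LINT x|M. (cmod (g x))\<^sup>2) \<le> b\<^sup>2"
    unfolding nrm2_square[symmetric] b_def by (rule power_mono) (use e in auto)
  have pw: "(cmod (f x + g x))\<^sup>2 \<le> (1 + b / a) * (cmod (f x))\<^sup>2 + (1 + a / b) * (cmod (g x))\<^sup>2" for x
  proof -
    have "(cmod (f x + g x))\<^sup>2 \<le> (cmod (f x) + cmod (g x))\<^sup>2"
      by (intro power_mono norm_triangle_ineq) auto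
    moreover have "(cmod (f x) * b - cmod (g x) * a)\<^sup>2 / (a * b) \<ge> 0"
      using ab by simp
    moreover have "(1 + b / a) * (cmod (f x))\<^sup>2 + (1 + a / b) * (cmod (g x))\<^sup>2 - (cmod (f x) + cmod (g x))\<^sup>2
        = (cmod (f x) * b - cmod (g x) * a)\<^sup>2 / (a * b)"
      using ab by (simp add: field_simps power2_eq_square)
    ultimately show ?thesis by linarith
  qed
  have "(LINT x|M. (cmod (f x + g x))\<^sup>2) \<le>
      (LINT x|M. (1 + b / a) * (cmod (f x))\<^sup>2 + (1 + a / b) * (cmod (g x))\<^sup>2)"
    using f g sqint_add[OF f g] pw by (intro integral_mono) (auto simp: sqint_def)
  also have "\<dots> = (1 + b / a) * (LINT x|M. (cmod (f x))\<^sup>2) + (1 + a / b) * (LINT x|M. (cmod (g x))\<^sup>2)"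
    using f g by (subst Bochner_Integration.integral_add) (auto simp: sqint_def)
  also have "\<dots> \<le> (1 + b / a) * a\<^sup>2 + (1 + a / b) * b\<^sup>2"
    using ab If Ig by (intro add_mono mult_left_mono) auto
  also have "\<dots> = (a + b)\<^sup>2"
    using ab by (simp add: field_simps power2_eq_square)
  finally have "nrm2 M (\<lambda>x. f x + g x) \<le> a + b"
    unfolding nrm2_def using ab by (intro real_le_lsqrt) auto
  then show "nrm2 M (\<lambda>x. f x + g x) \<le> nrm2 M f + nrm2 M g + e"
    by (simp add: a_def b_def)
qed

lemma nrm2_triangle_diff:
  assumes "sqint M f" "sqint M g" "sqint M h"
  shows "nrm2 M (\<lambda>x. f x - h x) \<le> nrm2 M (\<lambda>x. f x - g x) + nrm2 M (\<lambda>x. g x - h x)"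
  using nrm2_triangle[of M "\<lambda>x. f x - g x" "\<lambda>x. g x - h x"] assms by auto

lemma nrm2_diff_le:
  assumes "sqint M f" "sqint M g"
  shows "\<bar>nrm2 M f - nrm2 M g\<bar> \<le> nrm2 M (\<lambda>x. f x - g x)"
  using nrm2_triangle[OF sqint_diff[OF assms(1,2)] assms(2)]
    nrm2_triangle[OF sqint_diff[OF assms(2,1)] assms(1)] nrm2_minus_commute[of M f g]
  by simp

lemma tendsto_nrm2:
  assumes "\<And>n. sqint M (u n)" "sqint M f" "(\<lambda>n. nrm2 M (\<lambda>x. u n x - f x)) \<longlonglongrightarrow> 0"
  shows "(\<lambda>n. nrm2 M (u n)) \<longlonglongrightarrow> nrm2 M f"
  by (rule LIM_zero_cancel, rule Lim_null_comparison[OF _ assms(3)])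
    (use nrm2_diff_le[OF assms(1,2)] in \<open>auto intro!: always_eventually\<close>)

text \<open>Addition, scaling and inversion for \<open>weinstein_transform\<close> all rest on this:
  the two sides of each rule are limits of one sequence, hence agree up to a null set.\<close>

lemma nrm2_limit_unique:
  assumes "\<And>n. sqint M (u n)" "sqint M f" "sqint M g"
    and "(\<lambda>n. nrm2 M (\<lambda>x. u n x - f x)) \<longlonglongrightarrow> 0" "(\<lambda>n. nrm2 M (\<lambda>x. u n x - g x)) \<longlonglongrightarrow> 0"
  shows "AE x in M. f x = g x"
proof -
  have "(\<lambda>n::nat. nrm2 M (\<lambda>x. f x - g x)) \<longlonglongrightarrow> 0"
  proof (rule Lim_null_comparison)
    show "\<forall>\<^sub>F n in sequentially. norm (nrm2 M (\<lambda>x. f x - g x))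
        \<le> nrm2 M (\<lambda>x. u n x - f x) + nrm2 M (\<lambda>x. u n x - g x)"
      using nrm2_triangle_diff[OF assms(2) assms(1) assms(3)] nrm2_minus_commute[of M f]
      by (intro always_eventually) (auto simp: nrm2_minus_commute[of M f])
    show "(\<lambda>n. nrm2 M (\<lambda>x. u n x - f x) + nrm2 M (\<lambda>x. u n x - g x)) \<longlonglongrightarrow> 0"
      using tendsto_add[OF assms(4,5)] by simp
  qed
  then have "nrm2 M (\<lambda>x. f x - g x) = 0"
    using LIMSEQ_const_iff by blast
  then show ?thesis
    using nrm2_eq_0_iff[of M "\<lambda>x. f x - g x"] assms by auto
qed

text \<open>Expresses the inner product through norms alone, so that an isometry also preserves the
  integrals of \<open>f x * cnj (g x)\<close>.\<close>

lemma integral_mult_cnj_polarization: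
  assumes f: "sqint M f" and g: "sqint M g"
  shows "4 * (LINT x|M. f x * cnj (g x)) =
     complex_of_real ((nrm2 M (\<lambda>x. f x + g x))\<^sup>2 - (nrm2 M (\<lambda>x. f x - g x))\<^sup>2) +
     \<i> * complex_of_real ((nrm2 M (\<lambda>x. f x + \<i> * g x))\<^sup>2 - (nrm2 M (\<lambda>x. f x - \<i> * g x))\<^sup>2)"
proof -
  let ?N = "\<lambda>h x. of_real ((cmod (h x))\<^sup>2) :: complex"
  have pw: "4 * (a * cnj b) = complex_of_real ((cmod (a + b))\<^sup>2) - complex_of_real ((cmod (a - b))\<^sup>2) +
      \<i> * (complex_of_real ((cmod (a + \<i> * b))\<^sup>2) - complex_of_real ((cmod (a - \<i> * b))\<^sup>2))" for a b
    by (simp only: complex_norm_square) (simp add: algebra_simps)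
  have int: "integrable M (?N h)" if "sqint M h" for h
    using that by (auto simp: sqint_def simp del: of_real_power)
  have eq: "complex_of_real ((nrm2 M h)\<^sup>2) = (LINT x|M. ?N h x)" for h
    unfolding nrm2_square by (rule integral_complex_of_real[symmetric])
  have "4 * (LINT x|M. f x * cnj (g x)) = (LINT x|M. 4 * (f x * cnj (g x)))"
    by simp
  also have "\<dots> = (LINT x|M. ?N (\<lambda>x. f x + g x) x - ?N (\<lambda>x. f x - g x) x +
      \<i> * (?N (\<lambda>x. f x + \<i> * g x) x - ?N (\<lambda>x. f x - \<i> * g x) x))"
    by (simp only: pw)
  also have "\<dots> = (LINT x|M. ?N (\<lambda>x. f x + g x) x) - (LINT x|M. ?N (\<lambda>x. f x - g x) x) +
      \<i> * ((LINT x|M. ?N (\<lambda>x. f x + \<i> * g x) x) - (LINT x|M. ?N (\<lambda>x. f x - \<i> * g x) x))"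
    using f g by (simp only: Bochner_Integration.integral_add Bochner_Integration.integral_diff
        integral_mult_right_zero int sqint_add sqint_diff sqint_cmult Bochner_Integration.integrable_add
        Bochner_Integration.integrable_diff Bochner_Integration.integrable_mult_right)
  finally show ?thesis
    by (simp only: eq of_real_diff)
qed

text \<open>
  A subsequence with \<open>\<parallel>f (r (k + 1)) - f (r k)\<parallel>\<^sup>2 \<le> 4 ^ (- k)\<close> converges almost everywhere because
  \<open>\<Sum>k. 2 ^ k \<bar>f (r (k + 1)) - f (r k)\<bar>\<^sup>2\<close> is integrable.
\<close>

theorem nrm2_complete:
  fixes f :: "nat \<Rightarrow> 'a \<Rightarrow> complex"
  assumes f: "\<And>n. sqint M (f n)"
    and cauchy: "\<And>e. e > 0 \<Longrightarrow> \<exists>N. \<forall>m\<ge>N. \<forall>n\<ge>N. nrm2 M (\<lambda>x. f m x - f n x) < e"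
  obtains g where "sqint M g" "(\<lambda>n. nrm2 M (\<lambda>x. f n x - g x)) \<longlonglongrightarrow> 0"
proof -
  have "\<forall>k. \<exists>N. \<forall>m\<ge>N. \<forall>n\<ge>N. nrm2 M (\<lambda>x. f m x - f n x) < (1 / 2) ^ k"
    using cauchy by simp
  then obtain N where N: "\<And>k m n. m \<ge> N k \<Longrightarrow> n \<ge> N k \<Longrightarrow> nrm2 M (\<lambda>x. f m x - f n x) < (1 / 2) ^ k"
    by metis
  \<comment> \<open>The sum of all \<open>N j\<close> up to \<open>k\<close> dominates each of them,
    so \<open>r k\<close> satisfies every Cauchy bound of index at most \<open>k\<close>.\<close>
  define r where "r k = (\<Sum>j\<le>k. N j)" for k
  have rN: "r k \<ge> N j" if "j \<le> k" for j k
    using that unfolding r_def by (intro member_le_sum) auto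
  have [measurable]: "f n \<in> borel_measurable M" for n using f by (auto simp: sqint_def)
  have r: "(LINT x|M. (cmod (f m x - f (r k) x))\<^sup>2) \<le> (1 / 4) ^ k" if "m \<ge> N k" for m k
  proof -
    have "(nrm2 M (\<lambda>x. f m x - f (r k) x))\<^sup>2 \<le> ((1 / 2) ^ k)\<^sup>2"
      using N[OF that rN[of k k]] by (intro power_mono) auto
    also have "\<dots> = (1 / 4 :: real) ^ k" by (simp add: power_mult_distrib[symmetric] power2_eq_square)
    finally show ?thesis by (simp add: nrm2_square)
  qed
  define d where "d k x = cmod (f (r (Suc k)) x - f (r k) x)" for k x
  have [measurable]: "d k \<in> borel_measurable M" for k unfolding d_def[abs_def] by measurable
  have dI: "integrable M (\<lambda>x. (d k x)\<^sup>2)" for k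
    unfolding d_def using f by (intro sqint_integrable) auto
  have "(\<integral>\<^sup>+x. (\<Sum>k. ennreal (2 ^ k * (d k x)\<^sup>2)) \<partial>M) = (\<Sum>k. \<integral>\<^sup>+x. ennreal (2 ^ k * (d k x)\<^sup>2) \<partial>M)"
    by (rule nn_integral_suminf) measurable
  also have "\<dots> \<le> (\<Sum>k. ennreal ((1 / 2) ^ k))"
  proof (intro suminf_le)
    fix k
    have "(\<integral>\<^sup>+x. ennreal (2 ^ k * (d k x)\<^sup>2) \<partial>M) = ennreal (2 ^ k * (LINT x|M. (d k x)\<^sup>2))"
      using dI by (subst nn_integral_eq_integral) auto
    also have "2 ^ k * (LINT x|M. (d k x)\<^sup>2) \<le> 2 ^ k * (1 / 4) ^ k"
      unfolding d_def using r[OF rN[of k "Suc k"]] by (intro mult_left_mono) auto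
    also have "(2 ^ k * (1 / 4) ^ k :: real) = (1 / 2) ^ k"
      by (simp add: power_mult_distrib[symmetric])
    finally show "(\<integral>\<^sup>+x. ennreal (2 ^ k * (d k x)\<^sup>2) \<partial>M) \<le> ennreal ((1 / 2) ^ k)"
      by (simp add: ennreal_leI)
  qed auto
  also have "\<dots> = ennreal 2"
    using power_half_series sums_mult[OF geometric_sums[of "1/2::real"], of 1]
    by (intro suminf_ennreal_eq) auto
  finally have "(\<integral>\<^sup>+x. (\<Sum>k. ennreal (2 ^ k * (d k x)\<^sup>2)) \<partial>M) \<noteq> \<infinity>"
    by (auto simp: top_unique)
  then have "AE x in M. (\<Sum>k. ennreal (2 ^ k * (d k x)\<^sup>2)) \<noteq> \<infinity>"
    by (intro nn_integral_noteq_infinite) auto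
  then have conv: "AE x in M. convergent (\<lambda>k. f (r k) x)"
  proof eventually_elim
    fix x assume "(\<Sum>k. ennreal (2 ^ k * (d k x)\<^sup>2)) \<noteq> \<infinity>"
    then have "summable (\<lambda>k. 2 ^ k * (d k x)\<^sup>2)"
      by (intro summable_suminf_not_top) auto
    then have "Bseq (\<lambda>k. 2 ^ k * (d k x)\<^sup>2)"
      by (intro convergent_imp_Bseq) (auto dest: summable_LIMSEQ_zero simp: convergent_def)
    then obtain C where C: "C > 0" "\<And>k. 2 ^ k * (d k x)\<^sup>2 \<le> C"
      by (auto simp: Bseq_def)
    \<comment> \<open>Boundedness of the terms is enough: it gives
      \<open>(d k x)\<^sup>2 \<le> C * (1 / 2) ^ k\<close>, so the increments have a geometric
      majorant of ratio \<open>1 / sqrt 2\<close>.\<close>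
    have "d k x \<le> sqrt C * (1 / sqrt 2) ^ k" for k
    proof -
      have "(d k x)\<^sup>2 \<le> C * (1 / 2) ^ k"
        using C(2)[of k] by (simp add: field_simps power_one_over)
      also have "\<dots> = (sqrt C * (1 / sqrt 2) ^ k)\<^sup>2"
      proof -
        have "((1 / sqrt 2) ^ k)\<^sup>2 = ((1 / sqrt 2)\<^sup>2) ^ k"
          by (subst (1 2) power_mult[symmetric]) (simp add: mult.commute)
        also have "(1 / sqrt 2)\<^sup>2 = (1 / 2 :: real)"
          by (simp add: power_divide)
        finally show ?thesis
          using C(1) by (simp only: power_mult_distrib real_sqrt_pow2 less_imp_le)
      qed
      finally show ?thesis
        by (rule power2_le_imp_le) (use C in auto)
    qed
    then have d: "norm (f (r (Suc k)) x - f (r k) x) \<le> sqrt C * (1 / sqrt 2) ^ k" for k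
      by (simp add: d_def)
    have "summable (\<lambda>k. sqrt C * (1 / sqrt 2) ^ k)"
      by (intro summable_mult summable_geometric) simp
    then have "summable (\<lambda>k. f (r (Suc k)) x - f (r k) x)"
      by (rule summable_comparison_test'[where N = 0]) (rule d)
    then show "convergent (\<lambda>k. f (r k) x)"
      by (simp add: summable_iff_convergent sum_lessThan_telescope[of "\<lambda>k. f (r k) x"]
          convergent_diff_const_right_iff)
  qed
  define g where "g x = lim (\<lambda>k. f (r k) x)" for x
  have [measurable]: "g \<in> borel_measurable M" unfolding g_def[abs_def] by measurable
  have lim: "AE x in M. (\<lambda>k. f (r k) x) \<longlonglongrightarrow> g x"
    using conv by eventually_elim (auto simp: g_def convergent_LIMSEQ_iff)
  \<comment> \<open>Fatou's lemma along the subsequence bounds the distance to \<open>g\<close> for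
    every \<open>n \<ge> N K\<close>, so the whole sequence converges and not only the
    subsequence.\<close>
  have key: "(\<integral>\<^sup>+x. ennreal ((cmod (f n x - g x))\<^sup>2) \<partial>M) \<le> ennreal (((1 / 2) ^ K)\<^sup>2)" if n: "n \<ge> N K" for n K
  proof -
    have "(\<integral>\<^sup>+x. ennreal ((cmod (f n x - g x))\<^sup>2) \<partial>M)
        = (\<integral>\<^sup>+x. liminf (\<lambda>k. ennreal ((cmod (f n x - f (r k) x))\<^sup>2)) \<partial>M)"
      using lim
    proof (intro nn_integral_cong_AE, eventually_elim)
      fix x assume "(\<lambda>k. f (r k) x) \<longlonglongrightarrow> g x"
      then have "(\<lambda>k. ennreal ((cmod (f n x - f (r k) x))\<^sup>2)) \<longlonglongrightarrow> ennreal ((cmod (f n x - g x))\<^sup>2)"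
        by (intro tendsto_intros)
      then show "ennreal ((cmod (f n x - g x))\<^sup>2) = liminf (\<lambda>k. ennreal ((cmod (f n x - f (r k) x))\<^sup>2))"
        by (intro lim_imp_Liminf[symmetric]) auto
    qed
    also have "\<dots> \<le> liminf (\<lambda>k. \<integral>\<^sup>+x. ennreal ((cmod (f n x - f (r k) x))\<^sup>2) \<partial>M)"
      by (rule nn_integral_liminf) measurable
    also have "\<dots> \<le> limsup (\<lambda>k. \<integral>\<^sup>+x. ennreal ((cmod (f n x - f (r k) x))\<^sup>2) \<partial>M)"
      by (rule Liminf_le_Limsup) auto
    also have "\<dots> \<le> ennreal (((1 / 2) ^ K)\<^sup>2)"
    proof (rule Limsup_bounded)
      show "\<forall>\<^sub>F k in sequentially. (\<integral>\<^sup>+x. ennreal ((cmod (f n x - f (r k) x))\<^sup>2) \<partial>M) \<le> ennreal (((1 / 2) ^ K)\<^sup>2)"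
        using eventually_ge_at_top[of K]
      proof eventually_elim
        fix k assume "k \<ge> K"
        then have "nrm2 M (\<lambda>x. f n x - f (r k) x) < (1 / 2) ^ K"
          using N[OF n rN] by auto
        then have "(nrm2 M (\<lambda>x. f n x - f (r k) x))\<^sup>2 \<le> ((1 / 2) ^ K)\<^sup>2"
          by (intro power_mono) auto
        moreover have "(\<integral>\<^sup>+x. ennreal ((cmod (f n x - f (r k) x))\<^sup>2) \<partial>M)
            = ennreal ((nrm2 M (\<lambda>x. f n x - f (r k) x))\<^sup>2)"
          unfolding nrm2_square using f by (intro nn_integral_eq_integral sqint_integrable) auto
        ultimately show "(\<integral>\<^sup>+x. ennreal ((cmod (f n x - f (r k) x))\<^sup>2) \<partial>M) \<le> ennreal (((1 / 2) ^ K)\<^sup>2)"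
          by (simp add: ennreal_leI)
      qed
    qed
    finally show ?thesis .
  qed
  have sq: "sqint M (\<lambda>x. f n x - g x)" if "n \<ge> N K" for n K
    unfolding sqint_def
    using key[OF that] by (auto intro!: integrableI_bounded simp: le_less_trans[OF _ ennreal_less_top])
  have "sqint M g"
    using sqint_diff[OF f[of "N 0"] sq[of 0 "N 0"]] by simp
  moreover have "(\<lambda>n. nrm2 M (\<lambda>x. f n x - g x)) \<longlonglongrightarrow> 0"
  proof (rule LIMSEQ_I)
    fix e :: real assume "e > 0"
    then obtain K where K: "(1 / 2) ^ K < e"
      using real_arch_pow_inv[of e "1/2"] by auto
    have "nrm2 M (\<lambda>x. f n x - g x) \<le> (1 / 2) ^ K" if "n \<ge> N K" for n
    proof -
      have "ennreal (LINT x|M. (cmod (f n x - g x))\<^sup>2) \<le> ennreal (((1 / 2) ^ K)\<^sup>2)"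
        using key[OF that] nn_integral_eq_integral[OF sqint_integrable[OF sq[OF that]]] by simp
      then show ?thesis
        unfolding nrm2_def by (intro real_le_lsqrt) (auto simp: ennreal_le_iff)
    qed
    then show "\<exists>no. \<forall>n\<ge>no. norm (nrm2 M (\<lambda>x. f n x - g x) - 0) < e"
      using K by (intro exI[of _ "N K"]) (auto intro: le_less_trans)
  qed
  ultimately show ?thesis by (rule that)
qed

section \<open>Algebras closed under bounded limits\<close>

text \<open>
  Functions on a set \<open>S\<close>: the values outside \<open>S\<close> are irrelevant, as \<open>limit\<close> with a constant
  sequence shows.
\<close>

locale bounded_limit_algebra =
  fixes S :: "'a set" and \<A> :: "('a \<Rightarrow> complex) set"
  assumes const: "(\<lambda>x. c) \<in> \<A>"
    and add: "f \<in> \<A> \<Longrightarrow> g \<in> \<A> \<Longrightarrow> (\<lambda>x. f x + g x) \<in> \<A>"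
    and mult: "f \<in> \<A> \<Longrightarrow> g \<in> \<A> \<Longrightarrow> (\<lambda>x. f x * g x) \<in> \<A>"
    and limit: "(\<And>n::nat. F n \<in> \<A>) \<Longrightarrow> (\<And>n x. x \<in> S \<Longrightarrow> cmod (F n x) \<le> K) \<Longrightarrow>
      (\<And>x. x \<in> S \<Longrightarrow> (\<lambda>n. F n x) \<longlonglongrightarrow> g x) \<Longrightarrow> g \<in> \<A>"
begin

lemma scale: "f \<in> \<A> \<Longrightarrow> (\<lambda>x. c * f x) \<in> \<A>"
  using mult[OF const] by blast

lemma diff: "f \<in> \<A> \<Longrightarrow> g \<in> \<A> \<Longrightarrow> (\<lambda>x. f x - g x) \<in> \<A>"
  using add[OF _ scale[of g "-1"]] by simp

lemma power: "f \<in> \<A> \<Longrightarrow> (\<lambda>x. f x ^ n) \<in> \<A>"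
  by (induction n) (auto intro: const mult)

lemma sum: "(\<And>i. i \<in> I \<Longrightarrow> f i \<in> \<A>) \<Longrightarrow> (\<lambda>x. \<Sum>i\<in>I. f i x) \<in> \<A>"
  by (induction I rule: infinite_finite_induct) (auto intro: const add)

text \<open>
  For \<open>0 \<le> w \<le> 1\<close> the functions \<open>1 - (1 - w ^ n) ^ 2 ^ n\<close> tend to \<open>0\<close>, \<open>1 - 1 / e\<close> or \<open>1\<close>
  according to whether \<open>w\<close> is less than, equal to or greater than \<open>1 / 2\<close>.  Calling
  the limit \<open>q\<close>, the functions \<open>1 - (1 - q) ^ n\<close> tend to the indicator of \<open>q > 0\<close>.
\<close>

lemma indicator_ge_half:
  assumes w: "(\<lambda>x. complex_of_real (w x)) \<in> \<A>" and w01: "\<And>x. x \<in> S \<Longrightarrow> 0 \<le> w x \<and> w x \<le> 1"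
  shows "indicator {x. w x \<ge> 1 / 2} \<in> \<A>"
proof -
  define p where "p n y = 1 - (1 - y ^ n) ^ 2 ^ n" for n and y :: real
  define q :: "real \<Rightarrow> real" where "q y = (if y < 1 / 2 then 0 else if y > 1 / 2 then 1 else 1 - exp (-1))" for y
  have p01: "0 \<le> p n y \<and> p n y \<le> 1" if "0 \<le> y" "y \<le> 1" for n y
  proof -
    have "y ^ n \<le> 1" "0 \<le> y ^ n" using that by (auto intro: power_le_one)
    then show ?thesis unfolding p_def by (auto intro: power_le_one)
  qed
  have lim: "(\<lambda>n. p n y) \<longlonglongrightarrow> q y" if y: "0 \<le> y" "y \<le> 1" for y
  proof -
    have yn: "y ^ n \<le> 1" "0 \<le> y ^ n" for n using that by (auto intro: power_le_one)
    consider "y < 1 / 2" | "y = 1 / 2" | "y > 1 / 2" by linarith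
    then show ?thesis
    proof cases
      case 1
      \<comment> \<open>Bernoulli's inequality gives
        \<open>1 - (1 - y ^ n) ^ 2 ^ n \<le> 2 ^ n * y ^ n = (2 * y) ^ n\<close>. The exponent
        \<open>2 ^ n\<close> is what puts the threshold at \<open>1 / 2\<close>.\<close>
      have "(\<lambda>n. (2 * y) ^ n) \<longlonglongrightarrow> 0" using 1 y by (intro LIMSEQ_power_zero) auto
      moreover have "norm (p n y) \<le> (2 * y) ^ n" for n
      proof -
        have "1 - real (2 ^ n) * y ^ n \<le> (1 - y ^ n) ^ 2 ^ n"
          using Bernoulli_inequality[of "- (y ^ n)" "2 ^ n"] yn[of n] by simp
        then show ?thesis using p01[OF y, of n] by (simp add: p_def power_mult_distrib)
      qed
      ultimately have "(\<lambda>n. p n y) \<longlonglongrightarrow> 0"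
        by (intro Lim_null_comparison[of "\<lambda>n. p n y" "\<lambda>n. (2 * y) ^ n"]) auto
      then show ?thesis using 1 by (simp add: q_def)
    next
      case 2
      \<comment> \<open>At the threshold the power is \<open>(1 - 1 / N) ^ N\<close> along
        \<open>N = 2 ^ n\<close>. Its limit \<open>exp (-1)\<close> is less than 1, so
        \<open>q\<close> is positive there, and the set where \<open>q\<close> is positive includes
        the boundary.\<close>
      have "(\<lambda>n. (1 + (-1) / real n) ^ n) \<longlonglongrightarrow> exp (-1)" by (rule tendsto_exp_limit_sequentially)
      then have "((\<lambda>n. (1 + (-1) / real n) ^ n) \<circ> (\<lambda>n. 2 ^ n)) \<longlonglongrightarrow> exp (-1)"
        by (rule LIMSEQ_subseq_LIMSEQ) (simp add: strict_mono_def)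
      then have "(\<lambda>n. 1 - (1 - (1 / 2) ^ n) ^ 2 ^ n) \<longlonglongrightarrow> 1 - exp (-1 :: real)"
        by (intro tendsto_intros) (simp add: o_def power_one_over)
      then show ?thesis unfolding p_def q_def 2 by simp
    next
      case 3
      have "filterlim (\<lambda>n. (2 * y) ^ n) at_top sequentially"
        using 3 by (intro filterlim_at_infinity_imp_filterlim_at_top filterlim_realpow_sequentially_gt1) auto
      then have "(\<lambda>n. exp (- ((2 * y) ^ n))) \<longlonglongrightarrow> 0"
        by (intro filterlim_compose[OF exp_at_bot] filterlim_compose[OF filterlim_uminus_at_bot_at_top])
      moreover have "norm ((1 - y ^ n) ^ 2 ^ n) \<le> exp (- ((2 * y) ^ n))" for n
      proof -
        have "(1 - y ^ n) ^ 2 ^ n \<le> exp (- (y ^ n)) ^ 2 ^ n"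
          using yn[of n] exp_ge_add_one_self[of "- (y ^ n)"] by (intro power_mono) auto
        also have "\<dots> = exp (- ((2 * y) ^ n))"
          by (simp add: exp_of_nat_mult[symmetric] power_mult_distrib)
        finally show ?thesis using yn[of n] by simp
      qed
      ultimately have "(\<lambda>n. (1 - y ^ n) ^ 2 ^ n) \<longlonglongrightarrow> 0"
        by (intro Lim_null_comparison[of "\<lambda>n. (1 - y ^ n) ^ 2 ^ n" "\<lambda>n. exp (- ((2 * y) ^ n))"]) auto
      then have "(\<lambda>n. p n y) \<longlonglongrightarrow> 1 - 0" unfolding p_def by (intro tendsto_intros)
      then show ?thesis using 3 by (simp add: q_def)
    qed
  qed
  have "(\<lambda>x. complex_of_real (p n (w x))) \<in> \<A>" for n
    unfolding p_def of_real_diff of_real_power of_real_1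
    by (intro diff const power w)
  then have q: "(\<lambda>x. complex_of_real (q (w x))) \<in> \<A>"
    by (rule limit[where K = 1]) (use w01 p01 in \<open>auto intro!: tendsto_of_real lim\<close>)
  have "(\<lambda>x. complex_of_real (1 - (1 - q (w x)) ^ n)) \<in> \<A>" for n
    unfolding of_real_diff of_real_power of_real_1
    by (intro diff const power q)
  then show ?thesis
  proof (rule limit[where K = 1])
    fix n x assume "x \<in> S"
    have q01: "0 \<le> 1 - q y \<and> 1 - q y \<le> 1" for y by (simp add: q_def)
    show "cmod (complex_of_real (1 - (1 - q (w x)) ^ n)) \<le> 1"
      using q01[of "w x"] power_le_one[of "1 - q (w x)" n] zero_le_power[of "1 - q (w x)" n]
      by (subst norm_of_real) auto
  next
    fix x assume x: "x \<in> S"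
    show "(\<lambda>n. complex_of_real (1 - (1 - q (w x)) ^ n)) \<longlonglongrightarrow> indicator {x. 1 / 2 \<le> w x} x"
    proof (cases "w x \<ge> 1 / 2")
      case True
      then have "(\<lambda>n. (1 - q (w x)) ^ n) \<longlonglongrightarrow> 0"
        by (intro LIMSEQ_power_zero) (auto simp: q_def)
      then have "(\<lambda>n. complex_of_real (1 - (1 - q (w x)) ^ n)) \<longlonglongrightarrow> of_real (1 - 0)"
        by (rule tendsto_of_real[OF tendsto_diff[OF tendsto_const]])
      moreover have "indicator {x. 1 / 2 \<le> w x} x = complex_of_real (1 - 0)"
        using True by simp
      ultimately show ?thesis by (simp only:)
    qed (auto simp: q_def)
  qed
qed

definition sets_of :: "'a set set" where
  "sets_of = {A. indicator A \<in> \<A>}"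

lemma sets_of_Compl: "A \<in> sets_of \<Longrightarrow> - A \<in> sets_of"
  using diff[OF const[of 1], of "indicator A"]
  by (auto simp: sets_of_def indicator_compl[abs_def])

lemma sets_of_Int: "A \<in> sets_of \<Longrightarrow> B \<in> sets_of \<Longrightarrow> A \<inter> B \<in> sets_of"
  using mult[of "indicator A" "indicator B"] by (auto simp: sets_of_def indicator_inter_arith[abs_def])

lemma sets_of_INT:
  assumes "\<And>n. A n \<in> sets_of" shows "(\<Inter>n::nat. A n) \<in> sets_of"
proof -
  have fin: "(\<Inter>i\<le>n. A i) \<in> sets_of" for n
    by (induction n) (auto simp: atMost_Suc assms intro!: sets_of_Int)
  have "indicator (\<Inter>n. A n) \<in> \<A>"
  proof (rule limit)
    show "indicator (\<Inter>i\<le>n. A i) \<in> \<A>" for n using fin[of n] by (simp add: sets_of_def)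
    show "cmod (indicator (\<Inter>i\<le>n. A i) x) \<le> 1" for n x by (simp add: indicator_def)
    fix x
    show "(\<lambda>n. indicator (\<Inter>i\<le>n. A i) x :: complex) \<longlonglongrightarrow> indicator (\<Inter>n. A n) x"
    proof (cases "x \<in> (\<Inter>n. A n)")
      case False
      then obtain N where "x \<notin> A N" by auto
      then have "\<forall>\<^sub>F n in sequentially. indicator (\<Inter>i\<le>n. A i) x = (0 :: complex)"
        by (intro eventually_sequentiallyI[of N]) (auto simp: indicator_def)
      then show ?thesis using False by (auto intro: tendsto_eventually)
    qed auto
  qed
  then show ?thesis by (simp add: sets_of_def)
qed

lemma sets_of_UN:
  assumes "\<And>n. A n \<in> sets_of" shows "(\<Union>n::nat. A n) \<in> sets_of"
  using sets_of_Compl[OF sets_of_INT[of "\<lambda>n. - A n"]] sets_of_Compl assms by simp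

lemma sets_of_eq_on:
  assumes "A \<in> sets_of" "A \<inter> S = B \<inter> S" shows "B \<in> sets_of"
  unfolding sets_of_def
proof (clarify, rule limit)
  show "indicator A \<in> \<A>" for n :: nat using assms by (simp add: sets_of_def)
  show "cmod (indicator A x) \<le> 1" for n :: nat and x by (simp add: indicator_def)
  fix x assume "x \<in> S"
  then have "indicator A x = (indicator B x :: complex)" using assms(2) by (auto simp: indicator_def)
  then show "(\<lambda>n::nat. indicator A x :: complex) \<longlonglongrightarrow> indicator B x" by simp
qed

lemma sigma_sets_subset_sets_of:
  assumes "G \<subseteq> sets_of" "A \<in> sigma_sets UNIV G" shows "A \<in> sets_of"
  using assms(2)
proof induction
  case Empty
  show ?case using const[of 0] by (simp add: sets_of_def indicator_def[abs_def])
qed (use assms(1) sets_of_Compl sets_of_UN in \<open>auto simp: Compl_eq_Diff_UNIV\<close>)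

end

text \<open>A functional monotone class theorem. Once the generator lies in \<open>sets_of\<close>,
  so does every measurable set; simple functions are combinations of indicators, and
  \<open>k\<close> is their limit under the uniform bound \<open>2 * K\<close>.\<close>

lemma (in bounded_limit_algebra) bounded_measurable:
  fixes k :: "'a \<Rightarrow> complex"
  assumes S: "sets M = {A \<inter> S | A. A \<in> sigma_sets UNIV G}" "space M = S"
    and G: "G \<subseteq> sets_of"
    and k: "k \<in> borel_measurable M" "\<And>x. x \<in> S \<Longrightarrow> cmod (k x) \<le> K"
  shows "k \<in> \<A>"
proof -
  obtain F where F: "\<And>i. simple_function M (F i)" "\<And>x. x \<in> space M \<Longrightarrow> (\<lambda>i. F i x) \<longlonglongrightarrow> k x"
      "\<And>i x. x \<in> space M \<Longrightarrow> dist (F i x) 0 \<le> 2 * dist (k x) 0"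
    using borel_measurable_implies_sequence_metric[OF k(1), of 0] by blast
  have sets: "A \<in> sets_of" if A: "A \<in> sets M" for A
  proof -
    obtain B where "B \<in> sigma_sets UNIV G" "A = B \<inter> S" using A S by auto
    then show ?thesis using sigma_sets_subset_sets_of[OF G] sets_of_eq_on[of B A] by auto
  qed
  \<comment> \<open>\<open>F i\<close> rewritten as a finite combination of indicators. The two
    agree on \<open>S\<close> only, which is all that \<open>limit\<close> sees.\<close>
  define F' where "F' i x = (\<Sum>y\<in>F i ` S. y * indicator (F i -` {y} \<inter> S) x)" for i x
  have FF: "F' i x = F i x" if x: "x \<in> S" for i x
  proof -
    have "F' i x = (\<Sum>y\<in>F i ` S. if y = F i x then F i x else 0)"
      unfolding F'_def using x by (intro sum.cong) (auto simp: indicator_def)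
    also have "\<dots> = F i x"
      using x simple_functionD(1)[OF F(1)[of i]] S(2) by (subst sum.delta) auto
    finally show ?thesis .
  qed
  show ?thesis
  proof (rule limit)
    fix i
    have "indicator (F i -` {y} \<inter> S) \<in> \<A>" for y
      using sets[OF simple_functionD(2)[OF F(1)[of i], of "{y}"]] S(2) by (simp add: sets_of_def)
    then show "F' i \<in> \<A>"
      unfolding F'_def[abs_def] by (intro sum scale)
    fix x assume x: "x \<in> S"
    show "cmod (F' i x) \<le> 2 * K"
      using F(3)[of x i] k(2)[OF x] S(2) x FF by auto
  qed (use F(2) S(2) FF in auto)
qed

section \<open>The normalized Bessel function\<close>

text \<open>The coefficient of \<open>t ^ (2 * k)\<close> in the series of \<open>bessel_j\<close>,
  stripped of its sign \<open>(-1) ^ k\<close>.\<close>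

definition bessel_coeff :: "real \<Rightarrow> nat \<Rightarrow> real" where
  "bessel_coeff \<alpha> k = Gamma (\<alpha> + 1) / (2 ^ (2 * k) * fact k * Gamma (\<alpha> + real k + 1))"

text \<open>Prepares Poisson's integral: up to normalization these are the moments of the density
  \<open>u powr (- 1 / 2) * (1 - u) powr (\<alpha> - 1 / 2)\<close> on the unit interval, divided by
  \<open>fact (2 * k)\<close> as in the cosine series. The duplication formula
  \<open>fact_double\<close> absorbs the power \<open>2 ^ (2 * k)\<close>.\<close>

lemma bessel_coeff_Beta:
  assumes "\<alpha> > - 1 / 2"
  shows "bessel_coeff \<alpha> k = Beta (real k + 1 / 2) (\<alpha> + 1 / 2) / (Beta (1 / 2) (\<alpha> + 1 / 2) * fact (2 * k))"
proof -
  have "(1 / 2 :: real) \<notin> \<int>\<^sub>\<le>\<^sub>0" using nonpos_Ints_nonpos[of "1 / 2 :: real"] by auto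
  from pochhammer_Gamma[OF this, of k]
  have "Gamma (1 / 2 + real k) = pochhammer (1 / 2) k * Gamma (1 / 2)"
    by (simp add: Gamma_one_half_real)
  moreover have "fact (2 * k) = 2 ^ (2 * k) * pochhammer (1 / 2) k * (fact k :: real)"
    by (rule fact_double)
  moreover have "Gamma (\<alpha> + 1) > 0" "Gamma (\<alpha> + 1 / 2) > 0" "Gamma (\<alpha> + real k + 1) > 0" "Gamma (1 / 2 :: real) > 0"
    using assms by (auto intro!: Gamma_real_pos)
  moreover have "pochhammer (1 / 2 :: real) k > 0" by (rule pochhammer_pos) simp
  ultimately show ?thesis
    unfolding bessel_coeff_def Beta_def by (simp add: add_ac Gamma_one_half_real)
qed

lemma set_integral_Beta:
  assumes "a > 0" "b > (0::real)"
  shows "set_integrable lborel {0..1} (\<lambda>t. t powr (a - 1) * (1 - t) powr (b - 1))"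
    and "(LINT t:{0..1}|lborel. t powr (a - 1) * (1 - t) powr (b - 1)) = Beta a b"
proof -
  show *: "set_integrable lborel {0..1} (\<lambda>t. t powr (a - 1) * (1 - t) powr (b - 1))"
    using assms by (rule integrable_Beta)
  show "(LINT t:{0..1}|lborel. t powr (a - 1) * (1 - t) powr (b - 1)) = Beta a b"
    using set_borel_integral_eq_integral(2)[OF *] has_integral_Beta_real[OF assms]
    by (simp add: integral_unique)
qed

lemma Beta_pos: "a > 0 \<Longrightarrow> b > (0::real) \<Longrightarrow> Beta a b > 0"
  by (auto simp: Beta_def intro!: divide_pos_pos mult_pos_pos Gamma_real_pos)

text \<open>Since \<open>u ^ k \<le> 1\<close> on the unit interval, the moments are largest at
  \<open>k = 0\<close>. The bound \<open>1 / fact k\<close>, cruder than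
  \<open>1 / fact (2 * k)\<close>, is the one that compares directly with the exponential
  series.\<close>

lemma bessel_coeff_bounds:
  assumes "\<alpha> > - 1 / 2"
  shows "0 < bessel_coeff \<alpha> k" "bessel_coeff \<alpha> k \<le> 1 / fact k"
proof -
  show "0 < bessel_coeff \<alpha> k"
    using assms by (auto simp: bessel_coeff_def intro!: divide_pos_pos mult_pos_pos Gamma_real_pos)
  have "(LINT t:{0..1}|lborel. t powr (real k + 1 / 2 - 1) * (1 - t) powr (\<alpha> + 1 / 2 - 1))
      \<le> (LINT t:{0..1}|lborel. t powr (1 / 2 - 1) * (1 - t) powr (\<alpha> + 1 / 2 - 1))"
    by (rule set_integral_mono; (rule set_integral_Beta mult_right_mono powr_mono')?)
      (use assms in \<open>auto intro: powr_mono'\<close>)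
  then have "Beta (real k + 1 / 2) (\<alpha> + 1 / 2) \<le> Beta (1 / 2) (\<alpha> + 1 / 2)"
    by (subst (asm) (1 2) set_integral_Beta(2)) (use assms in auto)
  then have "bessel_coeff \<alpha> k \<le> 1 / fact (2 * k)"
    using Beta_pos[of "1/2" "\<alpha> + 1/2"] assms
    by (auto simp: bessel_coeff_Beta[OF assms] field_simps)
  also have "\<dots> \<le> 1 / fact k"
    by (intro divide_left_mono fact_mono) auto
  finally show "bessel_coeff \<alpha> k \<le> 1 / fact k" .
qed

lemma summable_bessel:
  assumes "\<alpha> > - 1 / 2" "x \<ge> 0"
  shows "summable (\<lambda>k. bessel_coeff \<alpha> k * x ^ k)"
proof (rule summable_comparison_test'[where N = 0])
  show "summable (\<lambda>k. inverse (fact k) * x ^ k)" by (rule summable_exp)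
  fix k
  show "norm (bessel_coeff \<alpha> k * x ^ k) \<le> inverse (fact k) * x ^ k"
    using bessel_coeff_bounds[OF assms(1), of k] assms(2)
      mult_right_mono[OF bessel_coeff_bounds(2)[OF assms(1), of k], of "x ^ k"]
    by (simp add: inverse_eq_divide)
qed

lemma bessel_j_altdef: "bessel_j \<alpha> t = (\<Sum>k. (-1) ^ k * bessel_coeff \<alpha> k * t ^ (2 * k))"
  if "\<alpha> > - 1 / 2"
proof -
  have "summable (\<lambda>k. (-1) ^ k * bessel_coeff \<alpha> k * t ^ (2 * k))"
    by (rule summable_comparison_test'[OF summable_bessel[OF that, of "t\<^sup>2"], where N = 0])
      (use bessel_coeff_bounds(1)[OF that] in \<open>auto simp: abs_mult power_mult power_abs less_imp_le\<close>)
  then have s: "summable (\<lambda>k. Gamma (\<alpha> + 1) *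
      ((-1) ^ k * t ^ (2 * k) / (2 ^ (2 * k) * fact k * Gamma (\<alpha> + real k + 1))))"
    by (simp add: bessel_coeff_def mult_ac)
  have "Gamma (\<alpha> + 1) > 0" using that by (intro Gamma_real_pos) auto
  then have "summable (\<lambda>k. (-1) ^ k * t ^ (2 * k) / (2 ^ (2 * k) * fact k * Gamma (\<alpha> + real k + 1)))"
    using s by (subst (asm) summable_cmult_iff) auto
  from suminf_mult[OF this, of "Gamma (\<alpha> + 1)"] show ?thesis
    by (simp add: bessel_j_def bessel_coeff_def mult_ac)
qed

text \<open>Poisson's integral of \<open>(1 - s\<^sup>2) powr (\<alpha> - 1 / 2) * cos (t * s)\<close> over \<open>[0, 1]\<close>, with \<open>u = s\<^sup>2\<close>.\<close>

lemma bessel_j_Poisson: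
  assumes \<alpha>: "\<alpha> > - 1 / 2"
  shows "bessel_j \<alpha> t = (LINT u:{0..1}|lborel. u powr (1 / 2 - 1) * (1 - u) powr (\<alpha> + 1 / 2 - 1) * cos (t * sqrt u))
     / Beta (1 / 2) (\<alpha> + 1 / 2)"
proof -
  define w where "w u = indicator {0..1} u * (u powr (1 / 2 - 1) * (1 - u) powr (\<alpha> + 1 / 2 - 1))" for u :: real
  define f where "f k u = (-1) ^ k * (t\<^sup>2) ^ k / fact (2 * k) * (w u * u ^ k)" for k u
  have w0: "w u \<ge> 0" for u by (simp add: w_def)
  \<comment> \<open>At \<open>u = 0\<close> both sides vanish because \<open>0 powr\<close> anything
    is 0, so the singular weight is harmless there.\<close>
  have wk: "w u * u ^ k = indicator {0..1} u * (u powr (real k + 1 / 2 - 1) * (1 - u) powr (\<alpha> + 1 / 2 - 1))" for u k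
  proof (cases "u > 0")
    case True
    then have "u powr (real k + 1 / 2 - 1) = u ^ k * u powr (1 / 2 - 1)"
      by (simp add: powr_realpow[symmetric] powr_add[symmetric])
    then show ?thesis by (simp add: w_def)
  next
    case False
    then show ?thesis by (cases "u = 0") (auto simp: w_def)
  qed
  have wI: "integrable lborel (\<lambda>u. w u * u ^ k)" for k
    using set_integral_Beta(1)[of "real k + 1/2" "\<alpha> + 1 / 2"] \<alpha>
    by (simp add: set_integrable_def wk)
  have wB: "(LINT u|lborel. w u * u ^ k) = Beta (real k + 1 / 2) (\<alpha> + 1 / 2)" for k
    using set_integral_Beta(2)[of "real k + 1/2" "\<alpha> + 1 / 2"] \<alpha>
    by (simp add: set_lebesgue_integral_def wk)
  have B0: "Beta (1 / 2) (\<alpha> + 1 / 2) > 0" using \<alpha> by (intro Beta_pos) auto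
  have fI: "integrable lborel (f k)" for k
    unfolding f_def[abs_def] by (intro Bochner_Integration.integrable_mult_right wI)
  have fB: "(LINT u|lborel. f k u) = Beta (1 / 2) (\<alpha> + 1 / 2) * ((-1) ^ k * bessel_coeff \<alpha> k * t ^ (2 * k))" for k
  proof -
    have "(LINT u|lborel. f k u) = (-1) ^ k * (t\<^sup>2) ^ k / fact (2 * k) * Beta (real k + 1 / 2) (\<alpha> + 1 / 2)"
      unfolding f_def by (simp only: integral_mult_right_zero wB)
    then show ?thesis using B0 by (simp add: bessel_coeff_Beta[OF \<alpha>] power_mult)
  qed
  have nf: "norm (f k u) = (t\<^sup>2) ^ k / fact (2 * k) * (w u * u ^ k)" for k u
    using w0[of u] by (cases "u \<in> {0..1}") (auto simp: f_def abs_mult power_abs w_def)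
  have cos: "(\<lambda>k. f k u) sums (w u * cos (t * sqrt u))" for u
  proof (cases "u \<in> {0..1}")
    case True
    have "(\<lambda>k. w u * ((-1) ^ k / fact (2 * k) * (t * sqrt u) ^ (2 * k))) sums (w u * cos (t * sqrt u))"
      by (intro sums_mult cos_paired)
    moreover have "(t * sqrt u) ^ (2 * k) = (t\<^sup>2) ^ k * u ^ k" for k
      using True by (simp add: power_mult power_mult_distrib)
    ultimately show ?thesis by (simp add: f_def mult_ac)
  qed (simp add: f_def w_def)
  \<comment> \<open>Termwise integration of the cosine series. Up to the Beta factor, the integrals
    of the norms are the terms of \<open>summable_bessel\<close> at
    \<open>t\<^sup>2\<close>.\<close>
  have "(\<lambda>k. LINT u|lborel. f k u) sums (LINT u|lborel. (\<Sum>k. f k u))"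
  proof (rule sums_integral)
    show "AE u in lborel. summable (\<lambda>k. norm (f k u))"
    proof (rule AE_I2)
      fix u
      show "summable (\<lambda>k. norm (f k u))"
      proof (cases "u \<in> {0..1}")
        case True
        have "summable (\<lambda>k. w u * (inverse (fact k) * (t\<^sup>2 * u) ^ k))"
          by (intro summable_mult summable_exp)
        then show ?thesis
        proof (rule summable_comparison_test'[where N = 0])
          fix k
          have "1 / fact (2 * k) \<le> (1 / fact k :: real)" by (intro divide_left_mono fact_mono) auto
          then have "(w u * (t\<^sup>2 * u) ^ k) * (1 / fact (2 * k)) \<le> (w u * (t\<^sup>2 * u) ^ k) * (1 / fact k)"
            using w0[of u] True by (intro mult_left_mono) auto
          moreover have "norm (norm (f k u)) = (t\<^sup>2) ^ k / fact (2 * k) * (w u * u ^ k)"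
            using nf[of k u] by (simp only: real_norm_def abs_abs)
          ultimately show "norm (norm (f k u)) \<le> w u * (inverse (fact k) * (t\<^sup>2 * u) ^ k)"
            by (simp only: power_mult_distrib) (simp add: divide_inverse mult_ac)
        qed
      qed (simp add: f_def w_def)
    qed
    have "summable (\<lambda>k. Beta (1 / 2) (\<alpha> + 1 / 2) * (bessel_coeff \<alpha> k * (t\<^sup>2) ^ k))"
      by (intro summable_mult summable_bessel \<alpha>) auto
    moreover have "(LINT u|lborel. norm (f k u)) = Beta (1 / 2) (\<alpha> + 1 / 2) * (bessel_coeff \<alpha> k * (t\<^sup>2) ^ k)" for k
      using B0 unfolding nf integral_mult_right_zero wB by (simp add: bessel_coeff_Beta[OF \<alpha>])
    ultimately show "summable (\<lambda>k. LINT u|lborel. norm (f k u))" by (simp only:)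
  qed (rule fI)
  then have "(\<lambda>k. Beta (1 / 2) (\<alpha> + 1 / 2) * ((-1) ^ k * bessel_coeff \<alpha> k * t ^ (2 * k)))
      sums (LINT u|lborel. w u * cos (t * sqrt u))"
    unfolding fB sums_unique[OF cos, symmetric] .
  then have "(\<lambda>k. (-1) ^ k * bessel_coeff \<alpha> k * t ^ (2 * k))
      sums ((LINT u|lborel. w u * cos (t * sqrt u)) / Beta (1 / 2) (\<alpha> + 1 / 2))"
    using B0 by (subst (asm) sums_mult_iff[symmetric, where c = "1 / Beta (1 / 2) (\<alpha> + 1 / 2)"]) auto
  then have "bessel_j \<alpha> t = (LINT u|lborel. w u * cos (t * sqrt u)) / Beta (1 / 2) (\<alpha> + 1 / 2)"
    unfolding bessel_j_altdef[OF \<alpha>] by (rule sums_unique[symmetric])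
  then show ?thesis by (simp add: set_lebesgue_integral_def w_def mult_ac)
qed

text \<open>Poisson's integral is an average of cosines against a probability density.\<close>

lemma abs_bessel_j_le_1:
  assumes \<alpha>: "\<alpha> > - 1 / 2" shows "\<bar>bessel_j \<alpha> t\<bar> \<le> 1"
proof -
  let ?w = "\<lambda>u::real. indicator {0..1} u * (u powr (1 / 2 - 1) * (1 - u) powr (\<alpha> + 1 / 2 - 1))"
  have B: "integrable lborel ?w" "(LINT u|lborel. ?w u) = Beta (1 / 2) (\<alpha> + 1 / 2)"
    using set_integral_Beta[of "1/2" "\<alpha> + 1 / 2"] \<alpha>
    by (auto simp: set_integrable_def set_lebesgue_integral_def)
  have B0: "Beta (1 / 2) (\<alpha> + 1 / 2) > 0" using \<alpha> by (intro Beta_pos) auto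
  have "\<bar>LINT u|lborel. ?w u * cos (t * sqrt u)\<bar> \<le> (LINT u|lborel. ?w u)"
  proof (rule integral_abs_bound_integral[OF _ B(1)])
    have "\<bar>?w u * cos (t * sqrt u)\<bar> \<le> ?w u * 1" for u
      unfolding abs_mult by (intro mult_mono) (auto simp: indicator_def)
    then show "\<bar>?w u * cos (t * sqrt u)\<bar> \<le> ?w u" for u by simp
    then show "integrable lborel (\<lambda>u. ?w u * cos (t * sqrt u))"
      by (intro Bochner_Integration.integrable_bound[OF B(1)]) (auto intro!: AE_I2)
  qed
  then show ?thesis
    using B0 B(2) by (simp add: bessel_j_Poisson[OF \<alpha>] set_lebesgue_integral_def mult_ac)
qed

lemma borel_measurable_bessel_j [measurable]:
  assumes \<alpha>: "\<alpha> > - 1 / 2" shows "bessel_j \<alpha> \<in> borel_measurable borel"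
  unfolding bessel_j_Poisson[OF \<alpha>, abs_def] set_lebesgue_integral_def
  by measurable

section \<open>Gaussian integrals\<close>

lemma integral_Gamma_Gaussian:
  assumes b: "b > 0" and s: "s > (0::real)"
  shows "integrable lborel (\<lambda>r. indicator {0<..} r * (r powr (2 * b - 1) * exp (- s * r\<^sup>2 / 2)))"
    and "(LINT r|lborel. indicator {0<..} r * (r powr (2 * b - 1) * exp (- s * r\<^sup>2 / 2)))
      = 2 powr (b - 1) * s powr (- b) * Gamma b"
proof -
  define f where "f v = v powr (b - 1) / exp v" for v :: real
  \<comment> \<open>The substitution \<open>v = g r\<close> in Euler's integral for
    \<open>Gamma b\<close>; the derivative \<open>s * r\<close> supplies the missing power of
    \<open>r\<close>.\<close>
  define g where "g r = s * r\<^sup>2 / 2" for r :: real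
  have inj: "inj_on g {0<..}"
    using s by (auto simp: inj_on_def g_def power2_eq_iff_nonneg)
  have img: "g ` {0<..} = {0<..}"
  proof (intro set_eqI iffI)
    fix v :: real assume "v \<in> {0<..}"
    then have "v = g (sqrt (2 * v / s))" "sqrt (2 * v / s) > 0" using s by (auto simp: g_def)
    then show "v \<in> g ` {0<..}" by blast
  qed (use s in \<open>auto simp: g_def\<close>)
  have hi: "(f has_integral Gamma b) {0<..}"
  proof -
    have "((\<lambda>v. if v \<in> {0<..} then f v else 0) has_integral Gamma b) {0..}"
      by (rule has_integral_spike[OF negligible_sing[of 0] _ Gamma_integral_real[OF b]])
        (auto simp: f_def)
    then show ?thesis by (subst (asm) has_integral_restrict) auto
  qed
  have abs: "f absolutely_integrable_on {0<..}"
    using hi by (intro nonnegative_absolutely_integrable_1) (auto simp: f_def)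
  have der: "(g has_field_derivative s * r) (at r within {0<..})" for r
    unfolding g_def by (auto intro!: derivative_eq_intros)
  have "(\<lambda>r. \<bar>s * r\<bar> * f (g r)) absolutely_integrable_on {0<..} \<and>
      integral {0<..} (\<lambda>r. \<bar>s * r\<bar> * f (g r)) = Gamma b"
    using has_absolute_integral_change_of_variables_1'[OF _ der inj, of f "Gamma b"] abs hi
    unfolding img by (auto simp: integral_unique)
  moreover have eq: "\<bar>s * r\<bar> * f (g r) = s powr b * 2 powr (1 - b) * (r powr (2 * b - 1) * exp (- s * r\<^sup>2 / 2))"
    if "r \<in> {0<..}" for r
  proof -
    have "g r powr (b - 1) = s powr (b - 1) * r powr (2 * (b - 1)) * 2 powr (1 - b)"
      using s that unfolding g_def
      by (simp add: powr_mult powr_divide powr_powr flip: powr_numeral)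
        (simp add: powr_diff field_simps)
    then have "s * r * g r powr (b - 1) = (s * s powr (b - 1)) * (r * r powr (2 * (b - 1))) * 2 powr (1 - b)"
      by (simp only: mult_ac)
    also have "s * s powr (b - 1) = s powr b" using s by (simp add: powr_diff)
    also have "r * r powr (2 * (b - 1)) = r powr (2 * b - 1)"
    proof -
      have "r * r powr (2 * (b - 1)) = r powr 1 * r powr (2 * (b - 1))" using that by simp
      also have "\<dots> = r powr (2 * b - 1)" unfolding powr_add[symmetric] by (simp add: algebra_simps)
      finally show ?thesis .
    qed
    finally have "s * r * g r powr (b - 1) = s powr b * r powr (2 * b - 1) * 2 powr (1 - b)" .
    moreover have "\<bar>s * r\<bar> * f (g r) = (s * r * g r powr (b - 1)) * exp (- s * r\<^sup>2 / 2)"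
    proof -
      have "- s * r\<^sup>2 / 2 = - g r" by (simp add: g_def)
      then have "exp (- s * r\<^sup>2 / 2) = inverse (exp (g r))" by (simp only: exp_minus)
      moreover have "\<bar>s * r\<bar> = s * r" using s that by simp
      ultimately show ?thesis by (simp only: f_def divide_inverse mult_ac)
    qed
    ultimately show ?thesis by (simp only: mult_ac)
  qed
  define h where "h r = s powr b * 2 powr (1 - b) * (r powr (2 * b - 1) * exp (- s * r\<^sup>2 / 2))" for r
  have eq': "\<bar>s * r\<bar> * f (g r) = h r" if "r \<in> {0<..}" for r
    unfolding h_def using that by (rule eq)
  have "(\<lambda>r. \<bar>s * r\<bar> * f (g r)) absolutely_integrable_on {0<..} \<longleftrightarrow> h absolutely_integrable_on {0<..}"
    by (rule set_integrable_cong[OF refl refl eq'])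
  moreover have "integral {0<..} (\<lambda>r. \<bar>s * r\<bar> * f (g r)) = integral {0<..} h"
    by (rule Henstock_Kurzweil_Integration.integral_cong[OF eq'])
  ultimately have "h absolutely_integrable_on {0<..} \<and> integral {0<..} h = Gamma b"
    by (simp only:)
  moreover have [measurable]: "h \<in> borel_measurable borel" unfolding h_def by measurable
  \<comment> \<open>The change of variables lives on the completed Lebesgue measure; Borel
    measurability of \<open>h\<close> brings the result back to \<open>lborel\<close>.\<close>
  ultimately have h: "integrable lborel (\<lambda>r. indicator {0<..} r * h r)" "(LINT r|lborel. indicator {0<..} r * h r) = Gamma b"
    unfolding set_integrable_def set_lebesgue_integral_def
    using set_lebesgue_integral_eq_integral(2)[of "{0<..}" h]
    by (auto simp: integrable_completion integral_completion set_integrable_def set_lebesgue_integral_def)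
  have h2: "indicator {0<..} r * (r powr (2 * b - 1) * exp (- s * r\<^sup>2 / 2)) =
     inverse (s powr b * 2 powr (1 - b)) * (indicator {0<..} r * h r)" for r
    using s by (simp add: h_def field_simps)
  show "integrable lborel (\<lambda>r. indicator {0<..} r * (r powr (2 * b - 1) * exp (- s * r\<^sup>2 / 2)))"
    unfolding h2 using h(1) by simp
  show "(LINT r|lborel. indicator {0<..} r * (r powr (2 * b - 1) * exp (- s * r\<^sup>2 / 2)))
      = 2 powr (b - 1) * s powr (- b) * Gamma b"
    unfolding h2 integral_mult_right_zero h(2)
    using s by (simp add: powr_minus powr_diff field_simps)
qed

text \<open>The Bessel series is integrated term by term. The moment of order \<open>k\<close>
  contributes \<open>Gamma (\<alpha> + 1 + k)\<close>, which cancels the same factor in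
  \<open>bessel_coeff\<close>, and the exponential series of \<open>- l\<^sup>2 / (2 * s)\<close>
  remains.\<close>

lemma integral_bessel_Gaussian:
  assumes \<alpha>: "\<alpha> > - 1 / 2" and s: "s > 0"
  shows "(LINT r|lborel. indicator {0<..} r * (r powr (2 * \<alpha> + 1) * exp (- s * r\<^sup>2 / 2) * bessel_j \<alpha> (r * l)))
    = 2 powr \<alpha> * Gamma (\<alpha> + 1) * s powr (- (\<alpha> + 1)) * exp (- l\<^sup>2 / (2 * s))"
proof -
  define b where "b k = \<alpha> + 1 + real k" for k
  have b: "b k > 0" for k using \<alpha> by (simp add: b_def)
  define h where "h k r = indicator {0<..} r * (r powr (2 * b k - 1) * exp (- s * r\<^sup>2 / 2))" for k r
  have h0: "h k r \<ge> 0" for k r by (simp add: h_def)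
  have hI: "integrable lborel (h k)" and hv: "(LINT r|lborel. h k r) = 2 powr (b k - 1) * s powr (- b k) * Gamma (b k)" for k
    unfolding h_def[abs_def] using integral_Gamma_Gaussian[OF b s] by auto
  define c where "c k = bessel_coeff \<alpha> k * (l\<^sup>2) ^ k" for k
  have c0: "c k \<ge> 0" for k using bessel_coeff_bounds(1)[OF \<alpha>, of k] by (simp add: c_def less_imp_le)
  define f where "f k r = (-1) ^ k * c k * h k r" for k r
  have fI: "integrable lborel (f k)" for k
    unfolding f_def[abs_def] by (intro Bochner_Integration.integrable_mult_right hI)
  define C where "C = 2 powr \<alpha> * Gamma (\<alpha> + 1) * s powr (- (\<alpha> + 1))"
  have ch: "c k * (LINT r|lborel. h k r) = C * ((l\<^sup>2 / (2 * s)) ^ k / fact k)" for k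
  proof -
    have G: "Gamma (b k) > 0" using b by (rule Gamma_real_pos)
    have 1: "2 powr (b k - 1) = 2 powr \<alpha> * (2 :: real) ^ k"
      by (simp add: b_def powr_add powr_realpow)
    have 2: "s powr (- b k) = s powr (- (\<alpha> + 1)) / s ^ k"
    proof -
      have "- b k = - (\<alpha> + 1) - real k" by (simp add: b_def)
      then show ?thesis using s by (simp only: powr_diff powr_realpow)
    qed
    have 3: "bessel_coeff \<alpha> k = Gamma (\<alpha> + 1) / (2 ^ k * 2 ^ k * fact k * Gamma (b k))"
      by (simp add: bessel_coeff_def b_def add_ac mult_2 power_add)
    show ?thesis
      unfolding hv c_def C_def 1 2 3 using G s by (simp add: power_divide power_mult_distrib mult_ac)
  qed
  have nf: "norm (f k r) = c k * h k r" for k r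
    using c0[of k] h0[of k r] by (simp add: f_def abs_mult power_abs)
  have eq: "h k r = indicator {0<..} r * (r powr (2 * \<alpha> + 1) * exp (- s * r\<^sup>2 / 2)) * (r\<^sup>2) ^ k" for k r
  proof (cases "r > 0")
    case True
    have "2 * b k - 1 = (2 * \<alpha> + 1) + real (2 * k)" by (simp add: b_def)
    then have "r powr (2 * b k - 1) = r powr (2 * \<alpha> + 1) * (r\<^sup>2) ^ k"
      using True by (simp only: powr_add powr_realpow power_mult)
    then show ?thesis by (simp add: h_def)
  qed (simp add: h_def)
  have sumc: "summable (\<lambda>k. c k * h k r)" for r
  proof -
    have "summable (\<lambda>k. indicator {0<..} r * (r powr (2 * \<alpha> + 1) * exp (- s * r\<^sup>2 / 2)) * (bessel_coeff \<alpha> k * (l\<^sup>2 * r\<^sup>2) ^ k))"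
      by (intro summable_mult summable_bessel \<alpha>) auto
    then show ?thesis by (simp add: eq c_def power_mult_distrib mult_ac)
  qed
  have "(\<lambda>k. LINT r|lborel. f k r) sums (LINT r|lborel. (\<Sum>k. f k r))"
  proof (rule sums_integral)
    show "AE r in lborel. summable (\<lambda>k. norm (f k r))" unfolding nf using sumc by simp
    show "summable (\<lambda>k. LINT r|lborel. norm (f k r))"
      unfolding nf integral_mult_right_zero ch
      using summable_exp[of "l\<^sup>2 / (2 * s)"] by (intro summable_mult) (simp add: inverse_eq_divide)
  qed (rule fI)
  moreover have "(\<Sum>k. f k r) = indicator {0<..} r * (r powr (2 * \<alpha> + 1) * exp (- s * r\<^sup>2 / 2) * bessel_j \<alpha> (r * l))" for r
  proof -
    let ?g = "\<lambda>k. (-1) ^ k * bessel_coeff \<alpha> k * (r * l) ^ (2 * k)"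
    have "summable (\<lambda>k. norm (?g k))"
    proof -
      have "norm (?g k) = bessel_coeff \<alpha> k * ((r * l)\<^sup>2) ^ k" for k
        using bessel_coeff_bounds(1)[OF \<alpha>, of k]
        by (simp add: abs_mult power_mult power_abs power_mult_distrib)
      then show ?thesis
        using summable_bessel[OF \<alpha>, of "(r * l)\<^sup>2"] by (simp only: zero_le_power2)
    qed
    then have "summable ?g" by (rule summable_norm_cancel)
    note suminf_mult[OF this, of "indicator {0<..} r * (r powr (2 * \<alpha> + 1) * exp (- s * r\<^sup>2 / 2))"]
    moreover have "f k r = indicator {0<..} r * (r powr (2 * \<alpha> + 1) * exp (- s * r\<^sup>2 / 2)) * ?g k" for k
    proof -
      have "(r * l) ^ (2 * k) = (r\<^sup>2) ^ k * (l\<^sup>2) ^ k" by (simp only: power_mult power_mult_distrib)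
      then show ?thesis by (simp only: f_def c_def eq mult_ac)
    qed
    ultimately show ?thesis
      unfolding bessel_j_altdef[OF \<alpha>] by (simp only: mult_ac)
  qed
  moreover have "(LINT r|lborel. f k r) = C * ((- (l\<^sup>2 / (2 * s))) ^ k / fact k)" for k
  proof -
    have "(LINT r|lborel. f k r) = (-1) ^ k * (c k * (LINT r|lborel. h k r))"
      unfolding f_def by (simp only: integral_mult_right_zero mult.assoc)
    also have "\<dots> = C * ((- (l\<^sup>2 / (2 * s))) ^ k / fact k)"
      unfolding ch by (subst (2) power_minus) (simp add: mult_ac)
    finally show ?thesis .
  qed
  ultimately have "(\<lambda>k. C * ((- (l\<^sup>2 / (2 * s))) ^ k / fact k)) sums
      (LINT r|lborel. indicator {0<..} r * (r powr (2 * \<alpha> + 1) * exp (- s * r\<^sup>2 / 2) * bessel_j \<alpha> (r * l)))"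
    by simp
  moreover have "(\<lambda>k. C * ((- (l\<^sup>2 / (2 * s))) ^ k / fact k)) sums (C * exp (- (l\<^sup>2 / (2 * s))))"
  proof (rule sums_mult)
    have "x ^ k /\<^sub>R fact k = x ^ k / fact k" for x :: real and k
      by (simp add: divide_inverse_commute)
    then show "(\<lambda>k. (- (l\<^sup>2 / (2 * s))) ^ k / fact k) sums exp (- (l\<^sup>2 / (2 * s)))"
      using exp_converges[of "- (l\<^sup>2 / (2 * s))"] by (simp only:)
  qed
  ultimately show ?thesis
    unfolding C_def by (simp add: sums_unique2)
qed

text \<open>The characteristic function of the standard normal distribution, freed from the factor
  \<open>1 / sqrt (2 * pi)\<close>.\<close>

lemma integral_Gaussian_char_1:
  "integrable lborel (\<lambda>x::real. complex_of_real (exp (- x\<^sup>2 / 2)) * exp (\<i> * complex_of_real (t * x)))" (is ?A)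
  "(LINT x|lborel. complex_of_real (exp (- x\<^sup>2 / 2)) * exp (\<i> * complex_of_real (t * x)))
    = complex_of_real (sqrt (2 * pi) * exp (- t\<^sup>2 / 2))" (is ?B)
proof -
  have d: "std_normal_density x *\<^sub>R iexp (t * x) = complex_of_real (1 / sqrt (2 * pi)) *
      (complex_of_real (exp (- x\<^sup>2 / 2)) * exp (\<i> * complex_of_real (t * x)))" for x
    by (simp add: std_normal_density_def scaleR_conv_of_real)
  have "integrable lborel (\<lambda>x. std_normal_density x *\<^sub>R iexp (t * x))"
    by (rule Bochner_Integration.integrable_bound[OF integrable_std_normal_moment[of 0]])
      (auto intro!: AE_I2)
  from Bochner_Integration.integrable_mult_right[OF this, of "complex_of_real (sqrt (2 * pi))"]
  moreover have "complex_of_real (sqrt (2 * pi)) * (complex_of_real (1 / sqrt (2 * pi)) * z) = z" for z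
    by simp
  ultimately show ?A unfolding d by (simp only:)
  have "char std_normal_distribution t = (LINT x|lborel. std_normal_density x *\<^sub>R iexp (t * x))"
    unfolding char_def by (subst integral_density) (auto intro: AE_I2)
  then have "complex_of_real (exp (- (t^2) / 2)) = complex_of_real (1 / sqrt (2 * pi)) *
      (LINT x|lborel. complex_of_real (exp (- x\<^sup>2 / 2)) * exp (\<i> * complex_of_real (t * x)))"
    unfolding char_std_normal_distribution d by simp
  then show ?B by (simp add: field_simps)
qed

text \<open>The integrand is a product over the coordinates, and \<open>lborel\<close> is the image
  of the product measure over \<open>Basis\<close>, so the integral is a product of one-dimensional
  ones.\<close>

lemma integral_Gaussian_char:
  fixes v :: "'a::euclidean_space"
  shows "integrable lborel (\<lambda>x. complex_of_real (exp (- (norm x)\<^sup>2 / 2)) * exp (\<i> * complex_of_real (v \<bullet> x)))" (is ?A)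
  and "(LINT x|lborel. complex_of_real (exp (- (norm x)\<^sup>2 / 2)) * exp (\<i> * complex_of_real (v \<bullet> x)))
    = complex_of_real ((2 * pi) powr (DIM('a) / 2) * exp (- (norm v)\<^sup>2 / 2))" (is ?B)
proof -
  interpret product_sigma_finite "\<lambda>b::'a. lborel :: real measure"
    by (standard)
  define f where "f t x = complex_of_real (exp (- x\<^sup>2 / 2)) * exp (\<i> * complex_of_real (t * x))" for t x :: real
  have n2: "(norm x)\<^sup>2 = (\<Sum>b\<in>Basis. (x \<bullet> b)\<^sup>2)" for x :: 'a
    unfolding power2_norm_eq_inner by (subst euclidean_inner) (simp add: power2_eq_square)
  have prod: "complex_of_real (exp (- (norm x)\<^sup>2 / 2)) * exp (\<i> * complex_of_real (v \<bullet> x))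
      = (\<Prod>b\<in>Basis. f (v \<bullet> b) (x \<bullet> b))" for x :: 'a
  proof -
    have "exp (- (norm x)\<^sup>2 / 2) = (\<Prod>b\<in>Basis. exp (- (x \<bullet> b)\<^sup>2 / 2))"
      unfolding n2 by (simp add: exp_sum[symmetric] sum_divide_distrib sum_negf)
    moreover have "exp (\<i> * complex_of_real (v \<bullet> x)) = (\<Prod>b\<in>Basis. exp (\<i> * complex_of_real ((v \<bullet> b) * (x \<bullet> b))))"
      unfolding euclidean_inner[of v x] of_real_sum sum_distrib_left by (rule exp_sum) simp
    ultimately show ?thesis by (simp only: f_def prod.distrib of_real_prod)
  qed
  have [measurable]: "f t \<in> borel_measurable borel" for t unfolding f_def[abs_def] by measurable
  have e: "(\<Sum>c\<in>Basis. g c *\<^sub>R c) \<bullet> b = g b" if "b \<in> Basis" for g and b :: 'a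
    using that by (simp add: inner_sum_left inner_Basis if_distrib cong: if_cong)
  have fI: "integrable lborel (f t)" for t
    unfolding f_def[abs_def] by (rule integral_Gaussian_char_1)
  have I: "integrable (Pi\<^sub>M Basis (\<lambda>_. lborel)) (\<lambda>x. \<Prod>b\<in>(Basis::'a set). f (v \<bullet> b) (x b))"
    by (rule product_integrable_prod) (auto intro: fI)
  show ?A unfolding prod
    by (subst lborel_eq, subst integrable_distr_eq) (use I in \<open>auto simp: e cong: prod.cong\<close>)
  have "(LINT x|lborel. (\<Prod>b\<in>Basis. f (v \<bullet> b) (x \<bullet> b)))
     = (LINT x|Pi\<^sub>M Basis (\<lambda>_. lborel). (\<Prod>b\<in>(Basis::'a set). f (v \<bullet> b) (x b)))"
    by (subst lborel_eq, subst integral_distr) (auto simp: e cong: prod.cong)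
  also have "\<dots> = (\<Prod>b\<in>(Basis::'a set). LINT x|lborel. f (v \<bullet> b) x)"
    by (rule product_integral_prod) (auto intro: fI)
  also have "\<dots> = (\<Prod>b\<in>(Basis::'a set). complex_of_real (sqrt (2 * pi) * exp (- (v \<bullet> b)\<^sup>2 / 2)))"
    unfolding f_def by (simp only: integral_Gaussian_char_1)
  also have "\<dots> = complex_of_real (sqrt (2 * pi) ^ DIM('a) * exp (- (norm v)\<^sup>2 / 2))"
    unfolding n2 of_real_prod[symmetric]
    by (simp only: prod.distrib prod_constant) (simp add: exp_sum[symmetric] sum_divide_distrib sum_negf)
  also have "sqrt (2 * pi) ^ DIM('a) = (2 * pi) powr (DIM('a) / 2)"
    by (simp add: powr_half_sqrt[symmetric] powr_powr flip: powr_realpow)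
  finally show ?B unfolding prod .
qed

section \<open>The Weinstein measure and kernel\<close>

definition weinstein_density :: "real \<Rightarrow> (real ^ 'n::finite) \<times> real \<Rightarrow> real" where
  "weinstein_density \<alpha> x = snd x powr (2 * \<alpha> + 1) /
     ((2 * pi) powr (real CARD('n) / 2) * 2 powr \<alpha> * Gamma (\<alpha> + 1))"

lemma weinstein_measure_altdef:
  "weinstein_measure \<alpha> = density (restrict_space lborel half_space) (\<lambda>x. ennreal (weinstein_density \<alpha> x))"
  by (simp add: weinstein_measure_def weinstein_density_def)

lemma half_space_borel [measurable]: "half_space \<in> sets borel"
  unfolding half_space_def by (intro borel_open open_Times) auto

lemma space_weinstein_measure [simp]: "space (weinstein_measure \<alpha>) = half_space"
  by (simp add: weinstein_measure_def space_restrict_space)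

lemma sets_weinstein_measure: "sets (weinstein_measure \<alpha>) = sets (restrict_space borel half_space)"
  unfolding weinstein_measure_altdef by (simp add: sets_restrict_space)

lemma measurable_weinstein_measure:
  "f \<in> borel_measurable borel \<Longrightarrow> f \<in> borel_measurable (weinstein_measure \<alpha>)"
  by (subst measurable_cong_sets[OF sets_weinstein_measure refl]) (rule measurable_restrict_space1)

lemma measurable_weinstein_density [measurable]: "weinstein_density \<alpha> \<in> borel_measurable borel"
proof -
  have [measurable]: "snd \<in> borel_measurable (borel :: ((real ^ 'a) \<times> real) measure)"
    by (intro borel_measurable_continuous_onI continuous_intros)
  show ?thesis unfolding weinstein_density_def[abs_def] by measurable
qed

text \<open>Makes Fubini available, both for the measurability of
  \<open>weinstein_transform_L1\<close> and for the multiplication formula.\<close>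

lemma sigma_finite_weinstein_measure: "sigma_finite_measure (weinstein_measure \<alpha>)"
proof -
  interpret sigma_finite_measure "restrict_space lborel half_space :: ((real ^ 'n::finite) \<times> real) measure"
    by (rule sigma_finite_measure_restrict_space) (auto intro: sigma_finite_lborel)
  have [measurable]: "(\<lambda>x. ennreal (weinstein_density \<alpha> x)) \<in> borel_measurable
      (restrict_space lborel half_space :: ((real ^ 'n::finite) \<times> real) measure)"
    by (rule measurable_restrict_space1) measurable
  show "sigma_finite_measure (weinstein_measure \<alpha> :: ((real ^ 'n) \<times> real) measure)"
    unfolding weinstein_measure_altdef
    by (subst sigma_finite_iff_density_finite) auto
qed

lemma weinstein_kernel_commute: "weinstein_kernel \<alpha> l x = weinstein_kernel \<alpha> x l"
  by (simp add: weinstein_kernel_def inner_commute mult.commute)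

lemma cnj_weinstein_kernel: "cnj (weinstein_kernel \<alpha> l x) = weinstein_kernel \<alpha> (reflect l) x"
  by (simp add: weinstein_kernel_def reflect_def exp_cnj)

lemma reflect_reflect [simp]: "reflect (reflect x) = x"
  by (simp add: reflect_def)

lemma reflect_half_space [simp]: "reflect x \<in> half_space \<longleftrightarrow> x \<in> half_space"
  by (cases x) (simp add: reflect_def half_space_def)

lemma borel_measurable_reflect [measurable]: "reflect \<in> borel_measurable borel"
  unfolding reflect_def[abs_def] by (intro borel_measurable_continuous_onI continuous_intros)

text \<open>\<open>reflect\<close> is diagonal in the standard basis, with entry -1 at the vectors
  of the first factor, recognized by \<open>snd j = 0\<close>, and 1 at the last one. All entries
  have modulus 1.\<close>

lemma lborel_distr_reflect: "distr lborel borel reflect = (lborel :: ((real ^ 'n::finite) \<times> real) measure)"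
proof -
  define c where "c j = (if snd j = 0 then -1 else 1 :: real)" for j :: "(real ^ 'n) \<times> real"
  have T: "0 + (\<Sum>j\<in>Basis. (c j * (x \<bullet> j)) *\<^sub>R j) = reflect x" for x :: "(real ^ 'n) \<times> real"
  proof (rule euclidean_eqI)
    fix b :: "(real ^ 'n) \<times> real" assume b: "b \<in> Basis"
    have "(0 + (\<Sum>j\<in>Basis. (c j * (x \<bullet> j)) *\<^sub>R j)) \<bullet> b = c b * (x \<bullet> b)"
      using b by (simp add: inner_sum_left inner_Basis if_distrib cong: if_cong)
    also have "\<dots> = reflect x \<bullet> b"
      using b by (cases x) (auto simp: Basis_prod_def c_def reflect_def)
    finally show "(0 + (\<Sum>j\<in>Basis. (c j * (x \<bullet> j)) *\<^sub>R j)) \<bullet> b = reflect x \<bullet> b" .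
  qed
  have "c j \<noteq> 0" "\<bar>c j\<bar> = 1" for j by (auto simp: c_def)
  then show ?thesis
    using lborel_affine_euclidean[of c 0] unfolding T by (simp add: density_1)
qed

lemma integral_Gaussian_char_shift:
  fixes v w :: "'a::euclidean_space"
  shows "integrable lborel (\<lambda>x. complex_of_real (exp (- (norm (x - v))\<^sup>2 / 2)) * exp (\<i> * complex_of_real (w \<bullet> x)))" (is ?A)
  and "(LINT x|lborel. complex_of_real (exp (- (norm (x - v))\<^sup>2 / 2)) * exp (\<i> * complex_of_real (w \<bullet> x)))
    = exp (\<i> * complex_of_real (w \<bullet> v)) * complex_of_real ((2 * pi) powr (DIM('a) / 2) * exp (- (norm w)\<^sup>2 / 2))" (is ?B)
proof -
  let ?f = "\<lambda>x. complex_of_real (exp (- (norm (x - v))\<^sup>2 / 2)) * exp (\<i> * complex_of_real (w \<bullet> x))"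
  have [measurable]: "?f \<in> borel_measurable borel"
    by (intro borel_measurable_continuous_onI continuous_intros) auto
  have eq: "?f (v + x) = exp (\<i> * complex_of_real (w \<bullet> v)) *
      (complex_of_real (exp (- (norm x)\<^sup>2 / 2)) * exp (\<i> * complex_of_real (w \<bullet> x)))" for x
    by (simp add: inner_add_right distrib_left exp_add)
  show ?A
    by (subst lborel_distr_plus[of v, symmetric], subst integrable_distr_eq)
      (auto simp only: eq intro!: Bochner_Integration.integrable_mult_right integral_Gaussian_char, auto)
  show ?B
    by (subst lborel_distr_plus[of v, symmetric], subst integral_distr)
      (auto simp only: eq integral_mult_right_zero integral_Gaussian_char, auto)
qed

text \<open>The horizontal width is fixed. Only the parameters that the two kinds of multipliers
  move are kept: a phase shifts \<open>v\<close>, a Gaussian of the last coordinate increases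
  \<open>s\<close>.\<close>

definition wave :: "real ^ 'n \<Rightarrow> real \<Rightarrow> (real ^ 'n::finite) \<times> real \<Rightarrow> complex" where
  "wave v s x = exp (\<i> * complex_of_real (v \<bullet> fst x)) *
     complex_of_real (exp (- (norm (fst x))\<^sup>2 / 2) * exp (- s * (snd x)\<^sup>2 / 2))"

text \<open>The shape of the transform of a wave: modulation by \<open>v\<close> has become
  translation by \<open>v\<close>.\<close>

definition bump :: "real ^ 'n \<Rightarrow> real \<Rightarrow> (real ^ 'n::finite) \<times> real \<Rightarrow> complex" where
  "bump v s x = complex_of_real (exp (- (norm (fst x - v))\<^sup>2 / 2) * exp (- s * (snd x)\<^sup>2 / 2))"

lemma bump_reflect: "bump v s (reflect x) = bump (- v) s x"
proof -
  have "norm (- fst x - v) = norm (fst x + v)" by (metis minus_add_distrib norm_minus_cancel diff_conv_add_uminus)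
  then show ?thesis by (simp add: bump_def reflect_def)
qed

lemma integrable_mult_bounded:
  fixes f b :: "'a \<Rightarrow> complex"
  assumes "integrable M f" "b \<in> borel_measurable M" "AE x in M. cmod (b x) \<le> K"
  shows "integrable M (\<lambda>x. b x * f x)"
proof (rule Bochner_Integration.integrable_bound)
  show "integrable M (\<lambda>x. complex_of_real K * f x)" using assms(1) by simp
  show "AE x in M. norm (b x * f x) \<le> norm (complex_of_real K * f x)"
    using assms(3) by eventually_elim (auto simp: norm_mult intro!: mult_right_mono)
qed (use assms in auto)

lemma bounded_integrable_imp_sqint:
  assumes "integrable M f" "AE x in M. cmod (f x) \<le> K"
  shows "sqint M f"
proof (rule sqint_bound)
  show "integrable M (\<lambda>x. K * cmod (f x))" using assms(1) by simp
  show "AE x in M. (cmod (f x))\<^sup>2 \<le> K * cmod (f x)"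
    using assms(2) by eventually_elim (auto simp: power2_eq_square intro!: mult_right_mono)
qed (use assms in auto)



lemma L2_altdef: "L2 \<alpha> = {f. sqint (weinstein_measure \<alpha>) f}"
  by (simp add: L2_def sqint_def)

lemma L2_norm_altdef: "L2_norm \<alpha> f = nrm2 (weinstein_measure \<alpha>) f"
  by (simp add: L2_norm_def nrm2_def)

text \<open>Small values are cut off: where \<open>cmod (f x) \<ge> 1 / n\<close> one has
  \<open>cmod (f x) \<le> n * (cmod (f x))\<^sup>2\<close>, so the truncation is integrable, and it
  differs from \<open>f\<close> by at most \<open>f\<close>.\<close>

lemma sqint_approx_integrable:
  assumes f: "sqint M f"
  obtains u where "\<And>n::nat. integrable M (u n)" "\<And>n. sqint M (u n)"
    "(\<lambda>n. nrm2 M (\<lambda>x. u n x - f x)) \<longlonglongrightarrow> 0"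
proof -
  have [measurable]: "f \<in> borel_measurable M" using f by (simp add: sqint_def)
  define u where "u n x = (if cmod (f x) * real n \<ge> 1 then f x else 0)" for n :: nat and x
  have [measurable]: "u n \<in> borel_measurable M" for n unfolding u_def[abs_def] by measurable
  have "(\<lambda>n. LINT x|M. (cmod (u n x - f x))\<^sup>2) \<longlonglongrightarrow> (LINT x|M. 0)"
  proof (rule integral_dominated_convergence)
    show "integrable M (\<lambda>x. (cmod (f x))\<^sup>2)" using f by (rule sqint_integrable)
    show "AE x in M. (\<lambda>n. (cmod (u n x - f x))\<^sup>2) \<longlonglongrightarrow> 0"
    proof (intro AE_I2 tendsto_eventually)
      fix x
      show "\<forall>\<^sub>F n in sequentially. (cmod (u n x - f x))\<^sup>2 = 0"
      proof (cases "f x = 0")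
        case False
        then obtain N :: nat where "1 / cmod (f x) \<le> real N" using real_arch_simple by blast
        then have N: "1 \<le> cmod (f x) * real N" using False by (simp add: divide_le_eq mult.commute)
        have "1 \<le> cmod (f x) * real n" if "n \<ge> N" for n
          by (rule order_trans[OF N]) (use that in \<open>auto intro!: mult_left_mono\<close>)
        then show ?thesis by (intro eventually_sequentiallyI[of N]) (simp add: u_def)
      qed (simp add: u_def)
    qed
    show "AE x in M. norm ((cmod (u n x - f x))\<^sup>2) \<le> (cmod (f x))\<^sup>2" for n
      by (intro AE_I2) (auto simp: u_def)
  qed measurable
  then have lim: "(\<lambda>n. nrm2 M (\<lambda>x. u n x - f x)) \<longlonglongrightarrow> 0"
    using tendsto_real_sqrt by (fastforce simp: nrm2_def)
  have sq: "sqint M (u n)" for n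
    by (rule sqint_bound[OF sqint_integrable[OF f]]) (auto simp: u_def)
  have "integrable M (u n)" for n
  proof (rule Bochner_Integration.integrable_bound)
    show "integrable M (\<lambda>x. real n * (cmod (f x))\<^sup>2)" using f by (simp add: sqint_def)
    show "AE x in M. norm (u n x) \<le> norm (real n * (cmod (f x))\<^sup>2)"
    proof (rule AE_I2)
      fix x
      have "cmod (f x) \<le> cmod (f x) * (cmod (f x) * real n)" if "cmod (f x) * real n \<ge> 1"
        using mult_left_mono[OF that norm_ge_zero, of "f x"] by simp
      then show "norm (u n x) \<le> norm (real n * (cmod (f x))\<^sup>2)"
        by (auto simp: u_def power2_eq_square mult_ac)
    qed
  qed measurable
  with sq lim show ?thesis using that by blast
qed

text \<open>Dilations preserve null sets. This carries the bound on \<open>m\<close> and its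
  nonvanishing over to \<open>m (\<sigma> *\<^sub>R \<xi>)\<close>.\<close>

lemma AE_lborel_scale:
  fixes P :: "'a::euclidean_space \<Rightarrow> bool"
  assumes "\<sigma> \<noteq> 0" "AE x in lborel. P x"
  shows "AE x in lborel. P (\<sigma> *\<^sub>R x)"
proof -
  let ?D = "distr lborel borel (\<lambda>x::'a. 0 + \<sigma> *\<^sub>R x)"
  have "AE x in density ?D (\<lambda>_. ennreal (\<bar>\<sigma>\<bar> ^ DIM('a))). P x"
    unfolding lborel_affine[OF assms(1), of "0 :: 'a", symmetric] by (rule assms(2))
  then have "AE x in ?D. P x"
    using assms(1) by (subst (asm) AE_density) auto
  then have "AE x in lborel. P (0 + \<sigma> *\<^sub>R x)"
    by (rule AE_distrD[rotated]) measurable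
  then show ?thesis by simp
qed

lemma measurable_scale_weinstein:
  assumes "\<sigma> > 0"
  shows "(\<lambda>x. \<sigma> *\<^sub>R x) \<in> measurable (weinstein_measure \<alpha>) (weinstein_measure \<alpha>)"
  by (subst measurable_cong_sets[OF sets_weinstein_measure sets_weinstein_measure])
    (use assms in \<open>auto intro!: measurable_restrict_space3 simp: half_space_def\<close>)

text \<open>Applied with \<open>z = \<eta> * \<zeta> \<xi>\<close>. The weights are real, so the
  identity splits into one for the real and one for the imaginary parts.\<close>

lemma complete_square:
  assumes "z + M > (0::real)"
  shows "z * (cmod a)\<^sup>2 + M * (cmod (p - a))\<^sup>2 =
    (z + M) * (cmod (a - complex_of_real (M / (z + M)) * p))\<^sup>2 + z * M / (z + M) * (cmod p)\<^sup>2"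
proof -
  have r: "z * x\<^sup>2 + M * (y - x)\<^sup>2 = (z + M) * (x - M / (z + M) * y)\<^sup>2 + z * M / (z + M) * y\<^sup>2" for x y :: real
  proof -
    define d where "d = z + M"
    have d: "d > 0" "z = d - M" using assms by (auto simp: d_def)
    show ?thesis unfolding d_def[symmetric] unfolding d(2) using d(1)
      by (simp add: field_simps power2_eq_square)
  qed
  show ?thesis
    using r[of "Re a" "Re p"] r[of "Im a" "Im p"] by (simp add: cmod_power2 distrib_left)
qed

section \<open>The weighted measure and the transform of integrable functions\<close>

locale weinstein =
  fixes \<alpha> :: real
  assumes \<alpha>: "\<alpha> > - 1 / 2"
begin

abbreviation W :: "((real ^ 'n::finite) \<times> real) measure" where
  "W \<equiv> weinstein_measure \<alpha>"

abbreviation F :: "((real ^ 'n::finite) \<times> real \<Rightarrow> complex) \<Rightarrow> (real ^ 'n) \<times> real \<Rightarrow> complex" where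
  "F \<equiv> weinstein_transform_L1 \<alpha>"

abbreviation T :: "((real ^ 'n::finite) \<times> real \<Rightarrow> complex) \<Rightarrow> (real ^ 'n) \<times> real \<Rightarrow> complex" where
  "T \<equiv> weinstein_transform \<alpha>"

lemma weinstein_density_pos: "x \<in> half_space \<Longrightarrow> weinstein_density \<alpha> x > 0"
  using \<alpha> by (auto simp: weinstein_density_def half_space_def intro!: divide_pos_pos mult_pos_pos Gamma_real_pos)

lemma weinstein_density_nonneg: "weinstein_density \<alpha> x \<ge> 0"
  using \<alpha> Gamma_real_pos[of "\<alpha> + 1"] by (auto simp: weinstein_density_def)

text \<open>The density is strictly positive on the half-space, so there the null sets are those of
  Lebesgue measure.\<close>

lemma AE_weinstein_measure:
  "(AE x in W. P x) \<longleftrightarrow> (AE x in lborel. x \<in> half_space \<longrightarrow> P x)"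
proof -
  have [measurable]: "(\<lambda>x. ennreal (weinstein_density \<alpha> x)) \<in> borel_measurable (restrict_space lborel half_space)"
    by (rule measurable_restrict_space1) measurable
  show ?thesis
    unfolding weinstein_measure_altdef
    by (subst AE_density) (auto simp: AE_restrict_space_iff weinstein_density_pos cong: imp_cong conj_cong)
qed

lemma nn_integral_weinstein_measure:
  assumes "f \<in> borel_measurable borel"
  shows "(\<integral>\<^sup>+x. f x \<partial>W) =
    (\<integral>\<^sup>+x. ennreal (weinstein_density \<alpha> x) * f x * indicator half_space x \<partial>lborel)"
  unfolding weinstein_measure_altdef using assms
  by (subst nn_integral_density) (auto simp: nn_integral_restrict_space intro!: measurable_restrict_space1)

lemma
  fixes f :: "(real ^ 'n::finite) \<times> real \<Rightarrow> complex"
  assumes f: "f \<in> borel_measurable borel"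
  shows integrable_weinstein_measure: "integrable W f \<longleftrightarrow>
      integrable lborel (\<lambda>x. indicator half_space x *\<^sub>R weinstein_density \<alpha> x *\<^sub>R f x)"
    and integral_weinstein_measure: "(LINT x|W. f x) =
      (LINT x|lborel. indicator half_space x *\<^sub>R weinstein_density \<alpha> x *\<^sub>R f x)"
proof -
  have m: "f \<in> borel_measurable (restrict_space lborel half_space)"
    "weinstein_density \<alpha> \<in> borel_measurable (restrict_space lborel half_space)"
    using f by (auto intro!: measurable_restrict_space1)
  show "integrable W f \<longleftrightarrow>
      integrable lborel (\<lambda>x. indicator half_space x *\<^sub>R weinstein_density \<alpha> x *\<^sub>R f x)"
    unfolding weinstein_measure_altdef
    by (subst integrable_density[OF m]) (auto simp: weinstein_density_nonneg integrable_restrict_space)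
  show "(LINT x|W. f x) =
      (LINT x|lborel. indicator half_space x *\<^sub>R weinstein_density \<alpha> x *\<^sub>R f x)"
    unfolding weinstein_measure_altdef
    by (subst integral_density[OF m]) (auto simp: weinstein_density_nonneg integral_restrict_space)
qed

text \<open>The density depends on the last coordinate alone. It is absorbed into the factor
  \<open>G\<close>, after which Fubini separates the variables.\<close>

lemma
  fixes f :: "real ^ 'n::finite \<Rightarrow> complex" and g :: "real \<Rightarrow> complex"
  assumes f: "integrable lborel f" and g [measurable]: "g \<in> borel_measurable borel"
    and gI: "integrable lborel (\<lambda>r. complex_of_real (indicator {0<..} r * r powr (2 * \<alpha> + 1)) * g r)"
  shows integrable_weinstein_prod: "integrable W (\<lambda>x. f (fst x) * g (snd x))" (is ?A)
    and integral_weinstein_prod: "(LINT x|W. f (fst x) * g (snd x)) =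
      (LINT x|lborel. f x) * (LINT r|lborel. complex_of_real (indicator {0<..} r * r powr (2 * \<alpha> + 1)) * g r) /
      complex_of_real ((2 * pi) powr (real CARD('n) / 2) * 2 powr \<alpha> * Gamma (\<alpha> + 1))" (is ?B)
proof -
  define c where "c = (2 * pi) powr (real CARD('n) / 2) * 2 powr \<alpha> * Gamma (\<alpha> + 1)"
  define G where "G r = complex_of_real (indicator {0<..} r * r powr (2 * \<alpha> + 1)) * g r" for r
  have G: "integrable lborel G" using gI by (simp only: G_def[abs_def])
  have [measurable]: "f \<in> borel_measurable borel" "G \<in> borel_measurable borel"
    using borel_measurable_integrable[OF f] borel_measurable_integrable[OF G] by auto
  have eq: "indicator half_space x *\<^sub>R weinstein_density \<alpha> x *\<^sub>R (f (fst x) * g (snd x)) =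
      (f (fst x) * G (snd x)) / complex_of_real c" for x
    by (cases x) (auto simp: G_def weinstein_density_def c_def half_space_def indicator_def scaleR_conv_of_real)
  have I: "integrable (lborel \<Otimes>\<^sub>M lborel) (\<lambda>x. f (fst x) * G (snd x))"
  proof (rule lborel_pair.Fubini_integrable)
    show "(\<lambda>x. f (fst x) * G (snd x)) \<in> borel_measurable (lborel \<Otimes>\<^sub>M lborel)" by measurable
    show "integrable lborel (\<lambda>x. LINT y|lborel. norm (f (fst (x, y)) * G (snd (x, y))))"
      using f by (simp add: norm_mult)
    show "AE x in lborel. integrable lborel (\<lambda>y. f (fst (x, y)) * G (snd (x, y)))"
      using G by simp
  qed
  have m: "(\<lambda>x. f (fst x) * g (snd x)) \<in> borel_measurable borel"
    unfolding borel_prod[symmetric] by measurable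
  show ?A
    unfolding integrable_weinstein_measure[OF m] eq using I
    by (simp add: lborel_prod)
  have "(LINT x|W. f (fst x) * g (snd x)) =
      (LINT x|lborel. f (fst x) * G (snd x)) / complex_of_real c"
    unfolding integral_weinstein_measure[OF m] eq by simp
  also have "(LINT x|lborel. f (fst x) * G (snd x)) = (LINT x|lborel. LINT y|lborel. f x * G y)"
    using lborel_pair.integral_fst'[OF I] by (simp add: lborel_prod)
  also have "\<dots> = (LINT x|lborel. f x) * (LINT y|lborel. G y)"
    by simp
  finally show ?B by (simp add: c_def G_def)
qed

lemma cmod_weinstein_kernel_le_1: "cmod (weinstein_kernel \<alpha> l x) \<le> 1"
  using abs_bessel_j_le_1[OF \<alpha>] by (simp add: weinstein_kernel_def norm_mult)

lemma measurable_weinstein_kernel [measurable (raw)]: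
  assumes "f \<in> borel_measurable M" "g \<in> borel_measurable M"
  shows "(\<lambda>x. weinstein_kernel \<alpha> (f x) (g x)) \<in> borel_measurable M"
proof -
  have "fst \<in> borel_measurable (borel :: ((real ^ 'n::finite) \<times> real) measure)"
      "snd \<in> borel_measurable (borel :: ((real ^ 'n) \<times> real) measure)"
    by (auto intro!: borel_measurable_continuous_onI continuous_intros)
  note [measurable] = borel_measurable_bessel_j[OF \<alpha>] assms measurable_compose[OF assms(1) this(1)]
    measurable_compose[OF assms(1) this(2)] measurable_compose[OF assms(2) this(1)]
    measurable_compose[OF assms(2) this(2)]
  show ?thesis
    unfolding weinstein_kernel_def by measurable
qed

lemma measurable_reflect_weinstein [measurable]:
  "reflect \<in> measurable W W"
  by (subst measurable_cong_sets[OF sets_weinstein_measure sets_weinstein_measure])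
    (auto intro!: measurable_restrict_space3)

text \<open>\<open>reflect\<close> preserves Lebesgue measure and keeps \<open>snd x\<close>, the
  only thing the density depends on.\<close>

lemma distr_weinstein_reflect:
  "distr W W reflect = W"
proof -
  show ?thesis
  proof (rule measure_eqI)
    fix A assume "A \<in> sets (distr W W reflect)"
    then have A: "A \<in> sets W" by simp
    then have "A \<in> sets (restrict_space borel half_space)" by (simp add: sets_weinstein_measure)
    then have Ah: "A \<subseteq> half_space" and [measurable]: "A \<in> sets borel"
      by (auto simp: sets_restrict_space_iff)
    have "x \<in> half_space" if "reflect x \<in> A" for x
      using subsetD[OF Ah that] by (simp only: reflect_half_space)
    then have rA: "reflect -` A \<subseteq> half_space" by auto
    then have eqA: "reflect -` A \<inter> space W = reflect -` A" by auto
    have B: "emeasure W B = (\<integral>\<^sup>+x. ennreal (weinstein_density \<alpha> x) * indicator B x \<partial>lborel)"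
      if "B \<subseteq> half_space" and [measurable]: "B \<in> sets borel" for B
    proof -
      have "B \<in> sets W" using that by (simp add: sets_weinstein_measure sets_restrict_space_iff)
      then have "emeasure W B = (\<integral>\<^sup>+x. indicator B x \<partial>W)" by simp
      also have "\<dots> = (\<integral>\<^sup>+x. ennreal (weinstein_density \<alpha> x) * indicator B x * indicator half_space x \<partial>lborel)"
        by (rule nn_integral_weinstein_measure) measurable
      also have "\<dots> = (\<integral>\<^sup>+x. ennreal (weinstein_density \<alpha> x) * indicator B x \<partial>lborel)"
        using that by (intro nn_integral_cong) (auto simp: indicator_def)
      finally show ?thesis .
    qed
    have r[measurable]: "reflect -` A \<in> sets borel"
      using measurable_sets[OF borel_measurable_reflect, of A] by simp
    have "emeasure (distr W W reflect) A = emeasure W (reflect -` A)"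
      unfolding emeasure_distr[OF measurable_reflect_weinstein A] eqA ..
    also have "\<dots> = (\<integral>\<^sup>+x. ennreal (weinstein_density \<alpha> x) * indicator (reflect -` A) x \<partial>lborel)"
      by (intro B r rA)
    also have "\<dots> = (\<integral>\<^sup>+x. ennreal (weinstein_density \<alpha> (reflect x)) * indicator A (reflect x) \<partial>lborel)"
      by (simp add: weinstein_density_def reflect_def indicator_def vimage_def)
    also have "\<dots> = (\<integral>\<^sup>+x. ennreal (weinstein_density \<alpha> x) * indicator A x \<partial>distr lborel borel reflect)"
      by (subst nn_integral_distr) auto
    also have "\<dots> = emeasure W A"
      unfolding lborel_distr_reflect using Ah by (intro B[symmetric]) auto
    finally show "emeasure (distr W W reflect) A = emeasure W A" .
  qed simp
qed

lemma integral_reflect: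
  fixes f :: "_ \<Rightarrow> 'b :: {banach, second_countable_topology}"
  assumes "f \<in> borel_measurable W"
  shows "(LINT x|W. f (reflect x)) = (LINT x|W. f x)"
  using integral_distr[OF measurable_reflect_weinstein assms] by (simp add: distr_weinstein_reflect)

lemma integrable_reflect:
  fixes f :: "_ \<Rightarrow> 'b :: {banach, second_countable_topology}"
  assumes "integrable W f"
  shows "integrable W (\<lambda>x. f (reflect x))"
  using integrable_distr[OF measurable_reflect_weinstein, of f] assms by (simp add: distr_weinstein_reflect)

lemma AE_reflect:
  assumes "AE x in W. P x"
  shows "AE x in W. P (reflect x)"
proof (rule AE_distrD[OF measurable_reflect_weinstein])
  show "AE x in distr W W reflect. P x"
    unfolding distr_weinstein_reflect by fact
qed

lemma integrable_mult_weinstein_kernel: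
  assumes "integrable W f"
  shows "integrable W (\<lambda>x. f x * weinstein_kernel \<alpha> l x)"
proof (rule Bochner_Integration.integrable_bound[OF assms])
  show "(\<lambda>x. f x * weinstein_kernel \<alpha> l x) \<in> borel_measurable W"
    using assms by (intro borel_measurable_times measurable_weinstein_kernel)
      (auto intro: measurable_weinstein_measure)
  show "AE x in W. norm (f x * weinstein_kernel \<alpha> l x) \<le> norm (f x)"
    by (intro AE_I2) (simp add: norm_mult mult_left_le cmod_weinstein_kernel_le_1)
qed

lemma cmod_weinstein_transform_L1_le:
  assumes "integrable W f"
  shows "cmod (F f l) \<le> (LINT x|W. cmod (f x))"
  unfolding weinstein_transform_L1_def
  by (rule Bochner_Integration.integral_norm_bound_integral[OF integrable_mult_weinstein_kernel[OF assms]])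
    (use assms in \<open>simp_all add: norm_mult mult_left_le cmod_weinstein_kernel_le_1\<close>)

lemma measurable_weinstein_transform_L1:
  fixes f :: "(real ^ 'n::finite) \<times> real \<Rightarrow> complex"
  assumes f [measurable]: "f \<in> borel_measurable W"
  shows "F f \<in> borel_measurable W"
proof -
  interpret sigma_finite_measure "W :: ((real ^ 'n) \<times> real) measure"
    by (rule sigma_finite_weinstein_measure)
  have id: "(\<lambda>x. x) \<in> borel_measurable (W :: ((real ^ 'n) \<times> real) measure)"
    by (rule measurable_weinstein_measure) simp
  show ?thesis
    unfolding weinstein_transform_L1_def[abs_def]
    by (intro borel_measurable_lebesgue_integral)
      (auto simp: split_beta' intro!: borel_measurable_times measurable_weinstein_kernel measurable_compose[OF _ f]
        measurable_compose[OF measurable_fst id] measurable_compose[OF measurable_snd id])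
qed

lemma weinstein_transform_L1_add:
  assumes "integrable W f" "integrable W g"
  shows "F (\<lambda>x. f x + g x) l = F f l + F g l"
  using assms by (simp add: weinstein_transform_L1_def distrib_right integrable_mult_weinstein_kernel)

lemma weinstein_transform_L1_cmult:
  "F (\<lambda>x. c * f x) l = c * F f l"
  by (simp add: weinstein_transform_L1_def mult.assoc)

lemma weinstein_transform_L1_diff:
  assumes "integrable W f" "integrable W g"
  shows "F (\<lambda>x. f x - g x) l = F f l - F g l"
  using assms by (simp add: weinstein_transform_L1_def left_diff_distrib integrable_mult_weinstein_kernel)

lemma weinstein_transform_L1_cnj:
  "F (\<lambda>x. cnj (f x)) l = cnj (F f (reflect l))"
  unfolding weinstein_transform_L1_def
  by (subst Bochner_Integration.integral_cnj[symmetric]) (simp add: cnj_weinstein_kernel del: Bochner_Integration.integral_cnj)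

text \<open>Fubini together with the symmetry of the kernel in its two arguments. This is the device
  that turns inversion into isometry.\<close>

lemma weinstein_multiplication_formula:
  fixes f g :: "(real ^ 'n::finite) \<times> real \<Rightarrow> complex"
  assumes f: "integrable W f" and g: "integrable W g"
  shows "(LINT l|W. F f l * g l) =
    (LINT x|W. f x * F g x)"
proof -
  let ?W = "W :: ((real ^ 'n) \<times> real) measure"
  interpret sigma_finite_measure ?W by (rule sigma_finite_weinstein_measure)
  interpret P: pair_sigma_finite ?W ?W ..
  have id: "(\<lambda>x. x) \<in> borel_measurable ?W"
    by (rule measurable_weinstein_measure) simp
  have [measurable]: "f \<in> borel_measurable ?W" "g \<in> borel_measurable ?W" using f g by auto
  have I: "integrable (?W \<Otimes>\<^sub>M ?W) (\<lambda>p. f (fst p) * g (snd p))"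
  proof (rule P.Fubini_integrable)
    show "integrable ?W (\<lambda>x. LINT y|?W. norm (f (fst (x, y)) * g (snd (x, y))))"
      using f by (simp add: norm_mult)
  qed (use g in auto)
  have "integrable (?W \<Otimes>\<^sub>M ?W) (\<lambda>(x, l). f x * weinstein_kernel \<alpha> l x * g l)"
  proof (rule Bochner_Integration.integrable_bound[OF I])
    show "(\<lambda>(x, l). f x * weinstein_kernel \<alpha> l x * g l) \<in> borel_measurable (?W \<Otimes>\<^sub>M ?W)"
      unfolding split_beta'
      by (intro borel_measurable_times measurable_weinstein_kernel measurable_compose[OF measurable_fst id]
          measurable_compose[OF measurable_snd id]) measurable
    show "AE p in ?W \<Otimes>\<^sub>M ?W. norm (case p of (x, l) \<Rightarrow> f x * weinstein_kernel \<alpha> l x * g l) \<le> norm (f (fst p) * g (snd p))"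
      by (intro AE_I2) (simp add: split_beta' norm_mult mult_left_le mult_right_mono cmod_weinstein_kernel_le_1)
  qed
  note Fubini = P.Fubini_integral[OF this]
  have 1: "F f l * g l = (LINT x|?W. f x * weinstein_kernel \<alpha> l x * g l)" for l
    unfolding weinstein_transform_L1_def by (rule integral_mult_left_zero[symmetric])
  have 2: "f x * F g x = (LINT l|?W. f x * weinstein_kernel \<alpha> l x * g l)" for x
  proof -
    have "F g x = (LINT l|?W. weinstein_kernel \<alpha> l x * g l)"
      unfolding weinstein_transform_L1_def
      by (intro Bochner_Integration.integral_cong refl)
        (simp add: mult.commute weinstein_kernel_commute[of \<alpha> x])
    then show ?thesis by (simp only: mult.assoc integral_mult_right_zero)
  qed
  show ?thesis unfolding 1 2 by (rule Fubini)
qed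

section \<open>Transforms of Gaussians\<close>

text \<open>The factor \<open>q\<close> stands for the constant 1 or for a Bessel function.\<close>

lemma integrable_radial_Gaussian:
  assumes s: "s > 0" and q: "q \<in> borel_measurable borel" "\<And>r. \<bar>q r\<bar> \<le> 1"
  shows "integrable lborel (\<lambda>r. complex_of_real (indicator {0<..} r * r powr (2 * \<alpha> + 1)) *
      complex_of_real (exp (- s * r\<^sup>2 / 2) * q r))"
proof -
  let ?g = "\<lambda>r. indicator {0<..} r * (r powr (2 * (\<alpha> + 1) - 1) * exp (- s * r\<^sup>2 / 2))"
  have "integrable lborel ?g"
    by (rule integral_Gamma_Gaussian) (use \<alpha> s in auto)
  then have "integrable lborel (\<lambda>r. complex_of_real (q r) * complex_of_real (?g r))"
    using q(1) by (intro integrable_mult_bounded[where K = 1] integrable_of_real) (simp_all add: q(2))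
  moreover have "2 * (\<alpha> + 1) - 1 = 2 * \<alpha> + 1" by simp
  ultimately show ?thesis
    by (simp only: of_real_mult mult_ac)
qed

lemma integrable_wave:
  assumes s: "s > 0" shows "integrable W (wave v s)"
  and "integrable W (bump v s)"
proof -
  have "integrable W (\<lambda>x. (complex_of_real (exp (- (norm (fst x))\<^sup>2 / 2)) * exp (\<i> * complex_of_real (v \<bullet> fst x)))
     * complex_of_real (exp (- s * (snd x)\<^sup>2 / 2) * 1))"
    by (intro integrable_weinstein_prod integral_Gaussian_char integrable_radial_Gaussian s) auto
  then show "integrable W (wave v s)"
    by (simp add: wave_def[abs_def] mult_ac)
  have "integrable W (\<lambda>x. (complex_of_real (exp (- (norm (fst x - v))\<^sup>2 / 2)) * exp (\<i> * complex_of_real (0 \<bullet> fst x)))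
     * complex_of_real (exp (- s * (snd x)\<^sup>2 / 2) * 1))"
    by (intro integrable_weinstein_prod integral_Gaussian_char_shift integrable_radial_Gaussian s) auto
  then show "integrable W (bump v s)"
    by (simp add: bump_def[abs_def])
qed

text \<open>The radial half of the transform, with an arbitrary horizontal factor \<open>f\<close>
  that already contains the phase of the kernel; thus it serves waves and bumps alike. The constants
  \<open>2 powr \<alpha> * Gamma (\<alpha> + 1)\<close> of the measure cancel here.\<close>

lemma radial_transform:
  fixes f :: "real ^ 'n::finite \<Rightarrow> complex"
  assumes s: "s > 0" and f: "integrable lborel f"
  shows "(LINT x|W. f (fst x) * complex_of_real (exp (- s * (snd x)\<^sup>2 / 2) * bessel_j \<alpha> (snd x * l)))
    = (LINT x|lborel. f x) * complex_of_real (s powr (- (\<alpha> + 1)) * exp (- l\<^sup>2 / (2 * s)) / (2 * pi) powr (real CARD('n) / 2))"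
proof -
  have "(LINT x|W. f (fst x) * complex_of_real (exp (- s * (snd x)\<^sup>2 / 2) * bessel_j \<alpha> (snd x * l)))
    = (LINT x|lborel. f x) * (LINT r|lborel. complex_of_real (indicator {0<..} r * r powr (2 * \<alpha> + 1)) *
       complex_of_real (exp (- s * r\<^sup>2 / 2) * bessel_j \<alpha> (r * l))) /
      complex_of_real ((2 * pi) powr (real CARD('n) / 2) * 2 powr \<alpha> * Gamma (\<alpha> + 1))"
  proof (intro integral_weinstein_prod f integrable_radial_Gaussian s abs_bessel_j_le_1[OF \<alpha>])
    show m: "(\<lambda>r. bessel_j \<alpha> (r * l)) \<in> borel_measurable borel"
      by (rule measurable_compose[OF _ borel_measurable_bessel_j[OF \<alpha>]]) measurable
    then show "(\<lambda>r. complex_of_real (exp (- s * r\<^sup>2 / 2) * bessel_j \<alpha> (r * l))) \<in> borel_measurable borel"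
      by measurable
  qed
  also have "(LINT r|lborel. complex_of_real (indicator {0<..} r * r powr (2 * \<alpha> + 1)) *
       complex_of_real (exp (- s * r\<^sup>2 / 2) * bessel_j \<alpha> (r * l))) =
       complex_of_real (LINT r|lborel. indicator {0<..} r * (r powr (2 * \<alpha> + 1) * exp (- s * r\<^sup>2 / 2) * bessel_j \<alpha> (r * l)))"
    by (subst integral_complex_of_real[symmetric]) (simp only: of_real_mult mult.assoc)
  also have "\<dots> = complex_of_real (2 powr \<alpha> * Gamma (\<alpha> + 1) * (s powr (- (\<alpha> + 1)) * exp (- l\<^sup>2 / (2 * s))))"
    unfolding integral_bessel_Gaussian[OF \<alpha> s] by (simp only: mult.assoc)
  finally have eq: "(LINT x|W. f (fst x) * complex_of_real (exp (- s * (snd x)\<^sup>2 / 2) * bessel_j \<alpha> (snd x * l)))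
    = (LINT x|lborel. f x) * complex_of_real (2 powr \<alpha> * Gamma (\<alpha> + 1) * (s powr (- (\<alpha> + 1)) * exp (- l\<^sup>2 / (2 * s)))) /
      complex_of_real ((2 * pi) powr (real CARD('n) / 2) * 2 powr \<alpha> * Gamma (\<alpha> + 1))" .
  have "Gamma (\<alpha> + 1) > 0" using \<alpha> by (intro Gamma_real_pos) auto
  then show ?thesis unfolding eq by simp
qed

text \<open>The phases of wave and kernel merge into the frequency \<open>v - fst l\<close>, which
  centres the resulting Gaussian at \<open>v\<close>. The power of \<open>2 * pi\<close> in the
  measure cancels that of the Gaussian integral.\<close>

lemma weinstein_transform_wave:
  assumes s: "s > 0"
  shows "F (wave v s) l = complex_of_real (s powr (- (\<alpha> + 1))) * bump v (1 / s) l"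
proof -
  have eq: "wave v s x * weinstein_kernel \<alpha> l x =
      (complex_of_real (exp (- (norm (fst x))\<^sup>2 / 2)) * exp (\<i> * complex_of_real ((v - fst l) \<bullet> fst x))) *
      complex_of_real (exp (- s * (snd x)\<^sup>2 / 2) * bessel_j \<alpha> (snd x * snd l))" for x
  proof -
    have "exp (\<i> * complex_of_real ((v - fst l) \<bullet> fst x)) =
        exp (\<i> * complex_of_real (v \<bullet> fst x)) * exp (- \<i> * complex_of_real (fst x \<bullet> fst l))"
      by (simp add: inner_diff_left right_diff_distrib exp_add[symmetric] inner_commute[of "fst l"])
    then show ?thesis
      by (simp only: wave_def weinstein_kernel_def of_real_mult mult_ac)
  qed
  have "exp (- (snd l)\<^sup>2 / (2 * s)) = exp (- (1 / s) * (snd l)\<^sup>2 / 2)" by simp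
  then show ?thesis
    unfolding weinstein_transform_L1_def eq radial_transform[OF s integral_Gaussian_char(1)]
      integral_Gaussian_char(2)
    by (simp add: bump_def norm_minus_commute)
qed

lemma weinstein_transform_bump:
  assumes s: "s > 0"
  shows "F (bump v s) l = complex_of_real (s powr (- (\<alpha> + 1))) * wave (- v) (1 / s) l"
proof -
  have eq: "bump v s x * weinstein_kernel \<alpha> l x =
      (complex_of_real (exp (- (norm (fst x - v))\<^sup>2 / 2)) * exp (\<i> * complex_of_real ((- fst l) \<bullet> fst x))) *
      complex_of_real (exp (- s * (snd x)\<^sup>2 / 2) * bessel_j \<alpha> (snd x * snd l))" for x
    by (simp add: bump_def weinstein_kernel_def inner_commute)
  have "exp (- (snd l)\<^sup>2 / (2 * s)) = exp (- (1 / s) * (snd l)\<^sup>2 / 2)" by simp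
  then show ?thesis
    unfolding weinstein_transform_L1_def eq radial_transform[OF s integral_Gaussian_char_shift(1)]
      integral_Gaussian_char_shift(2)
    by (simp add: wave_def inner_commute)
qed

text \<open>Integrability of both functions and equality at every point, not just almost everywhere:
  in this form the property is stable under linear combinations and also yields boundedness. The
  reflection is applied before the second transform instead of after it.\<close>

definition inversion_holds :: "((real ^ 'n::finite) \<times> real \<Rightarrow> complex) \<Rightarrow> bool" where
  "inversion_holds f \<longleftrightarrow> integrable W f \<and>
     integrable W (F f) \<and>
     (\<forall>x. F (\<lambda>l. F f (reflect l)) x = f x)"

text \<open>The phase \<open>v\<close> becomes a translation by \<open>v\<close>, the reflection
  makes it \<open>- v\<close>, and the transform of that bump has phase \<open>v\<close> again. The
  scalars \<open>s powr (- (\<alpha> + 1))\<close> and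
  \<open>(1 / s) powr (- (\<alpha> + 1))\<close> multiply to 1.\<close>

lemma inversion_holds_wave:
  assumes s: "s > 0" shows "inversion_holds (wave v s)"
  unfolding inversion_holds_def
proof (intro conjI allI)
  have s': "1 / s > 0" using s by simp
  have F: "F (wave v s) = (\<lambda>l. complex_of_real (s powr (- (\<alpha> + 1))) * bump v (1 / s) l)"
    by (rule ext) (rule weinstein_transform_wave[OF s])
  show "integrable W (F (wave v s))"
    unfolding F by (rule Bochner_Integration.integrable_mult_right) (rule integrable_wave(2)[OF s'])
  fix x
  have "s powr (- (\<alpha> + 1)) * (1 / s) powr (- (\<alpha> + 1)) = 1"
    using s by (simp add: powr_mult[symmetric])
  then show "F (\<lambda>l. F (wave v s) (reflect l)) x = wave v s x"
    unfolding F bump_reflect weinstein_transform_L1_cmult weinstein_transform_bump[OF s']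
    by (simp add: mult.assoc[symmetric] of_real_mult[symmetric] del: of_real_mult)
qed (rule integrable_wave[OF s])

lemma inversion_holds_add:
  assumes "inversion_holds f" "inversion_holds g" shows "inversion_holds (\<lambda>x. f x + g x)"
proof -
  have fg: "integrable W f" "integrable W g"
    using assms by (auto simp: inversion_holds_def)
  have F: "F (\<lambda>x. f x + g x) =
      (\<lambda>l. F f l + F g l)"
    by (rule ext) (rule weinstein_transform_L1_add[OF fg])
  show ?thesis
    using assms unfolding inversion_holds_def F
    by (auto simp: weinstein_transform_L1_add integrable_reflect)
qed

lemma inversion_holds_cmult:
  assumes "inversion_holds f" shows "inversion_holds (\<lambda>x. c * f x)"
proof -
  have F: "F (\<lambda>x. c * f x) = (\<lambda>l. c * F f l)"
    by (rule ext) (rule weinstein_transform_L1_cmult)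
  show ?thesis
    using assms unfolding inversion_holds_def F by (auto simp: weinstein_transform_L1_cmult)
qed

text \<open>Transforms of integrable functions are bounded, and \<open>f\<close> is such a transform
  too, by inversion. Bounded and integrable implies square integrable.\<close>

lemma inversion_holds_sqint:
  assumes "inversion_holds f"
  shows "sqint W f" "sqint W (F f)"
proof -
  have f: "integrable W f"
    and F: "integrable W (\<lambda>l. F f (reflect l))"
    and eq: "f = F (\<lambda>l. F f (reflect l))"
    using assms integrable_reflect by (auto simp: inversion_holds_def)
  show "sqint W f"
    by (rule bounded_integrable_imp_sqint[OF f]) (subst eq, auto intro!: AE_I2 cmod_weinstein_transform_L1_le[OF F])
  show "sqint W (F f)"
    using assms by (intro bounded_integrable_imp_sqint[OF _ AE_I2[OF cmod_weinstein_transform_L1_le[OF f]]])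
      (auto simp: inversion_holds_def)
qed

text \<open>The conjugate of \<open>F f\<close> is a reflected transform of the conjugate of
  \<open>f\<close>. After a reflection of the variable, the multiplication formula moves that
  transform onto the other factor, where inversion turns it into \<open>f\<close>.\<close>

lemma inversion_holds_isometry:
  assumes f: "inversion_holds f"
  shows "nrm2 W (F f) = nrm2 W f"
proof -
  have fI: "integrable W f" and FI: "integrable W (F f)"
    and inv: "\<And>x. F (\<lambda>l. F f (reflect l)) x = f x"
    using f by (auto simp: inversion_holds_def)
  have cI: "integrable W (\<lambda>x. cnj (f x))" using fI by simp
  have [measurable]: "F f \<in> borel_measurable W" "F (\<lambda>x. cnj (f x)) \<in> borel_measurable W"
    using fI cI by (auto intro!: measurable_weinstein_transform_L1)
  have m: "(\<lambda>l. F f (reflect l) * F (\<lambda>x. cnj (f x)) l) \<in> borel_measurable W"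
    using measurable_reflect_weinstein by measurable
  have "complex_of_real (LINT l|W. (cmod (F f l))\<^sup>2) = (LINT l|W. complex_of_real ((cmod (F f l))\<^sup>2))"
    by (rule integral_complex_of_real[symmetric])
  also have "\<dots> = (LINT l|W. F f (reflect (reflect l)) * F (\<lambda>x. cnj (f x)) (reflect l))"
    by (simp only: complex_norm_square weinstein_transform_L1_cnj reflect_reflect)
  also have "\<dots> = (LINT l|W. F f (reflect l) * F (\<lambda>x. cnj (f x)) l)"
    by (rule integral_reflect[OF m])
  also have "\<dots> = (LINT l|W. F (\<lambda>l. F f (reflect l)) l * cnj (f l))"
    by (rule weinstein_multiplication_formula[OF integrable_reflect[OF FI] cI, symmetric])
  also have "\<dots> = (LINT x|W. complex_of_real ((cmod (f x))\<^sup>2))"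
    by (simp only: inv complex_norm_square)
  also have "\<dots> = complex_of_real (LINT x|W. (cmod (f x))\<^sup>2)"
    by (rule integral_complex_of_real)
  finally show ?thesis by (simp add: nrm2_def)
qed

section \<open>Density of the Gaussian waves\<close>

inductive_set waves :: "((real ^ 'n::finite) \<times> real \<Rightarrow> complex) set" where
  wave: "s > 0 \<Longrightarrow> wave v s \<in> waves"
| add: "f \<in> waves \<Longrightarrow> g \<in> waves \<Longrightarrow> (\<lambda>x. f x + g x) \<in> waves"
| cmult: "f \<in> waves \<Longrightarrow> (\<lambda>x. c * f x) \<in> waves"

lemma waves_inversion_holds: "f \<in> waves \<Longrightarrow> inversion_holds f"
  by (induction rule: waves.induct) (auto intro: inversion_holds_wave inversion_holds_add inversion_holds_cmult)

definition L12 :: "((real ^ 'n::finite) \<times> real \<Rightarrow> complex) set" where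
  "L12 = {f. integrable W f \<and> sqint W f}"

lemma waves_L12: "f \<in> waves \<Longrightarrow> f \<in> L12"
  using waves_inversion_holds[of f] inversion_holds_sqint[of f] by (auto simp: L12_def inversion_holds_def)

lemma L12_add: "f \<in> L12 \<Longrightarrow> g \<in> L12 \<Longrightarrow> (\<lambda>x. f x + g x) \<in> L12"
  and L12_diff: "f \<in> L12 \<Longrightarrow> g \<in> L12 \<Longrightarrow> (\<lambda>x. f x - g x) \<in> L12"
  by (auto simp: L12_def)

lemma L12_mult:
  fixes f b :: "(real ^ 'n::finite) \<times> real \<Rightarrow> complex"
  assumes "f \<in> L12" "b \<in> borel_measurable W" "\<And>x. x \<in> half_space \<Longrightarrow> cmod (b x) \<le> K"
  shows "(\<lambda>x. b x * f x) \<in> L12"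
  using assms by (auto simp: L12_def intro!: integrable_mult_bounded[where K = K] sqint_mult_bounded[where K = K] AE_I2)

text \<open>The \<open>L1\<close> norm plus the squared \<open>L2\<close> norm, so that one number
  controls both. It is not a norm; \<open>err_add\<close> replaces the triangle inequality at the
  price of a factor 2.\<close>

definition err :: "((real ^ 'n::finite) \<times> real \<Rightarrow> complex) \<Rightarrow> real" where
  "err f = (LINT x|W. cmod (f x) + (cmod (f x))\<^sup>2)"

lemma err_integrable: "f \<in> L12 \<Longrightarrow> integrable W (\<lambda>x. cmod (f x) + (cmod (f x))\<^sup>2)"
  by (auto simp: L12_def sqint_def)

lemma err_add:
  assumes "f \<in> L12" "g \<in> L12"
  shows "err (\<lambda>x. f x + g x) \<le> 2 * err f + 2 * err g"
proof -
  have "err (\<lambda>x. f x + g x) \<le> (LINT x|W. 2 * (cmod (f x) + (cmod (f x))\<^sup>2) + 2 * (cmod (g x) + (cmod (g x))\<^sup>2))"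
    unfolding err_def
  proof (rule integral_mono)
    fix x
    have "cmod (f x + g x) \<le> 2 * cmod (f x) + 2 * cmod (g x)"
      using norm_triangle_ineq[of "f x" "g x"] norm_ge_zero[of "f x"] norm_ge_zero[of "g x"] by linarith
    then show "cmod (f x + g x) + (cmod (f x + g x))\<^sup>2 \<le> 2 * (cmod (f x) + (cmod (f x))\<^sup>2) + 2 * (cmod (g x) + (cmod (g x))\<^sup>2)"
      using cmod_add_square_le[of "f x" "g x"] by (simp add: algebra_simps)
  next
    show "integrable W (\<lambda>x. cmod (f x + g x) + (cmod (f x + g x))\<^sup>2)"
      by (rule err_integrable[OF L12_add[OF assms]])
    show "integrable W
        (\<lambda>x. 2 * (cmod (f x) + (cmod (f x))\<^sup>2) + 2 * (cmod (g x) + (cmod (g x))\<^sup>2))"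
      by (rule Bochner_Integration.integrable_add; rule Bochner_Integration.integrable_mult_right;
          rule err_integrable) (use assms in auto)
  qed
  also have "\<dots> = 2 * err f + 2 * err g"
    unfolding err_def
    by (simp only: integral_mult_right_zero Bochner_Integration.integral_add[OF
        Bochner_Integration.integrable_mult_right[OF err_integrable[OF assms(1)]]
        Bochner_Integration.integrable_mult_right[OF err_integrable[OF assms(2)]]])
  finally show ?thesis .
qed

text \<open>With \<open>K \<ge> 1\<close> the constant \<open>K\<^sup>2\<close> covers the linear
  term as well as the quadratic one.\<close>

lemma err_mult:
  fixes f b :: "(real ^ 'n::finite) \<times> real \<Rightarrow> complex"
  assumes "f \<in> L12" "b \<in> borel_measurable W" "\<And>x. x \<in> half_space \<Longrightarrow> cmod (b x) \<le> K" "K \<ge> 1"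
  shows "err (\<lambda>x. b x * f x) \<le> K\<^sup>2 * err f"
proof -
  have "err (\<lambda>x. b x * f x) \<le> (LINT x|W. K\<^sup>2 * (cmod (f x) + (cmod (f x))\<^sup>2))"
    unfolding err_def
  proof (rule integral_mono)
    fix x :: "(real ^ 'n) \<times> real" assume "x \<in> space W"
    then have b: "cmod (b x) \<le> K" using assms(3) by simp
    also have "K \<le> K\<^sup>2" using assms(4) by (simp add: power2_eq_square)
    finally have "cmod (b x) * cmod (f x) \<le> K\<^sup>2 * cmod (f x)" by (intro mult_right_mono) auto
    moreover have "(cmod (b x))\<^sup>2 * (cmod (f x))\<^sup>2 \<le> K\<^sup>2 * (cmod (f x))\<^sup>2"
      using b by (intro mult_right_mono power_mono) auto
    ultimately show "cmod (b x * f x) + (cmod (b x * f x))\<^sup>2 \<le> K\<^sup>2 * (cmod (f x) + (cmod (f x))\<^sup>2)"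
      by (simp add: norm_mult power_mult_distrib distrib_left)
  qed (use assms in \<open>auto intro!: err_integrable L12_mult Bochner_Integration.integrable_mult_right\<close>)
  then show ?thesis by (simp add: err_def)
qed

definition wave_closure :: "((real ^ 'n::finite) \<times> real \<Rightarrow> complex) set" where
  "wave_closure = {f \<in> L12. \<forall>e>0. \<exists>h\<in>waves. err (\<lambda>x. f x - h x) < e}"

lemma wave_closure_L12: "f \<in> wave_closure \<Longrightarrow> f \<in> L12"
  by (simp add: wave_closure_def)

lemma waves_closure: "f \<in> waves \<Longrightarrow> f \<in> wave_closure"
  by (auto simp: wave_closure_def waves_L12 err_def intro!: bexI[of _ f])

lemma wave_closureI:
  assumes f: "f \<in> L12" and ap: "\<And>e. e > 0 \<Longrightarrow> \<exists>g\<in>wave_closure. err (\<lambda>x. f x - g x) < e"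
  shows "f \<in> wave_closure"
  unfolding wave_closure_def
proof (clarsimp simp: f)
  fix e :: real assume e: "e > 0"
  \<comment> \<open>Quarters, because \<open>err_add\<close> doubles each of the two errors.\<close>
  obtain g where g: "g \<in> wave_closure" "err (\<lambda>x. f x - g x) < e / 4" using ap[of "e / 4"] e by auto
  obtain h where h: "h \<in> waves" "err (\<lambda>x. g x - h x) < e / 4" using g(1) e by (auto simp: wave_closure_def dest!: spec[of _ "e / 4"])
  have "err (\<lambda>x. (f x - g x) + (g x - h x)) \<le> 2 * err (\<lambda>x. f x - g x) + 2 * err (\<lambda>x. g x - h x)"
    using f g h by (intro err_add L12_diff) (auto intro: wave_closure_L12 waves_L12)
  then show "\<exists>h\<in>waves. err (\<lambda>x. f x - h x) < e" using g h by (intro bexI[of _ h]) auto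
qed

lemma wave_closure_add:
  assumes f: "f \<in> wave_closure" and g: "g \<in> wave_closure"
  shows "(\<lambda>x. f x + g x) \<in> wave_closure"
proof (rule wave_closureI)
  show "(\<lambda>x. f x + g x) \<in> L12" using assms by (auto intro: L12_add wave_closure_L12)
  fix e :: real assume e: "e > 0"
  obtain h where h: "h \<in> waves" "err (\<lambda>x. f x - h x) < e / 4" using f e by (auto simp: wave_closure_def dest!: spec[of _ "e / 4"])
  obtain k where k: "k \<in> waves" "err (\<lambda>x. g x - k x) < e / 4" using g e by (auto simp: wave_closure_def dest!: spec[of _ "e / 4"])
  have "err (\<lambda>x. (f x - h x) + (g x - k x)) \<le> 2 * err (\<lambda>x. f x - h x) + 2 * err (\<lambda>x. g x - k x)"
    using f g h k by (intro err_add L12_diff) (auto intro: wave_closure_L12 waves_L12)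
  then have "err (\<lambda>x. (f x + g x) - (h x + k x)) < e" using h k by (simp add: algebra_simps)
  then show "\<exists>h\<in>wave_closure. err (\<lambda>x. f x + g x - h x) < e"
    using h k by (intro bexI[of _ "\<lambda>x. h x + k x"]) (auto intro: waves_closure waves.add)
qed

section \<open>Multipliers of the closure\<close>

definition multipliers :: "((real ^ 'n::finite) \<times> real \<Rightarrow> complex) set" where
  "multipliers = {\<phi> \<in> borel_measurable W. (\<exists>K. \<forall>x\<in>half_space. cmod (\<phi> x) \<le> K) \<and>
     (\<forall>f\<in>wave_closure. (\<lambda>x. \<phi> x * f x) \<in> wave_closure)}"

text \<open>Multiplication by a bounded function is continuous for \<open>err\<close>, so it is
  enough that the waves are mapped to waves.\<close>

lemma multipliersI:
  fixes \<phi> :: "(real ^ 'n::finite) \<times> real \<Rightarrow> complex"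
  assumes m: "\<phi> \<in> borel_measurable W" and b: "\<And>x. x \<in> half_space \<Longrightarrow> cmod (\<phi> x) \<le> K"
    and w: "\<And>h. h \<in> waves \<Longrightarrow> (\<lambda>x. \<phi> x * h x) \<in> waves"
  shows "\<phi> \<in> multipliers"
  unfolding multipliers_def
proof (clarsimp, intro conjI m exI ballI)
  show "cmod (\<phi> x) \<le> max 1 K" if "x \<in> half_space" for x using b[OF that] by simp
  fix f :: "(real ^ 'n) \<times> real \<Rightarrow> complex" assume f: "f \<in> wave_closure"
  show "(\<lambda>x. \<phi> x * f x) \<in> wave_closure"
  proof (rule wave_closureI)
    show "(\<lambda>x. \<phi> x * f x) \<in> L12" by (rule L12_mult[OF wave_closure_L12[OF f] m b])
    fix e :: real assume e: "e > 0"
    let ?K = "max 1 K"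
    have K: "?K\<^sup>2 > 0" by simp
    obtain h where h: "h \<in> waves" "err (\<lambda>x. f x - h x) < e / ?K\<^sup>2"
      using f e K by (auto simp: wave_closure_def dest!: spec[of _ "e / ?K\<^sup>2"])
    have "err (\<lambda>x. \<phi> x * (f x - h x)) \<le> ?K\<^sup>2 * err (\<lambda>x. f x - h x)"
      using f h b by (intro err_mult L12_diff m) (auto intro: wave_closure_L12 waves_L12 order_trans[OF b])
    also have "\<dots> < e" using h(2) K by (simp add: pos_less_divide_eq mult.commute)
    finally have "err (\<lambda>x. \<phi> x * f x - \<phi> x * h x) < e" by (simp only: right_diff_distrib)
    then show "\<exists>g\<in>wave_closure. err (\<lambda>x. \<phi> x * f x - g x) < e"
      using waves_closure[OF w[OF h(1)]] by (intro bexI[where x = "\<lambda>x. \<phi> x * h x"])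
  qed
qed

text \<open>Closure under bounded limits is dominated convergence: for a fixed \<open>f\<close>, the
  errors of \<open>F n x * f x\<close> have a common integrable majorant built from \<open>K\<close>
  and \<open>f\<close>.\<close>

lemma multipliers_algebra:
  "bounded_limit_algebra half_space (multipliers :: ((real ^ 'n::finite) \<times> real \<Rightarrow> complex) set)"
proof
  show "(\<lambda>x::(real ^ 'n) \<times> real. c) \<in> multipliers" for c
    by (rule multipliersI[where K = "cmod c"]) (auto intro: waves.cmult)
next
  fix f g :: "(real ^ 'n) \<times> real \<Rightarrow> complex" assume f: "f \<in> multipliers" and g: "g \<in> multipliers"
  obtain K where K: "\<And>x. x \<in> half_space \<Longrightarrow> cmod (f x) \<le> K"
    using f unfolding multipliers_def by blast
  obtain L where L: "\<And>x. x \<in> half_space \<Longrightarrow> cmod (g x) \<le> L"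
    using g unfolding multipliers_def by blast
  have m: "f \<in> borel_measurable W" "g \<in> borel_measurable W"
    using f g by (auto simp: multipliers_def)
  have "cmod (f x + g x) \<le> K + L" "cmod (f x * g x) \<le> K * L" if "x \<in> half_space" for x
    using K[OF that] L[OF that] norm_triangle_ineq[of "f x" "g x"]
    by (auto simp: norm_mult intro!: mult_mono order_trans[OF norm_ge_zero])
  then have b: "\<exists>K. \<forall>x\<in>half_space. cmod (f x + g x) \<le> K" "\<exists>K. \<forall>x\<in>half_space. cmod (f x * g x) \<le> K"
    by blast+
  show "(\<lambda>x. f x + g x) \<in> multipliers"
    using f g b m by (auto simp: multipliers_def distrib_right intro: wave_closure_add)
  show "(\<lambda>x. f x * g x) \<in> multipliers"
    using f g b m by (auto simp: multipliers_def mult.assoc)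
next
  fix F and g :: "(real ^ 'n) \<times> real \<Rightarrow> complex" and K
  assume F: "\<And>n::nat. F n \<in> multipliers" and K: "\<And>n x. x \<in> half_space \<Longrightarrow> cmod (F n x) \<le> K"
    and lim: "\<And>x. x \<in> half_space \<Longrightarrow> (\<lambda>n. F n x) \<longlonglongrightarrow> g x"
  have Fm [measurable]: "F n \<in> borel_measurable W" for n using F by (auto simp: multipliers_def)
  have gm [measurable]: "g \<in> borel_measurable W"
    by (rule borel_measurable_LIMSEQ_metric[OF Fm]) (use lim in auto)
  have gK: "cmod (g x) \<le> K" if "x \<in> half_space" for x
    using tendsto_norm[OF lim[OF that]] by (rule Lim_bounded[where M = 0]) (use K[OF that] in auto)
  show "g \<in> multipliers"
    unfolding multipliers_def
  proof (clarsimp, intro conjI gm exI ballI)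
    show "cmod (g x) \<le> K" if "x \<in> half_space" for x by (rule gK[OF that])
    fix f :: "(real ^ 'n) \<times> real \<Rightarrow> complex" assume f: "f \<in> wave_closure"
    note fL = wave_closure_L12[OF f]
    have [measurable]: "f \<in> borel_measurable W" using fL by (auto simp: L12_def)
    show "(\<lambda>x. g x * f x) \<in> wave_closure"
    proof (rule wave_closureI)
      show "(\<lambda>x. g x * f x) \<in> L12" by (rule L12_mult[OF fL gm gK])
      fix e :: real assume e: "e > 0"
      have "(\<lambda>n. err (\<lambda>x. g x * f x - F n x * f x)) \<longlonglongrightarrow> (LINT x|(W :: ((real ^ 'n) \<times> real) measure). 0)"
        unfolding err_def
      proof (rule integral_dominated_convergence)
        let ?w = "\<lambda>x. 2 * K * cmod (f x) + (2 * K)\<^sup>2 * (cmod (f x))\<^sup>2"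
        show "integrable W ?w" using fL by (auto simp: L12_def sqint_def)
        show "AE x in W. (\<lambda>n. cmod (g x * f x - F n x * f x) + (cmod (g x * f x - F n x * f x))\<^sup>2) \<longlonglongrightarrow> 0"
        proof (rule AE_I2)
          fix x :: "(real ^ 'n) \<times> real" assume "x \<in> space W"
          then have "(\<lambda>n. F n x) \<longlonglongrightarrow> g x" using lim by simp
          then have "(\<lambda>n. cmod (g x * f x - F n x * f x) + (cmod (g x * f x - F n x * f x))\<^sup>2)
              \<longlonglongrightarrow> cmod (g x * f x - g x * f x) + (cmod (g x * f x - g x * f x))\<^sup>2"
            by (intro tendsto_intros)
          then show "(\<lambda>n. cmod (g x * f x - F n x * f x) + (cmod (g x * f x - F n x * f x))\<^sup>2) \<longlonglongrightarrow> 0" by simp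
        qed
        show "AE x in W. norm (cmod (g x * f x - F n x * f x) + (cmod (g x * f x - F n x * f x))\<^sup>2) \<le> ?w x" for n
        proof (rule AE_I2)
          fix x :: "(real ^ 'n) \<times> real" assume "x \<in> space W"
          then have "cmod (g x - F n x) \<le> 2 * K"
            using K[of x n] gK[of x] norm_triangle_ineq4[of "g x" "F n x"] by simp
          then have "cmod (g x * f x - F n x * f x) \<le> 2 * K * cmod (f x)"
            by (auto simp: left_diff_distrib[symmetric] norm_mult intro!: mult_right_mono)
          then have "cmod (g x * f x - F n x * f x) + (cmod (g x * f x - F n x * f x))\<^sup>2 \<le> 2 * K * cmod (f x) + (2 * K * cmod (f x))\<^sup>2"
            by (intro add_mono power_mono) auto
          then show "norm (cmod (g x * f x - F n x * f x) + (cmod (g x * f x - F n x * f x))\<^sup>2) \<le> ?w x"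
            by (simp add: power_mult_distrib)
        qed
      qed measurable
      then have "\<forall>\<^sub>F n in sequentially. err (\<lambda>x. g x * f x - F n x * f x) < e"
        using e by (intro order_tendstoD(2)) auto
      then obtain n where "err (\<lambda>x. g x * f x - F n x * f x) < e" by (auto simp: eventually_sequentially)
      then show "\<exists>h\<in>wave_closure. err (\<lambda>x. g x * f x - h x) < e"
        using F[of n] f by (intro bexI[of _ "\<lambda>x. F n x * f x"]) (auto simp: multipliers_def)
    qed
  qed
qed

interpretation multipliers: bounded_limit_algebra half_space multipliers
  by (rule multipliers_algebra)

lemma phase_multiplier: "(\<lambda>x. exp (\<i> * complex_of_real (v \<bullet> fst x))) \<in> multipliers"
proof (rule multipliersI[where K = 1])
  show "(\<lambda>x. exp (\<i> * complex_of_real (v \<bullet> fst x))) \<in> borel_measurable W"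
    by (intro measurable_weinstein_measure borel_measurable_continuous_onI continuous_intros)
  show "(\<lambda>x. exp (\<i> * complex_of_real (v \<bullet> fst x)) * h x) \<in> waves" if "h \<in> waves" for h
    using that
  proof induction
    case (wave s u)
    have "(\<lambda>x. exp (\<i> * complex_of_real (v \<bullet> fst x)) * wave u s x) = wave (v + u) s"
      by (auto simp: wave_def inner_add_left distrib_left exp_add)
    then show ?case using waves.wave[OF wave] by simp
  qed (auto simp: distrib_left mult.left_commute intro: waves.add waves.cmult)
qed auto

lemma radial_multiplier:
  assumes "t \<ge> 0" shows "(\<lambda>x. complex_of_real (exp (- t * (snd x)\<^sup>2 / 2))) \<in> multipliers"
proof (rule multipliersI[where K = 1])
  show "(\<lambda>x. complex_of_real (exp (- t * (snd x)\<^sup>2 / 2))) \<in> borel_measurable W"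
    by (intro measurable_weinstein_measure borel_measurable_continuous_onI continuous_intros) auto
  show "(\<lambda>x. complex_of_real (exp (- t * (snd x)\<^sup>2 / 2)) * h x) \<in> waves" if "h \<in> waves" for h
    using that
  proof induction
    case (wave s u)
    have "exp (- t * r\<^sup>2 / 2) * exp (- s * r\<^sup>2 / 2) = exp (- (t + s) * r\<^sup>2 / 2)" for r
      by (simp add: exp_add[symmetric] algebra_simps)
    then have "complex_of_real (exp (- t * (snd x)\<^sup>2 / 2)) * wave u s x = wave u (t + s) x" for x
      unfolding wave_def by (metis (no_types, lifting) mult.left_commute of_real_mult)
    then show ?case using waves.wave[of "t + s" u] wave assms by simp
  qed (auto simp: distrib_left mult.left_commute intro: waves.add waves.cmult)
qed (use assms in auto)

text \<open>The function \<open>(1 + sin ((v \<bullet> fst x - c) / n)) / 2\<close> is a combination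
  of characters with values in the unit interval, and it is at least \<open>1 / 2\<close> exactly
  where the sine is nonnegative. That set is periodic, but its period grows with \<open>n\<close>,
  and in the limit only the half-space is left.\<close>

lemma half_space_ge_multiplier: "{x. v \<bullet> fst x \<ge> c} \<in> multipliers.sets_of"
proof -
  define A where "A n = {x :: (real ^ 'a) \<times> real. sin ((v \<bullet> fst x - c) / real (Suc n)) \<ge> 0}" for n
  have A: "A n \<in> multipliers.sets_of" for n
  proof -
    let ?N = "real (Suc n)"
    \<comment> \<open>Euler's formula; \<open>4 * \<i>\<close> combines the \<open>2 * \<i>\<close>
      of the sine with the division by 2.\<close>
    have eq: "complex_of_real ((1 + sin ((v \<bullet> fst x - c) / ?N)) / 2) = 1 / 2 +
        ((exp (- \<i> * complex_of_real (c / ?N)) / (4 * \<i>)) * exp (\<i> * complex_of_real ((v /\<^sub>R ?N) \<bullet> fst x)) -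
        (exp (\<i> * complex_of_real (c / ?N)) / (4 * \<i>)) * exp (\<i> * complex_of_real ((- v /\<^sub>R ?N) \<bullet> fst x)))" for x
    proof -
      have i: "(v /\<^sub>R ?N) \<bullet> fst x = v \<bullet> fst x / ?N" "(- v /\<^sub>R ?N) \<bullet> fst x = - (v \<bullet> fst x / ?N)"
        by (simp_all add: divide_inverse mult.commute)
      have "\<i> * complex_of_real ((v \<bullet> fst x - c) / ?N) = - \<i> * complex_of_real (c / ?N) + \<i> * complex_of_real (v \<bullet> fst x / ?N)"
        "- (\<i> * complex_of_real ((v \<bullet> fst x - c) / ?N)) = \<i> * complex_of_real (c / ?N) + \<i> * complex_of_real (- (v \<bullet> fst x / ?N))"
        by (simp_all only: diff_divide_distrib of_real_diff of_real_minus) (simp_all add: algebra_simps)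
      then have "complex_of_real (sin ((v \<bullet> fst x - c) / ?N)) = (exp (- \<i> * complex_of_real (c / ?N)) * exp (\<i> * complex_of_real (v \<bullet> fst x / ?N)) -
         exp (\<i> * complex_of_real (c / ?N)) * exp (\<i> * complex_of_real (- (v \<bullet> fst x / ?N)))) / (2 * \<i>)"
        unfolding sin_of_real[symmetric] sin_exp_eq by (simp only: exp_add)
      moreover have "(P * Q - R * T) / (2 * \<i>) / 2 = P / (4 * \<i>) * Q - R / (4 * \<i>) * T" for P Q R T
        by (simp add: field_simps)
      moreover have "complex_of_real ((1 + y) / 2) = 1 / 2 + complex_of_real y / 2" for y
        by (simp add: add_divide_distrib)
      ultimately show ?thesis unfolding i by (simp only:)
    qed
    have "{x :: (real ^ 'a) \<times> real. (1 + sin ((v \<bullet> fst x - c) / ?N)) / 2 \<ge> 1 / 2} \<in> multipliers.sets_of"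
      unfolding multipliers.sets_of_def
    proof (clarify, rule multipliers.indicator_ge_half)
      show "(\<lambda>x. complex_of_real ((1 + sin ((v \<bullet> fst x - c) / ?N)) / 2)) \<in> multipliers"
        unfolding eq by (intro multipliers.add multipliers.diff multipliers.scale multipliers.const phase_multiplier)
      have "0 \<le> (1 + z) / 2 \<and> (1 + z) / 2 \<le> 1" if "- 1 \<le> z" "z \<le> 1" for z :: real
        using that by simp
      then show "0 \<le> (1 + sin ((v \<bullet> fst x - c) / ?N)) / 2 \<and> (1 + sin ((v \<bullet> fst x - c) / ?N)) / 2 \<le> 1" for x
        using sin_ge_minus_one sin_le_one by blast
    qed
    then show ?thesis by (simp add: A_def)
  qed
  show ?thesis
    unfolding multipliers.sets_of_def
  proof (clarify, rule multipliers.limit)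
    show "indicator (A n) \<in> multipliers" for n using A[of n] by (simp add: multipliers.sets_of_def)
    show "cmod (indicator (A n) x) \<le> 1" for n x by (simp add: indicator_def)
    fix x :: "(real ^ 'a) \<times> real"
    let ?y = "v \<bullet> fst x - c"
    \<comment> \<open>From \<open>N\<close> on the argument has modulus less than 1, hence less than
      \<open>pi\<close>, where the sine has the sign of its argument.\<close>
    obtain N :: nat where N: "\<bar>?y\<bar> < real N" using reals_Archimedean2 by blast
    have "x \<in> A n \<longleftrightarrow> v \<bullet> fst x \<ge> c" if "n \<ge> N" for n
    proof -
      let ?z = "?y / real (Suc n)"
      have z: "\<bar>?z\<bar> < 1" using N that by (simp add: abs_divide)
      have "pi > 1" using pi_gt3 by simp
      then have pi: "?z < pi" "- ?z < pi" using z unfolding abs_less_iff by (blast intro: less_trans)+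
      consider "?y = 0" | "?y > 0" | "?y < 0" by linarith
      then show ?thesis
      proof cases
        case 2
        then have "?z > 0" by simp
        then have "sin ?z > 0" by (rule sin_gt_zero) (rule pi)
        then show ?thesis using 2 by (simp add: A_def)
      next
        case 3
        then have "?z < 0" by (simp add: divide_neg_pos)
        then have "sin (- ?z) > 0" by (intro sin_gt_zero pi) (simp only: neg_0_less_iff_less)
        then have "sin ?z < 0" by (simp only: sin_minus)
        then show ?thesis using 3 by (simp add: A_def)
      qed (simp add: A_def)
    qed
    then have "\<forall>\<^sub>F n in sequentially. indicator (A n) x = (indicator {x. c \<le> v \<bullet> fst x} x :: complex)"
      by (intro eventually_sequentiallyI[of N]) (simp add: indicator_def)
    then show "(\<lambda>n. indicator (A n) x :: complex) \<longlonglongrightarrow> indicator {x. c \<le> v \<bullet> fst x} x"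
      by (rule tendsto_eventually)
  qed
qed

lemma snd_le_multiplier: "{x :: (real ^ 'n::finite) \<times> real. snd x \<le> a} \<in> multipliers.sets_of"
proof (cases "a > 0")
  case True
  \<comment> \<open>Makes the Gaussian equal to \<open>1 / 2\<close> at height \<open>a\<close>; as
    it decreases on positive heights, it is at least \<open>1 / 2\<close> precisely up to
    \<open>a\<close>.\<close>
  define t where "t = 2 * ln 2 / a\<^sup>2"
  have t: "t > 0" using True by (simp add: t_def)
  have "indicator {x :: (real ^ 'n) \<times> real. exp (- t * (snd x)\<^sup>2 / 2) \<ge> 1 / 2} \<in> multipliers"
    using t by (intro multipliers.indicator_ge_half radial_multiplier) auto
  then have "{x :: (real ^ 'n) \<times> real. exp (- t * (snd x)\<^sup>2 / 2) \<ge> 1 / 2} \<in> multipliers.sets_of"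
    by (simp add: multipliers.sets_of_def)
  then show ?thesis
  proof (rule multipliers.sets_of_eq_on)
    have "exp (- t * r\<^sup>2 / 2) \<ge> 1 / 2 \<longleftrightarrow> r \<le> a" if "r > 0" for r
    proof -
      have half: "exp (- ln 2) = (1 / 2 :: real)" by (simp add: exp_minus)
      have "exp (- t * r\<^sup>2 / 2) \<ge> 1 / 2 \<longleftrightarrow> - t * r\<^sup>2 / 2 \<ge> - ln 2"
        unfolding half[symmetric] by (rule exp_le_cancel_iff)
      also have "\<dots> \<longleftrightarrow> ln 2 \<ge> t * r\<^sup>2 / 2" by simp
      also have "\<dots> \<longleftrightarrow> r\<^sup>2 \<le> a\<^sup>2" using True by (simp add: t_def field_simps)
      also have "\<dots> \<longleftrightarrow> r \<le> a" using that True by (simp add: power_mono_iff)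
      finally show ?thesis .
    qed
    then show "{x :: (real ^ 'n) \<times> real. exp (- t * (snd x)\<^sup>2 / 2) \<ge> 1 / 2} \<inter> half_space = {x. snd x \<le> a} \<inter> half_space"
      by (auto simp: half_space_def)
  qed
next
  case False
  \<comment> \<open>For \<open>a \<le> 0\<close> the set does not meet the half-space and counts as
    empty.\<close>
  have "{} \<in> multipliers.sets_of"
    using multipliers.const[of 0] by (simp add: multipliers.sets_of_def indicator_def[abs_def])
  then show ?thesis
    by (rule multipliers.sets_of_eq_on) (use False in \<open>auto simp: half_space_def\<close>)
qed

text \<open>Coordinate half-spaces generate the Borel sets. A basis vector of the product is either
  horizontal, where the sine construction applies, or vertical, where the radial Gaussians
  do.\<close>

lemma bounded_measurable_multiplier:
  fixes k :: "(real ^ 'n::finite) \<times> real \<Rightarrow> complex"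
  assumes "k \<in> borel_measurable W" "\<And>x. x \<in> half_space \<Longrightarrow> cmod (k x) \<le> K"
  shows "k \<in> multipliers"
proof (rule multipliers.bounded_measurable[OF _ _ _ assms])
  let ?G = "(\<lambda>(a, i). {x::(real ^ 'n) \<times> real. x \<bullet> i \<le> a}) ` (UNIV \<times> Basis)"
  have "sets (borel :: ((real ^ 'n) \<times> real) measure) = sigma_sets UNIV ?G"
    by (subst borel_eq_halfspace_le) simp
  then show "sets W = {A \<inter> half_space |A. A \<in> sigma_sets UNIV ?G}"
    unfolding sets_weinstein_measure by (auto simp: sets_restrict_space)
  show "?G \<subseteq> multipliers.sets_of"
  proof clarify
    fix a :: real and i :: "(real ^ 'n) \<times> real" assume "i \<in> Basis"
    then consider b where "i = (b, 0)" | "i = (0, 1)" by (auto simp: Basis_prod_def)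
    then show "{x. x \<bullet> i \<le> a} \<in> multipliers.sets_of"
    proof cases
      case 1
      have "{x :: (real ^ 'n) \<times> real. x \<bullet> i \<le> a} = {x. (- b) \<bullet> fst x \<ge> - a}"
        by (auto simp: 1 inner_commute)
      then show ?thesis using half_space_ge_multiplier[of "- a" "- b"] by simp
    next
      case 2
      have "{x :: (real ^ 'n) \<times> real. x \<bullet> i \<le> a} = {x. snd x \<le> a}"
        by (auto simp: 2)
      then show ?thesis using snd_le_multiplier[of a] by simp
    qed
  qed
qed simp

text \<open>\<open>f\<close> is \<open>f / g\<close> times a wave \<open>g\<close> without zeros.
  The quotient cut off at \<open>n\<close> is a multiplier, and what the cutoff loses is at each
  point either 0 or \<open>f x\<close>, so \<open>f\<close> itself dominates.\<close>

theorem L12_subset_wave_closure: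
  fixes f :: "(real ^ 'n::finite) \<times> real \<Rightarrow> complex"
  assumes f: "f \<in> L12" shows "f \<in> wave_closure"
proof (rule wave_closureI[OF f])
  define g :: "(real ^ 'n) \<times> real \<Rightarrow> complex" where "g = wave 0 1"
  have g: "g \<in> waves" unfolding g_def by (rule waves.wave) simp
  have g0: "g x \<noteq> 0" for x by (simp add: g_def wave_def)
  have [measurable]: "f \<in> borel_measurable W" "g \<in> borel_measurable W"
    using f waves_L12[OF g] by (auto simp: L12_def)
  define k where "k n x = (if cmod (f x / g x) \<le> real n then f x / g x else 0)" for n :: nat and x
  have km [measurable]: "k n \<in> borel_measurable W" for n unfolding k_def[abs_def] by measurable
  have kg: "(\<lambda>x. k n x * g x) \<in> wave_closure" for n
  proof -
    have "k n \<in> multipliers"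
      by (rule bounded_measurable_multiplier[OF km, where K = "real n"]) (simp add: k_def)
    then show ?thesis using waves_closure[OF g] by (auto simp: multipliers_def)
  qed
  have "(\<lambda>n. err (\<lambda>x. f x - k n x * g x)) \<longlonglongrightarrow> (LINT x|(W :: ((real ^ 'n) \<times> real) measure). 0)"
    unfolding err_def
  proof (rule integral_dominated_convergence)
    show "integrable W (\<lambda>x. cmod (f x) + (cmod (f x))\<^sup>2)" by (rule err_integrable[OF f])
    show "AE x in W. (\<lambda>n. cmod (f x - k n x * g x) + (cmod (f x - k n x * g x))\<^sup>2) \<longlonglongrightarrow> 0"
    proof (intro AE_I2 tendsto_eventually)
      fix x
      obtain N :: nat where N: "cmod (f x / g x) \<le> real N" using real_arch_simple by blast
      show "\<forall>\<^sub>F n in sequentially. cmod (f x - k n x * g x) + (cmod (f x - k n x * g x))\<^sup>2 = 0"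
        using N g0[of x] by (intro eventually_sequentiallyI[of N]) (auto simp: k_def)
    qed
    show "AE x in W. norm (cmod (f x - k n x * g x) + (cmod (f x - k n x * g x))\<^sup>2) \<le> cmod (f x) + (cmod (f x))\<^sup>2" for n
      using g0 by (intro AE_I2) (auto simp: k_def)
  qed measurable
  then have lim: "(\<lambda>n. err (\<lambda>x. f x - k n x * g x)) \<longlonglongrightarrow> 0" by simp
  fix e :: real assume "e > 0"
  then have "\<forall>\<^sub>F n in sequentially. err (\<lambda>x. f x - k n x * g x) < e"
    by (intro order_tendstoD(2)[OF lim])
  then obtain n where "err (\<lambda>x. f x - k n x * g x) < e" by (auto simp: eventually_sequentially)
  then show "\<exists>g\<in>wave_closure. err (\<lambda>x. f x - g x) < e" using kg[of n] by (intro bexI[where x = "\<lambda>x. k n x * g x"])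
qed

section \<open>Plancherel theorem\<close>

lemma L1_Int_L2: "L1 \<alpha> \<inter> L2 \<alpha> = L12"
  by (auto simp: L12_def L1_def L2_altdef)

lemma L12_D:
  assumes "f \<in> L12" shows "integrable W f" "sqint W f"
  using assms by (auto simp: L12_def)

lemma L12_approx_waves:
  assumes f: "f \<in> L12"
  obtains h where "\<And>n::nat. h n \<in> waves"
    "(\<lambda>n. LINT x|W. cmod (f x - h n x)) \<longlonglongrightarrow> 0"
    "(\<lambda>n. nrm2 W (\<lambda>x. f x - h n x)) \<longlonglongrightarrow> 0"
proof -
  have "\<forall>n::nat. \<exists>h\<in>waves. err (\<lambda>x. f x - h x) < 1 / real (Suc n)"
    using L12_subset_wave_closure[OF f] by (auto simp: wave_closure_def)
  then obtain h where h: "\<And>n. h n \<in> waves" "\<And>n. err (\<lambda>x. f x - h n x) < 1 / real (Suc n)"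
    by metis
  have d: "(\<lambda>x. f x - h n x) \<in> L12" for n
    by (intro L12_diff f waves_L12 h)
  have dI: "integrable W (\<lambda>x. cmod (f x - h n x))" "integrable W (\<lambda>x. (cmod (f x - h n x))\<^sup>2)" for n
    using L12_D[OF d[of n]] by (auto simp: sqint_def)
  have e: "err (\<lambda>x. f x - h n x) = (LINT x|W. cmod (f x - h n x)) + (nrm2 W (\<lambda>x. f x - h n x))\<^sup>2" for n
    unfolding err_def nrm2_square using dI by (rule Bochner_Integration.integral_add)
  have lim: "(\<lambda>n. 1 / real (Suc n)) \<longlonglongrightarrow> 0" by (rule LIMSEQ_Suc[OF lim_1_over_n])
  have nn: "(LINT x|W. cmod (f x - h n x)) \<ge> 0" "(nrm2 W (\<lambda>x. f x - h n x))\<^sup>2 \<ge> 0" for n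
    by simp_all
  have le: "norm (LINT x|W. cmod (f x - h n x)) \<le> 1 / real (Suc n)"
    "norm ((nrm2 W (\<lambda>x. f x - h n x))\<^sup>2) \<le> 1 / real (Suc n)" for n
    using h(2)[of n] nn[of n] unfolding e real_norm_def abs_of_nonneg[OF nn(1)] abs_of_nonneg[OF nn(2)]
    by linarith+
  have "(\<lambda>n. LINT x|W. cmod (f x - h n x)) \<longlonglongrightarrow> 0"
    by (rule Lim_null_comparison[OF always_eventually lim]) (rule allI, rule le)
  moreover have "(\<lambda>n. (nrm2 W (\<lambda>x. f x - h n x))\<^sup>2) \<longlonglongrightarrow> 0"
    by (rule Lim_null_comparison[OF always_eventually lim]) (rule allI, rule le)
  then have "(\<lambda>n. nrm2 W (\<lambda>x. f x - h n x)) \<longlonglongrightarrow> 0"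
    by simp
  ultimately show ?thesis using that h(1) by blast
qed

text \<open>\<open>L1\<close> convergence of the waves makes their transforms converge at every
  point; Fatou's lemma and the isometry on waves give the bound. An inequality is all this yields,
  but it already shows that the transform is square integrable.\<close>

lemma weinstein_transform_L1_contraction:
  assumes f: "f \<in> L12"
  shows "sqint W (F f)"
    and "nrm2 W (F f) \<le> nrm2 W f"
proof -
  obtain h where h: "\<And>n::nat. h n \<in> waves" "(\<lambda>n. LINT x|W. cmod (f x - h n x)) \<longlonglongrightarrow> 0"
    "(\<lambda>n. nrm2 W (\<lambda>x. f x - h n x)) \<longlonglongrightarrow> 0"
    using L12_approx_waves[OF f] by blast
  have hL: "h n \<in> L12" for n using waves_L12[OF h(1)] .
  have inv: "inversion_holds (h n)" for n by (rule waves_inversion_holds[OF h(1)])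
  have dlim: "(\<lambda>n. F f l - F (h n) l) \<longlonglongrightarrow> 0" for l
  proof (rule Lim_null_comparison[OF always_eventually h(2)], rule allI)
    fix n
    have "F f l - F (h n) l = F (\<lambda>x. f x - h n x) l"
      by (rule weinstein_transform_L1_diff[symmetric]) (intro L12_D f hL)+
    then show "norm (F f l - F (h n) l) \<le> (LINT x|W. cmod (f x - h n x))"
      using cmod_weinstein_transform_L1_le[OF L12_D(1)[OF L12_diff[OF f hL]]] by simp
  qed
  have lim: "(\<lambda>n. F (h n) l) \<longlonglongrightarrow> F f l" for l
    using tendsto_diff[OF tendsto_const[of "F f l"] dlim[of l]] by simp
  have m [measurable]: "F f \<in> borel_measurable W" "F (h n) \<in> borel_measurable W" for n
    using L12_D(1)[OF f] L12_D(1)[OF hL] by (auto intro!: measurable_weinstein_transform_L1)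
  have nh: "(\<lambda>n. nrm2 W (h n)) \<longlonglongrightarrow> nrm2 W f"
    by (rule tendsto_nrm2) (use h(3) nrm2_minus_commute[of W f] L12_D(2)[OF f] L12_D(2)[OF hL] in auto)
  have "(\<integral>\<^sup>+l. ennreal ((cmod (F f l))\<^sup>2) \<partial>W) = (\<integral>\<^sup>+l. liminf (\<lambda>n. ennreal ((cmod (F (h n) l))\<^sup>2)) \<partial>W)"
    by (intro nn_integral_cong lim_imp_Liminf[symmetric] tendsto_ennrealI tendsto_power tendsto_norm lim) auto
  also have "\<dots> \<le> liminf (\<lambda>n. \<integral>\<^sup>+l. ennreal ((cmod (F (h n) l))\<^sup>2) \<partial>W)"
    by (rule nn_integral_liminf) measurable
  also have "(\<lambda>n. \<integral>\<^sup>+l. ennreal ((cmod (F (h n) l))\<^sup>2) \<partial>W) = (\<lambda>n. ennreal ((nrm2 W (h n))\<^sup>2))"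
  proof
    fix n
    have "(\<integral>\<^sup>+l. ennreal ((cmod (F (h n) l))\<^sup>2) \<partial>W) = ennreal ((nrm2 W (F (h n)))\<^sup>2)"
      unfolding nrm2_square using inversion_holds_sqint(2)[OF inv]
      by (intro nn_integral_eq_integral sqint_integrable) auto
    then show "(\<integral>\<^sup>+l. ennreal ((cmod (F (h n) l))\<^sup>2) \<partial>W) = ennreal ((nrm2 W (h n))\<^sup>2)"
      by (simp add: inversion_holds_isometry[OF inv])
  qed
  also have "liminf (\<lambda>n. ennreal ((nrm2 W (h n))\<^sup>2)) = ennreal ((nrm2 W f)\<^sup>2)"
    by (intro lim_imp_Liminf tendsto_ennrealI tendsto_power nh) auto
  finally have le: "(\<integral>\<^sup>+l. ennreal ((cmod (F f l))\<^sup>2) \<partial>W) \<le> ennreal ((nrm2 W f)\<^sup>2)" .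
  then show sq: "sqint W (F f)"
    unfolding sqint_def by (auto intro!: integrableI_bounded m simp: le_less_trans[OF _ ennreal_less_top])
  have "ennreal ((nrm2 W (F f))\<^sup>2) \<le> ennreal ((nrm2 W f)\<^sup>2)"
    using le nn_integral_eq_integral[OF sqint_integrable[OF sq]] by (simp add: nrm2_square)
  then have "(nrm2 W (F f))\<^sup>2 \<le> (nrm2 W f)\<^sup>2"
    by (subst (asm) ennreal_le_iff) auto
  then show "nrm2 W (F f) \<le> nrm2 W f"
    by (rule power2_le_imp_le) simp
qed

text \<open>The contraction, applied to \<open>h n - f\<close>, makes the transforms of the waves
  converge in norm, and so the isometry passes to the limit.\<close>

lemma weinstein_transform_L1_isometry:
  assumes f: "f \<in> L12"
  shows "nrm2 W (F f) = nrm2 W f"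
proof -
  obtain h where h: "\<And>n::nat. h n \<in> waves"
    "(\<lambda>n. nrm2 W (\<lambda>x. f x - h n x)) \<longlonglongrightarrow> 0"
    using L12_approx_waves[OF f] by blast
  have hL: "h n \<in> L12" for n using waves_L12[OF h(1)] .
  have h': "(\<lambda>n. nrm2 W (\<lambda>x. h n x - f x)) \<longlonglongrightarrow> 0" using h(2) by (simp add: nrm2_minus_commute[of W f])
  have "(\<lambda>n. nrm2 W (h n)) \<longlonglongrightarrow> nrm2 W f"
    by (rule tendsto_nrm2[OF _ _ h']) (auto intro: L12_D f hL)
  moreover have "(\<lambda>n. nrm2 W (F (h n))) \<longlonglongrightarrow> nrm2 W (F f)"
  proof (rule tendsto_nrm2)
    show "(\<lambda>n. nrm2 W (\<lambda>x. F (h n) x - F f x)) \<longlonglongrightarrow> 0"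
    proof (rule Lim_null_comparison[OF always_eventually h'], rule allI)
      fix n
      have "(\<lambda>l. F (h n) l - F f l) = F (\<lambda>x. h n x - f x)"
        by (rule ext, rule weinstein_transform_L1_diff[symmetric]) (intro L12_D f hL)+
      then show "norm (nrm2 W (\<lambda>x. F (h n) x - F f x)) \<le> nrm2 W (\<lambda>x. h n x - f x)"
        using weinstein_transform_L1_contraction(2)[OF L12_diff[OF hL f]] by simp
    qed
  qed (auto intro: weinstein_transform_L1_contraction f hL)
  moreover have "nrm2 W (F (h n)) = nrm2 W (h n)" for n
    by (rule inversion_holds_isometry[OF waves_inversion_holds[OF h(1)]])
  ultimately show ?thesis using LIMSEQ_unique by force
qed

lemma nrm2_weinstein_transform_L1_diff:
  assumes "f \<in> L12" "g \<in> L12"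
  shows "nrm2 W (\<lambda>l. F f l - F g l) =
    nrm2 W (\<lambda>x. f x - g x)"
proof -
  have "(\<lambda>l. F f l - F g l) = F (\<lambda>x. f x - g x)"
    by (rule ext, rule weinstein_transform_L1_diff[symmetric]) (intro L12_D assms)+
  then show ?thesis using weinstein_transform_L1_isometry[OF L12_diff[OF assms]] by simp
qed

text \<open>Literally the property under the \<open>SOME\<close> in
  \<open>weinstein_transform\<close>. The limit along truncations exists by completeness; it then
  has to be compared with every other approximating sequence.\<close>

lemma weinstein_transform_exists:
  assumes f: "sqint W f"
  shows "\<exists>g. g \<in> L2 \<alpha> \<and>
        (\<forall>u :: nat \<Rightarrow> _.
           (\<forall>n. u n \<in> L1 \<alpha> \<inter> L2 \<alpha>) \<and> (\<lambda>n. L2_norm \<alpha> (\<lambda>x. u n x - f x)) \<longlonglongrightarrow> 0 \<longrightarrow>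
           (\<lambda>n. L2_norm \<alpha> (\<lambda>l. F (u n) l - g l)) \<longlonglongrightarrow> 0)"
proof -
  obtain u where u: "\<And>n::nat. integrable W (u n)" "\<And>n. sqint W (u n)"
    "(\<lambda>n. nrm2 W (\<lambda>x. u n x - f x)) \<longlonglongrightarrow> 0"
    using sqint_approx_integrable[OF f] by blast
  have uL: "u n \<in> L12" for n using u by (simp add: L12_def)
  have "\<exists>N. \<forall>m\<ge>N. \<forall>n\<ge>N. nrm2 W (\<lambda>x. F (u m) x - F (u n) x) < e" if "e > 0" for e
  proof -
    have "\<forall>\<^sub>F n in sequentially. nrm2 W (\<lambda>x. u n x - f x) < e / 2"
      by (rule order_tendstoD(2)[OF u(3)]) (use that in simp)
    then obtain N where N: "\<And>n. n \<ge> N \<Longrightarrow> nrm2 W (\<lambda>x. u n x - f x) < e / 2"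
      by (auto simp: eventually_sequentially)
    have "nrm2 W (\<lambda>x. F (u m) x - F (u n) x) < e" if "m \<ge> N" "n \<ge> N" for m n
      using nrm2_triangle_diff[OF u(2) f u(2), of m n] N[OF that(1)] N[OF that(2)]
      by (simp add: nrm2_weinstein_transform_L1_diff[OF uL uL] nrm2_minus_commute[of W f])
    then show ?thesis by blast
  qed
  then obtain g where g: "sqint W g" "(\<lambda>n. nrm2 W (\<lambda>x. F (u n) x - g x)) \<longlonglongrightarrow> 0"
    using nrm2_complete[of W "\<lambda>n. F (u n)"] weinstein_transform_L1_contraction(1)[OF uL] by blast
  show ?thesis
  proof (intro exI[of _ g] conjI allI impI)
    show "g \<in> L2 \<alpha>" using g by (simp add: L2_altdef)
    fix v :: "nat \<Rightarrow> _"
    assume "(\<forall>n. v n \<in> L1 \<alpha> \<inter> L2 \<alpha>) \<and> (\<lambda>n. L2_norm \<alpha> (\<lambda>x. v n x - f x)) \<longlonglongrightarrow> 0"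
    then have v: "\<And>n. v n \<in> L12" "(\<lambda>n. nrm2 W (\<lambda>x. v n x - f x)) \<longlonglongrightarrow> 0"
      by (auto simp: L1_Int_L2 L2_norm_altdef)
    show "(\<lambda>n. L2_norm \<alpha> (\<lambda>l. F (v n) l - g l)) \<longlonglongrightarrow> 0"
      unfolding L2_norm_altdef
    proof (rule Lim_null_comparison[OF always_eventually], rule allI)
      fix n
      \<comment> \<open>The isometry on differences keeps the transforms of the two sequences as
        close as the sequences themselves.\<close>
      have "nrm2 W (\<lambda>l. F (v n) l - g l) \<le> nrm2 W (\<lambda>l. F (v n) l - F (u n) l) + nrm2 W (\<lambda>l. F (u n) l - g l)"
        by (intro nrm2_triangle_diff weinstein_transform_L1_contraction v uL g)
      also have "nrm2 W (\<lambda>l. F (v n) l - F (u n) l) = nrm2 W (\<lambda>l. v n l - u n l)"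
        by (rule nrm2_weinstein_transform_L1_diff[OF v(1) uL])
      also have "\<dots> \<le> nrm2 W (\<lambda>x. v n x - f x) + nrm2 W (\<lambda>x. u n x - f x)"
        using nrm2_triangle_diff[OF L12_D(2)[OF v(1)] f u(2)] nrm2_minus_commute[of W f] by simp
      finally show "norm (nrm2 W (\<lambda>l. F (v n) l - g l)) \<le>
          nrm2 W (\<lambda>x. v n x - f x) + nrm2 W (\<lambda>x. u n x - f x) + nrm2 W (\<lambda>l. F (u n) l - g l)"
        by simp
      show "(\<lambda>n. nrm2 W (\<lambda>x. v n x - f x) + nrm2 W (\<lambda>x. u n x - f x) + nrm2 W (\<lambda>l. F (u n) l - g l)) \<longlonglongrightarrow> 0"
        using tendsto_add[OF tendsto_add[OF v(2) u(3)] g(2)] by simp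
    qed
  qed
qed

lemma
  assumes f: "sqint W f"
  shows weinstein_transform_sqint: "sqint W (T f)"
    and weinstein_transform_limit: "\<And>u. (\<And>n::nat. u n \<in> L12) \<Longrightarrow>
      (\<lambda>n. nrm2 W (\<lambda>x. u n x - f x)) \<longlonglongrightarrow> 0 \<Longrightarrow>
      (\<lambda>n. nrm2 W (\<lambda>l. F (u n) l - T f l)) \<longlonglongrightarrow> 0"
proof -
  have *: "T f \<in> L2 \<alpha> \<and>
        (\<forall>u :: nat \<Rightarrow> _.
           (\<forall>n. u n \<in> L1 \<alpha> \<inter> L2 \<alpha>) \<and> (\<lambda>n. L2_norm \<alpha> (\<lambda>x. u n x - f x)) \<longlonglongrightarrow> 0 \<longrightarrow>
           (\<lambda>n. L2_norm \<alpha> (\<lambda>l. F (u n) l - T f l)) \<longlonglongrightarrow> 0)"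
    unfolding weinstein_transform_def by (rule someI_ex[OF weinstein_transform_exists[OF f]])
  then show "sqint W (T f)"
    by (simp add: L2_altdef)
  show "(\<lambda>n. nrm2 W (\<lambda>l. F (u n) l - T f l)) \<longlonglongrightarrow> 0"
    if "\<And>n::nat. u n \<in> L12" "(\<lambda>n. nrm2 W (\<lambda>x. u n x - f x)) \<longlonglongrightarrow> 0" for u
    using conjunct2[OF *, rule_format, of u] that unfolding L1_Int_L2 L2_norm_altdef by blast
qed

lemma weinstein_transform_approx:
  assumes f: "sqint W f"
  obtains u where "\<And>n::nat. u n \<in> L12" "(\<lambda>n. nrm2 W (\<lambda>x. u n x - f x)) \<longlonglongrightarrow> 0"
    "(\<lambda>n. nrm2 W (\<lambda>l. F (u n) l - T f l)) \<longlonglongrightarrow> 0"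
proof -
  obtain u where u: "\<And>n::nat. integrable W (u n)" "\<And>n. sqint W (u n)"
    "(\<lambda>n. nrm2 W (\<lambda>x. u n x - f x)) \<longlonglongrightarrow> 0"
    using sqint_approx_integrable[OF f] by blast
  have uL: "u n \<in> L12" for n using u by (simp add: L12_def)
  show ?thesis by (rule that[OF uL u(3) weinstein_transform_limit[OF f uL u(3)]])
qed

text \<open>The constant sequence \<open>f\<close> is among the approximating sequences.\<close>

lemma weinstein_transform_eq_L1:
  assumes f: "f \<in> L12"
  shows "AE l in W. T f l = F f l"
proof (rule nrm2_limit_unique)
  show "(\<lambda>n::nat. nrm2 W (\<lambda>l. F f l - T f l)) \<longlonglongrightarrow> 0"
    by (rule weinstein_transform_limit[OF L12_D(2)[OF f], of "\<lambda>n. f"]) (use f in \<open>auto simp: nrm2_def\<close>)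
  show "(\<lambda>n::nat. nrm2 W (\<lambda>l. F f l - F f l)) \<longlonglongrightarrow> 0"
    by (simp add: nrm2_def)
qed (use f in \<open>auto intro: weinstein_transform_sqint weinstein_transform_L1_contraction L12_D\<close>)

theorem weinstein_plancherel:
  assumes f: "sqint W f"
  shows "nrm2 W (T f) = nrm2 W f"
proof -
  obtain u where u: "\<And>n::nat. u n \<in> L12" "(\<lambda>n. nrm2 W (\<lambda>x. u n x - f x)) \<longlonglongrightarrow> 0"
    "(\<lambda>n. nrm2 W (\<lambda>l. F (u n) l - T f l)) \<longlonglongrightarrow> 0"
    using weinstein_transform_approx[OF f] by blast
  have "(\<lambda>n. nrm2 W (u n)) \<longlonglongrightarrow> nrm2 W f"
    by (rule tendsto_nrm2[OF _ f u(2)]) (rule L12_D(2)[OF u(1)])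
  moreover have "(\<lambda>n. nrm2 W (F (u n))) \<longlonglongrightarrow> nrm2 W (T f)"
    by (rule tendsto_nrm2[OF _ weinstein_transform_sqint[OF f] u(3)]) (rule weinstein_transform_L1_contraction(1)[OF u(1)])
  ultimately show ?thesis
    using LIMSEQ_unique by (force simp: weinstein_transform_L1_isometry[OF u(1)])
qed

lemma weinstein_transform_add:
  assumes f: "sqint W f" and g: "sqint W g"
  shows "AE l in W. T (\<lambda>x. f x + g x) l =
    T f l + T g l"
proof -
  obtain u where u: "\<And>n::nat. u n \<in> L12" "(\<lambda>n. nrm2 W (\<lambda>x. u n x - f x)) \<longlonglongrightarrow> 0"
    "(\<lambda>n. nrm2 W (\<lambda>l. F (u n) l - T f l)) \<longlonglongrightarrow> 0"
    using weinstein_transform_approx[OF f] by blast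
  obtain v where v: "\<And>n::nat. v n \<in> L12" "(\<lambda>n. nrm2 W (\<lambda>x. v n x - g x)) \<longlonglongrightarrow> 0"
    "(\<lambda>n. nrm2 W (\<lambda>l. F (v n) l - T g l)) \<longlonglongrightarrow> 0"
    using weinstein_transform_approx[OF g] by blast
  note sq = L12_D(2)[OF u(1)] L12_D(2)[OF v(1)] f g weinstein_transform_sqint
    weinstein_transform_L1_contraction(1)[OF u(1)] weinstein_transform_L1_contraction(1)[OF v(1)]
  \<comment> \<open>Used twice: for the approximants themselves and for their transforms.\<close>
  have lim: "(\<lambda>n. nrm2 W (\<lambda>x. (a n x + b n x) - (p x + q x))) \<longlonglongrightarrow> 0"
    if "\<And>n. sqint W (a n)" "\<And>n. sqint W (b n)" "sqint W p" "sqint W q"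
      "(\<lambda>n. nrm2 W (\<lambda>x. a n x - p x)) \<longlonglongrightarrow> 0" "(\<lambda>n. nrm2 W (\<lambda>x. b n x - q x)) \<longlonglongrightarrow> 0" for a b :: "nat \<Rightarrow> _" and p q
  proof (rule Lim_null_comparison[OF always_eventually], rule allI)
    fix n
    show "norm (nrm2 W (\<lambda>x. (a n x + b n x) - (p x + q x))) \<le> nrm2 W (\<lambda>x. a n x - p x) + nrm2 W (\<lambda>x. b n x - q x)"
      using nrm2_triangle[OF sqint_diff[OF that(1,3)] sqint_diff[OF that(2,4)]] by (simp add: algebra_simps)
    show "(\<lambda>n. nrm2 W (\<lambda>x. a n x - p x) + nrm2 W (\<lambda>x. b n x - q x)) \<longlonglongrightarrow> 0"
      using tendsto_add[OF that(5,6)] by simp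
  qed
  have uv: "(\<lambda>x. u n x + v n x) \<in> L12" for n by (intro L12_add u v)
  have F: "F (\<lambda>x. u n x + v n x) = (\<lambda>l. F (u n) l + F (v n) l)" for n
    by (rule ext, rule weinstein_transform_L1_add) (intro L12_D u v)+
  show ?thesis
  proof (rule nrm2_limit_unique)
    show "(\<lambda>n. nrm2 W (\<lambda>l. F (\<lambda>x. u n x + v n x) l - T (\<lambda>x. f x + g x) l)) \<longlonglongrightarrow> 0"
      by (intro weinstein_transform_limit sqint_add f g uv lim sq u v)
    show "(\<lambda>n. nrm2 W (\<lambda>l. F (\<lambda>x. u n x + v n x) l - (T f l + T g l))) \<longlonglongrightarrow> 0"
      unfolding F by (intro lim sq u v)
  qed (intro weinstein_transform_L1_contraction uv sq sqint_add)+
qed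

lemma weinstein_transform_cmult:
  assumes f: "sqint W f"
  shows "AE l in W. T (\<lambda>x. c * f x) l = c * T f l"
proof -
  obtain u where u: "\<And>n::nat. u n \<in> L12" "(\<lambda>n. nrm2 W (\<lambda>x. u n x - f x)) \<longlonglongrightarrow> 0"
    "(\<lambda>n. nrm2 W (\<lambda>l. F (u n) l - T f l)) \<longlonglongrightarrow> 0"
    using weinstein_transform_approx[OF f] by blast
  have lim: "(\<lambda>n. nrm2 W (\<lambda>x. c * a n x - c * p x)) \<longlonglongrightarrow> 0"
    if "(\<lambda>n. nrm2 W (\<lambda>x. a n x - p x)) \<longlonglongrightarrow> 0" for a :: "nat \<Rightarrow> _" and p
    using tendsto_mult[OF tendsto_const[of "cmod c"] that]
    by (simp add: nrm2_cmult right_diff_distrib[symmetric])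
  have cu: "(\<lambda>x. c * u n x) \<in> L12" for n using L12_D[OF u(1)] by (auto simp: L12_def)
  have F: "F (\<lambda>x. c * u n x) = (\<lambda>l. c * F (u n) l)" for n
    by (rule ext, rule weinstein_transform_L1_cmult)
  show ?thesis
  proof (rule nrm2_limit_unique)
    show "(\<lambda>n. nrm2 W (\<lambda>l. F (\<lambda>x. c * u n x) l - T (\<lambda>x. c * f x) l)) \<longlonglongrightarrow> 0"
      by (intro weinstein_transform_limit sqint_cmult f cu lim u)
    show "(\<lambda>n. nrm2 W (\<lambda>l. F (\<lambda>x. c * u n x) l - c * T f l)) \<longlonglongrightarrow> 0"
      unfolding F by (intro lim u)
  qed (intro weinstein_transform_L1_contraction cu weinstein_transform_sqint f sqint_cmult)+
qed

lemma weinstein_transform_diff: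
  assumes f: "sqint W f" and g: "sqint W g"
  shows "AE l in W. T (\<lambda>x. f x - g x) l =
    T f l - T g l"
  using weinstein_transform_add[OF f sqint_cmult[OF g, of "-1"]] weinstein_transform_cmult[OF g, of "-1"]
  by eventually_elim simp

lemma nrm2_weinstein_transform_diff:
  assumes f: "sqint W f" and g: "sqint W g"
  shows "nrm2 W (\<lambda>l. T f l - T g l) =
    nrm2 W (\<lambda>x. f x - g x)"
proof -
  have "nrm2 W (\<lambda>l. T f l - T g l) =
      nrm2 W (T (\<lambda>x. f x - g x))"
    using weinstein_transform_diff[OF f g] weinstein_transform_sqint[OF f] weinstein_transform_sqint[OF g]
      weinstein_transform_sqint[OF sqint_diff[OF f g]]
    by (intro nrm2_cong_AE) (auto simp: sqint_def)
  then show ?thesis using weinstein_plancherel[OF sqint_diff[OF f g]] by simp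
qed

theorem weinstein_parseval:
  assumes f: "sqint W f" and g: "sqint W g"
  shows "(LINT x|W. f x * cnj (g x)) =
    (LINT l|W. T f l * cnj (T g l))"
proof -
  have m: "T h \<in> borel_measurable W" if "sqint W h" for h
    using weinstein_transform_sqint[OF that] by (simp add: sqint_def)
  \<comment> \<open>The values 1, -1, \<i> and -\<i> of \<open>c\<close> are those that occur in the
    polarization identity.\<close>
  have a: "nrm2 W (\<lambda>l. T f l + c * T g l) = nrm2 W (\<lambda>x. f x + c * g x)" for c
  proof -
    have "nrm2 W (\<lambda>l. T f l + c * T g l) = nrm2 W (T (\<lambda>x. f x + c * g x))"
      using weinstein_transform_add[OF f sqint_cmult[OF g, of c]] weinstein_transform_cmult[OF g, of c]
        m[OF f] m[OF g] m[OF sqint_add[OF f sqint_cmult[OF g]]]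
      by (intro nrm2_cong_AE) (auto elim: eventually_elim2)
    then show ?thesis using weinstein_plancherel[OF sqint_add[OF f sqint_cmult[OF g]]] by simp
  qed
  have "4 * (LINT x|W. f x * cnj (g x)) = 4 * (LINT l|W. T f l * cnj (T g l))"
    unfolding integral_mult_cnj_polarization[OF f g]
      integral_mult_cnj_polarization[OF weinstein_transform_sqint[OF f] weinstein_transform_sqint[OF g]]
    using a[of 1] a[of "-1"] a[of "\<i>"] a[of "-\<i>"] by simp
  then show ?thesis by simp
qed

section \<open>The inverse transform\<close>

lemma sqint_reflect:
  assumes "sqint W f"
  shows "sqint W (\<lambda>x. f (reflect x))"
  using assms measurable_compose[OF measurable_reflect_weinstein] integrable_reflect
  by (auto simp: sqint_def)

lemma nrm2_reflect:
  assumes "f \<in> borel_measurable W"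
  shows "nrm2 W (\<lambda>x. f (reflect x)) = nrm2 W f"
  unfolding nrm2_def using assms by (subst integral_reflect) auto

lemma sqint_approx_waves:
  assumes f: "sqint W f"
  obtains h where "\<And>n::nat. h n \<in> waves" "(\<lambda>n. nrm2 W (\<lambda>x. h n x - f x)) \<longlonglongrightarrow> 0"
proof -
  have "\<exists>h\<in>waves. nrm2 W (\<lambda>x. h x - f x) < 1 / real (Suc n)" for n
  proof -
    let ?e = "1 / real (Suc n)"
    have e: "?e / 2 > 0" by simp
    obtain u where u: "\<And>n::nat. integrable W (u n)" "\<And>n. sqint W (u n)" "(\<lambda>n. nrm2 W (\<lambda>x. u n x - f x)) \<longlonglongrightarrow> 0"
      using sqint_approx_integrable[OF f] by blast
    obtain k where k: "nrm2 W (\<lambda>x. u k x - f x) < ?e / 2"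
      using order_tendstoD(2)[OF u(3) e] by (auto simp: eventually_sequentially)
    have uL: "u k \<in> L12" using u by (simp add: L12_def)
    obtain h where h: "\<And>n::nat. h n \<in> waves" "(\<lambda>n. nrm2 W (\<lambda>x. u k x - h n x)) \<longlonglongrightarrow> 0"
      using L12_approx_waves[OF uL] by blast
    obtain j where j: "nrm2 W (\<lambda>x. u k x - h j x) < ?e / 2"
      using order_tendstoD(2)[OF h(2) e] by (auto simp: eventually_sequentially)
    have "nrm2 W (\<lambda>x. h j x - f x) \<le> nrm2 W (\<lambda>x. h j x - u k x) + nrm2 W (\<lambda>x. u k x - f x)"
      by (intro nrm2_triangle_diff u f L12_D(2)[OF waves_L12[OF h(1)]])
    also have "\<dots> < ?e" using j k unfolding nrm2_minus_commute[of W "h j" "u k"] by linarith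
    finally show ?thesis using h(1) by blast
  qed
  then obtain h where h: "\<And>n. h n \<in> waves" "\<And>n. nrm2 W (\<lambda>x. h n x - f x) < 1 / real (Suc n)"
    by metis
  have "(\<lambda>n. nrm2 W (\<lambda>x. h n x - f x)) \<longlonglongrightarrow> 0"
    by (rule Lim_null_comparison[OF always_eventually LIMSEQ_Suc[OF lim_1_over_n]])
      (use h(2) in \<open>auto intro: less_imp_le\<close>)
  with h(1) that show ?thesis by blast
qed

lemma inv_weinstein_transform_sqint:
  "sqint W f \<Longrightarrow> sqint W (inv_weinstein_transform \<alpha> f)"
  unfolding inv_weinstein_transform_def[abs_def] by (intro sqint_reflect weinstein_transform_sqint)

text \<open>Waves that approximate \<open>f\<close> satisfy inversion exactly. Their reflected
  transforms lie in \<open>L12\<close> and approximate the inverse transform of \<open>f\<close>;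
  transforming once more gives back the waves, so they also converge to the left-hand side.\<close>

theorem weinstein_transform_inverse:
  assumes f: "sqint W f"
  shows "AE x in W. T (inv_weinstein_transform \<alpha> f) x = f x"
proof -
  obtain h where h: "\<And>n::nat. h n \<in> waves" "(\<lambda>n. nrm2 W (\<lambda>x. h n x - f x)) \<longlonglongrightarrow> 0"
    using sqint_approx_waves[OF f] by blast
  have inv: "inversion_holds (h n)" for n by (rule waves_inversion_holds[OF h(1)])
  have hL: "h n \<in> L12" for n by (rule waves_L12[OF h(1)])
  have R: "(\<lambda>l. F (h n) (reflect l)) \<in> L12" for n
    using inv[of n] integrable_reflect sqint_reflect[OF inversion_holds_sqint(2)[OF inv]]
    by (auto simp: L12_def inversion_holds_def)
  have Tf: "sqint W (T f)" by (rule weinstein_transform_sqint[OF f])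
  have "nrm2 W (\<lambda>l. F (h n) (reflect l) - inv_weinstein_transform \<alpha> f l) = nrm2 W (\<lambda>l. F (h n) l - T f l)" for n
    unfolding inv_weinstein_transform_def
    using sqint_diff[OF inversion_holds_sqint(2)[OF inv] Tf]
    by (intro nrm2_reflect[of "\<lambda>l. F (h n) l - T f l"]) (auto simp: sqint_def)
  then have "(\<lambda>n. nrm2 W (\<lambda>l. F (h n) (reflect l) - inv_weinstein_transform \<alpha> f l)) \<longlonglongrightarrow> 0"
    using weinstein_transform_limit[OF f hL h(2)] by simp
  from weinstein_transform_limit[OF inv_weinstein_transform_sqint[OF f] R this]
  have "(\<lambda>n. nrm2 W (\<lambda>x. F (\<lambda>l. F (h n) (reflect l)) x - T (inv_weinstein_transform \<alpha> f) x)) \<longlonglongrightarrow> 0" .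
  moreover have "F (\<lambda>l. F (h n) (reflect l)) x = h n x" for n x
    using inv[of n] unfolding inversion_holds_def by blast
  ultimately have lim: "(\<lambda>n. nrm2 W (\<lambda>x. h n x - T (inv_weinstein_transform \<alpha> f) x)) \<longlonglongrightarrow> 0"
    by (simp only:)
  show ?thesis
    by (rule nrm2_limit_unique[OF _ _ f lim h(2)])
      (intro L12_D hL weinstein_transform_sqint inv_weinstein_transform_sqint f)+
qed

section \<open>Tikhonov regularization\<close>

lemma AE_scale_weinstein:
  assumes \<sigma>: "\<sigma> > 0" and P: "AE x in W. P x"
  shows "AE x in W. P (\<sigma> *\<^sub>R x)"
  using AE_lborel_scale[OF _ P[unfolded AE_weinstein_measure], of \<sigma>] \<sigma>
  unfolding AE_weinstein_measure by (auto simp: half_space_def mem_Times_iff)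

text \<open>Injectivity and independence of the representative, both read off from the isometry. The
  first yields uniqueness of the minimizer.\<close>

lemma weinstein_transform_cong_AE:
  assumes f: "sqint W f" and g: "sqint W g"
  shows "(AE x in W. f x = g x) \<longleftrightarrow>
    (AE l in W. T f l = T g l)"
proof -
  have Tf: "sqint W (T f)" "sqint W (T g)"
    using assms weinstein_transform_sqint by auto
  show ?thesis
    using nrm2_eq_0_iff[OF sqint_diff[OF f g]] nrm2_eq_0_iff[OF sqint_diff[OF Tf]]
    by (simp add: nrm2_weinstein_transform_diff[OF f g])
qed

end

locale tikhonov_regularization = weinstein \<alpha> for \<alpha> +
  fixes \<sigma> :: real
    and \<zeta> :: "(real ^ 'n::finite) \<times> real \<Rightarrow> real"
    and m \<phi> :: "(real ^ 'n) \<times> real \<Rightarrow> complex"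
  assumes \<sigma>: "\<sigma> > 0"
    and \<zeta> [measurable]: "\<zeta> \<in> borel_measurable (weinstein_measure \<alpha>)"
    and \<zeta>1: "\<And>\<xi>. \<xi> \<in> half_space \<Longrightarrow> \<zeta> \<xi> \<ge> 1"
    and \<zeta>I: "(\<lambda>\<xi>. complex_of_real (1 / \<zeta> \<xi>)) \<in> L1 \<alpha>"
    and m: "m \<in> Linfty \<alpha>"
    and m_nonzero: "AE \<xi> in weinstein_measure \<alpha>. m \<xi> \<noteq> 0"
    and \<phi>: "\<phi> \<in> H_space \<alpha> \<zeta>"
begin

abbreviation \<mu> :: "((real ^ 'n) \<times> real) measure" where "\<mu> \<equiv> weinstein_measure \<alpha>"

abbreviation star :: "real \<Rightarrow> (real ^ 'n) \<times> real \<Rightarrow> complex" where "star \<equiv> phi_star \<alpha> m \<sigma> \<zeta> \<phi>"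

definition ms :: "(real ^ 'n) \<times> real \<Rightarrow> complex" where "ms \<xi> = m (\<sigma> *\<^sub>R \<xi>)"
definition M where "M \<xi> = (cmod (ms \<xi>))\<^sup>2"
text \<open>The filter factor of the regularization.\<close>

definition b where "b \<eta> \<xi> = M \<xi> / (\<eta> * \<zeta> \<xi> + M \<xi>)"
definition w where "w \<eta> \<xi> = complex_of_real (b \<eta> \<xi>) * T \<phi> \<xi>"

lemma ms_measurable [measurable]: "ms \<in> borel_measurable \<mu>"
  unfolding ms_def[abs_def] using m
  by (intro measurable_compose[OF measurable_scale_weinstein[OF \<sigma>]]) (auto simp: Linfty_def)

lemma M_b_measurable [measurable]: "M \<in> borel_measurable \<mu>" "b \<eta> \<in> borel_measurable \<mu>"
  unfolding b_def[abs_def] M_def[abs_def] by measurable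

lemma ms_bounded: "\<exists>C. AE \<xi> in \<mu>. cmod (ms \<xi>) \<le> C"
  using m AE_scale_weinstein[OF \<sigma>] unfolding ms_def Linfty_def by blast

lemma ms_nonzero: "AE \<xi> in \<mu>. ms \<xi> \<noteq> 0"
  using AE_scale_weinstein[OF \<sigma> m_nonzero] by (simp add: ms_def)

lemma M_nonneg [simp]: "M \<xi> \<ge> 0" by (simp add: M_def)

lemma sqint_ms_mult: "sqint \<mu> f \<Longrightarrow> sqint \<mu> (\<lambda>\<xi>. ms \<xi> * f \<xi>)"
  using ms_bounded sqint_mult_bounded[OF _ ms_measurable] by blast

lemma multiplier_op_altdef: "multiplier_op \<alpha> m \<sigma> f = inv_weinstein_transform \<alpha> (\<lambda>\<xi>. ms \<xi> * T f \<xi>)"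
  by (simp add: multiplier_op_def ms_def)

lemma multiplier_op_sqint:
  "sqint \<mu> f \<Longrightarrow> sqint \<mu> (multiplier_op \<alpha> m \<sigma> f)"
  unfolding multiplier_op_altdef
  by (intro inv_weinstein_transform_sqint sqint_ms_mult weinstein_transform_sqint)

lemma transform_multiplier_op:
  "sqint \<mu> f \<Longrightarrow> AE \<xi> in \<mu>. T (multiplier_op \<alpha> m \<sigma> f) \<xi> = ms \<xi> * T f \<xi>"
  unfolding multiplier_op_altdef
  by (intro weinstein_transform_inverse sqint_ms_mult weinstein_transform_sqint)

lemma H_space_iff:
  "f \<in> H_space \<alpha> \<zeta> \<longleftrightarrow> sqint \<mu> f \<and> integrable \<mu> (\<lambda>\<xi>. \<zeta> \<xi> * (cmod (T f \<xi>))\<^sup>2)"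
proof -
  have "sqint \<mu> (\<lambda>\<xi>. complex_of_real (sqrt (\<zeta> \<xi>)) * T f \<xi>) \<longleftrightarrow> integrable \<mu> (\<lambda>\<xi>. \<zeta> \<xi> * (cmod (T f \<xi>))\<^sup>2)"
    if f: "sqint \<mu> f"
  proof -
    have [measurable]: "T f \<in> borel_measurable \<mu>"
      using weinstein_transform_sqint[OF f] by (simp add: sqint_def)
    have "integrable \<mu> (\<lambda>\<xi>. (cmod (complex_of_real (sqrt (\<zeta> \<xi>)) * T f \<xi>))\<^sup>2) \<longleftrightarrow> integrable \<mu> (\<lambda>\<xi>. \<zeta> \<xi> * (cmod (T f \<xi>))\<^sup>2)"
    proof (rule Bochner_Integration.integrable_cong[OF refl])
      fix \<xi> assume "\<xi> \<in> space \<mu>"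
      then have "\<zeta> \<xi> \<ge> 1" using \<zeta>1 by simp
      then show "(cmod (complex_of_real (sqrt (\<zeta> \<xi>)) * T f \<xi>))\<^sup>2 = \<zeta> \<xi> * (cmod (T f \<xi>))\<^sup>2"
        by (simp add: norm_mult power_mult_distrib)
    qed
    moreover have "(\<lambda>\<xi>. complex_of_real (sqrt (\<zeta> \<xi>)) * T f \<xi>) \<in> borel_measurable \<mu>" by measurable
    ultimately show ?thesis unfolding sqint_def by blast
  qed
  then show ?thesis by (auto simp: H_space_def L2_altdef)
qed

lemma \<phi>_sqint: "sqint \<mu> \<phi>" and p_weighted: "integrable \<mu> (\<lambda>\<xi>. \<zeta> \<xi> * (cmod (T \<phi> \<xi>))\<^sup>2)"
  using \<phi> by (auto simp: H_space_iff)

lemma p_sqint: "sqint \<mu> (T \<phi>)"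
  by (rule weinstein_transform_sqint[OF \<phi>_sqint])

lemma p_measurable [measurable]: "T \<phi> \<in> borel_measurable \<mu>"
  using p_sqint by (simp add: sqint_def)

lemma inverse_\<zeta>_integrable: "integrable \<mu> (\<lambda>\<xi>. 1 / \<zeta> \<xi>)"
proof -
  have "integrable \<mu> (\<lambda>\<xi>. complex_of_real (1 / \<zeta> \<xi>))" using \<zeta>I by (simp add: L1_def)
  from integrable_Re[OF this] show ?thesis by simp
qed

text \<open>AM-GM: \<open>2 \<bar>p\<bar> \<le> 1 / \<zeta> + \<zeta> \<bar>p\<bar>\<^sup>2\<close>\<close>

lemma p_integrable: "integrable \<mu> (T \<phi>)"
proof (rule Bochner_Integration.integrable_bound)
  show "integrable \<mu> (\<lambda>\<xi>. 1 / \<zeta> \<xi> + \<zeta> \<xi> * (cmod (T \<phi> \<xi>))\<^sup>2)"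
    by (rule Bochner_Integration.integrable_add[OF inverse_\<zeta>_integrable p_weighted])
  show "AE \<xi> in \<mu>. norm (T \<phi> \<xi>) \<le> norm (1 / \<zeta> \<xi> + \<zeta> \<xi> * (cmod (T \<phi> \<xi>))\<^sup>2)"
  proof (rule AE_I2)
    fix \<xi> assume "\<xi> \<in> space \<mu>"
    then have z: "\<zeta> \<xi> \<ge> 1" using \<zeta>1 by simp
    have "(1 - \<zeta> \<xi> * cmod (T \<phi> \<xi>))\<^sup>2 / \<zeta> \<xi> \<ge> 0" using z by simp
    moreover have "(1 - \<zeta> \<xi> * cmod (T \<phi> \<xi>))\<^sup>2 / \<zeta> \<xi> = 1 / \<zeta> \<xi> + \<zeta> \<xi> * (cmod (T \<phi> \<xi>))\<^sup>2 - 2 * cmod (T \<phi> \<xi>)"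
      using z by (simp add: field_simps power2_eq_square)
    ultimately have "2 * cmod (T \<phi> \<xi>) \<le> 1 / \<zeta> \<xi> + \<zeta> \<xi> * (cmod (T \<phi> \<xi>))\<^sup>2" by linarith
    moreover have "cmod (T \<phi> \<xi>) \<ge> 0" by simp
    ultimately show "norm (T \<phi> \<xi>) \<le> norm (1 / \<zeta> \<xi> + \<zeta> \<xi> * (cmod (T \<phi> \<xi>))\<^sup>2)"
      unfolding real_norm_def by linarith
  qed
qed measurable

section \<open>The minimizer and its transform\<close>

lemma denominator_pos: "\<eta> > 0 \<Longrightarrow> \<xi> \<in> half_space \<Longrightarrow> \<eta> * \<zeta> \<xi> + M \<xi> > 0"
  using \<zeta>1[of \<xi>] by (intro add_pos_nonneg mult_pos_pos) auto

lemma b_bounds: "\<eta> > 0 \<Longrightarrow> \<xi> \<in> half_space \<Longrightarrow> 0 \<le> b \<eta> \<xi> \<and> b \<eta> \<xi> \<le> 1"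
  using denominator_pos[of \<eta> \<xi>] \<zeta>1[of \<xi>] by (auto simp: b_def divide_le_eq)

lemma w_L12: assumes "\<eta> > 0" shows "w \<eta> \<in> L12"
proof -
  have "AE \<xi> in \<mu>. cmod (complex_of_real (b \<eta> \<xi>)) \<le> 1"
    using b_bounds[OF assms] by (intro AE_I2) simp
  then show ?thesis
    unfolding L12_def w_def[abs_def]
    by (auto intro!: integrable_mult_bounded[where K = 1] sqint_mult_bounded[where K = 1] p_integrable p_sqint)
qed

text \<open>As a function of \<open>x\<close>, \<open>Theta\<close> is almost everywhere the inverse
  transform of \<open>k\<close>, so Parseval moves the defining integral to the frequency side,
  where \<open>ms l * cnj (ms l) = M l\<close> produces the filter factor. The identity holds at
  every \<open>y\<close>, as uniform convergence requires.\<close>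

lemma phi_star_eq:
  assumes \<eta>: "\<eta> > 0"
  shows "star \<eta> y = F (w \<eta>) (reflect y)"
proof -
  define D where "D \<xi> = complex_of_real (\<eta> * \<zeta> \<xi> + M \<xi>)" for \<xi>
  define k where "k \<xi> = ms \<xi> * weinstein_kernel \<alpha> y \<xi> / D \<xi>" for \<xi>
  let ?h = "multiplier_op \<alpha> m \<sigma> \<phi>"
  have [measurable]: "(\<lambda>\<xi>. weinstein_kernel \<alpha> y \<xi>) \<in> borel_measurable \<mu>"
    by (intro measurable_weinstein_kernel) (auto intro: measurable_weinstein_measure)
  have [measurable]: "D \<in> borel_measurable \<mu>" unfolding D_def[abs_def] by measurable
  have km [measurable]: "k \<in> borel_measurable \<mu>" unfolding k_def[abs_def] by measurable
  obtain C where C: "AE \<xi> in \<mu>. cmod (ms \<xi>) \<le> C" using ms_bounded by blast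
  \<comment> \<open>The first bound gives integrability through \<open>1 / \<zeta>\<close>, the
    second square integrability.\<close>
  have kb: "AE \<xi> in \<mu>. cmod (k \<xi>) \<le> C / \<eta> * (1 / \<zeta> \<xi>) \<and> cmod (k \<xi>) \<le> C / \<eta>"
    using C AE_space
  proof eventually_elim
    fix \<xi> assume c: "cmod (ms \<xi>) \<le> C" and "\<xi> \<in> space \<mu>"
    then have z: "\<zeta> \<xi> \<ge> 1" and x: "\<xi> \<in> half_space" using \<zeta>1 by auto
    have C0: "C \<ge> 0" using c norm_ge_zero order_trans by blast
    have "cmod (D \<xi>) = \<eta> * \<zeta> \<xi> + M \<xi>" using denominator_pos[OF \<eta> x] unfolding D_def norm_of_real by simp
    then have D: "cmod (D \<xi>) \<ge> \<eta> * \<zeta> \<xi>" by simp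
    have ez: "\<eta> * \<zeta> \<xi> > 0" using \<eta> z by simp
    have "cmod (ms \<xi>) * cmod (weinstein_kernel \<alpha> y \<xi>) \<le> C * 1"
      by (rule mult_mono[OF c cmod_weinstein_kernel_le_1 C0 norm_ge_zero])
    then have "cmod (k \<xi>) \<le> C / (\<eta> * \<zeta> \<xi>)"
      unfolding k_def norm_divide norm_mult using D ez C0 by (intro frac_le) auto
    moreover have "C / (\<eta> * \<zeta> \<xi>) \<le> C / \<eta>"
      using C0 \<eta> z by (intro divide_left_mono) auto
    ultimately show "cmod (k \<xi>) \<le> C / \<eta> * (1 / \<zeta> \<xi>) \<and> cmod (k \<xi>) \<le> C / \<eta>" by simp
  qed
  have kI: "integrable \<mu> k"
  proof (rule Bochner_Integration.integrable_bound)
    show "integrable \<mu> (\<lambda>\<xi>. C / \<eta> * (1 / \<zeta> \<xi>))"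
      by (rule Bochner_Integration.integrable_mult_right[OF inverse_\<zeta>_integrable])
    show "AE \<xi> in \<mu>. norm (k \<xi>) \<le> norm (C / \<eta> * (1 / \<zeta> \<xi>))"
      using kb
    proof eventually_elim
      fix \<xi> assume "cmod (k \<xi>) \<le> C / \<eta> * (1 / \<zeta> \<xi>) \<and> cmod (k \<xi>) \<le> C / \<eta>"
      then show "norm (k \<xi>) \<le> norm (C / \<eta> * (1 / \<zeta> \<xi>))"
        using abs_ge_self[of "C / \<eta> * (1 / \<zeta> \<xi>)"] unfolding real_norm_def by linarith
    qed
  qed measurable
  have kS: "sqint \<mu> k"
    by (rule bounded_integrable_imp_sqint[OF kI, of "C / \<eta>"]) (use kb in auto)
  have kL: "k \<in> L12" using kI kS by (simp add: L12_def)
  have \<Theta>: "Theta \<alpha> m \<sigma> \<zeta> \<eta> x y = F k (reflect x)" for x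
    unfolding Theta_def weinstein_transform_L1_def k_def D_def ms_def M_def
    by (intro Bochner_Integration.integral_cong refl) simp
  have Fk: "AE x in \<mu>. F k (reflect x) = inv_weinstein_transform \<alpha> k x"
    using AE_reflect[OF weinstein_transform_eq_L1[OF kL]]
    by eventually_elim (simp add: inv_weinstein_transform_def)
  have hS: "sqint \<mu> ?h" and iS: "sqint \<mu> (inv_weinstein_transform \<alpha> k)"
    using multiplier_op_sqint[OF \<phi>_sqint] inv_weinstein_transform_sqint[OF kS] by auto
  have [measurable]: "?h \<in> borel_measurable \<mu>" "inv_weinstein_transform \<alpha> k \<in> borel_measurable \<mu>"
    "(\<lambda>x. F k (reflect x)) \<in> borel_measurable \<mu>"
    using hS iS measurable_compose[OF measurable_reflect_weinstein measurable_weinstein_transform_L1[OF km]]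
    by (auto simp: sqint_def)
  have [measurable]: "T ?h \<in> borel_measurable \<mu>" "T (inv_weinstein_transform \<alpha> k) \<in> borel_measurable \<mu>"
    using weinstein_transform_sqint[OF hS] weinstein_transform_sqint[OF iS] by (auto simp: sqint_def)
  have "star \<eta> y = (LINT x|\<mu>. ?h x * cnj (F k (reflect x)))"
    by (simp add: phi_star_def \<Theta>)
  also have "\<dots> = (LINT x|\<mu>. ?h x * cnj (inv_weinstein_transform \<alpha> k x))"
    using Fk by (intro integral_cong_AE) (measurable, auto)
  also have "\<dots> = (LINT l|\<mu>. T ?h l * cnj (T (inv_weinstein_transform \<alpha> k) l))"
    by (rule weinstein_parseval[OF hS iS])
  also have "\<dots> = (LINT l|\<mu>. ms l * T \<phi> l * cnj (k l))"
    using transform_multiplier_op[OF \<phi>_sqint] weinstein_transform_inverse[OF kS]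
    by (intro integral_cong_AE) (measurable, auto elim: eventually_elim2)
  also have "\<dots> = (LINT l|\<mu>. w \<eta> l * weinstein_kernel \<alpha> (reflect y) l)"
  proof (intro Bochner_Integration.integral_cong refl)
    fix l
    have "ms l * cnj (ms l) = complex_of_real (M l)"
      unfolding M_def by (rule complex_norm_square[symmetric])
    then have "ms l * T \<phi> l * cnj (k l) = complex_of_real (M l) / cnj (D l) * T \<phi> l * cnj (weinstein_kernel \<alpha> y l)"
      by (simp add: k_def mult_ac)
    then show "ms l * T \<phi> l * cnj (k l) = w \<eta> l * weinstein_kernel \<alpha> (reflect y) l"
      by (simp add: w_def b_def D_def cnj_weinstein_kernel)
  qed
  finally show ?thesis by (simp add: weinstein_transform_L1_def)
qed

lemma phi_star_sqint:
  assumes \<eta>: "\<eta> > 0" shows "sqint \<mu> (star \<eta>)"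
  unfolding phi_star_eq[OF \<eta>, abs_def]
  by (intro sqint_reflect weinstein_transform_L1_contraction w_L12 \<eta>)

text \<open>The preceding formula identifies \<open>star \<eta>\<close> almost everywhere with the
  inverse transform of \<open>w \<eta>\<close>, which \<open>T\<close> undoes.\<close>

lemma transform_phi_star:
  assumes \<eta>: "\<eta> > 0"
  shows "AE \<xi> in \<mu>. T (star \<eta>) \<xi> = w \<eta> \<xi>"
proof -
  have wS: "sqint \<mu> (w \<eta>)" by (rule L12_D(2)[OF w_L12[OF \<eta>]])
  have "AE x in \<mu>. star \<eta> x = inv_weinstein_transform \<alpha> (w \<eta>) x"
    using AE_reflect[OF weinstein_transform_eq_L1[OF w_L12[OF \<eta>]]]
    by eventually_elim (simp add: inv_weinstein_transform_def phi_star_eq[OF \<eta>])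
  then have "AE \<xi> in \<mu>. T (star \<eta>) \<xi> = T (inv_weinstein_transform \<alpha> (w \<eta>)) \<xi>"
    by (subst weinstein_transform_cong_AE[OF phi_star_sqint[OF \<eta>] inv_weinstein_transform_sqint[OF wS], symmetric])
  then show ?thesis using weinstein_transform_inverse[OF wS] by eventually_elim simp
qed

lemma w_measurable [measurable]: "w \<eta> \<in> borel_measurable \<mu>"
  unfolding w_def[abs_def] by measurable

lemma phi_star_H_space:
  assumes \<eta>: "\<eta> > 0" shows "star \<eta> \<in> H_space \<alpha> \<zeta>"
  unfolding H_space_iff
proof (intro conjI phi_star_sqint \<eta>)
  have [measurable]: "T (star \<eta>) \<in> borel_measurable \<mu>"
    using weinstein_transform_sqint[OF phi_star_sqint[OF \<eta>]] by (simp add: sqint_def)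
  show "integrable \<mu> (\<lambda>\<xi>. \<zeta> \<xi> * (cmod (T (star \<eta>) \<xi>))\<^sup>2)"
  proof (rule Bochner_Integration.integrable_bound[OF p_weighted])
    show "AE \<xi> in \<mu>. norm (\<zeta> \<xi> * (cmod (T (star \<eta>) \<xi>))\<^sup>2) \<le> norm (\<zeta> \<xi> * (cmod (T \<phi> \<xi>))\<^sup>2)"
      using transform_phi_star[OF \<eta>] AE_space
    proof eventually_elim
      fix \<xi> assume eq: "T (star \<eta>) \<xi> = w \<eta> \<xi>" and "\<xi> \<in> space \<mu>"
      then have x: "\<xi> \<in> half_space" and z: "\<zeta> \<xi> \<ge> 1" using \<zeta>1 by auto
      have "cmod (w \<eta> \<xi>) \<le> 1 * cmod (T \<phi> \<xi>)"
        unfolding w_def norm_mult using b_bounds[OF \<eta> x] by (intro mult_right_mono) auto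
      then have "(cmod (w \<eta> \<xi>))\<^sup>2 \<le> (cmod (T \<phi> \<xi>))\<^sup>2" by (intro power_mono) auto
      then show "norm (\<zeta> \<xi> * (cmod (T (star \<eta>) \<xi>))\<^sup>2) \<le> norm (\<zeta> \<xi> * (cmod (T \<phi> \<xi>))\<^sup>2)"
        using z unfolding eq by (simp add: abs_mult)
    qed
  qed measurable
qed

text \<open>The minimal value of the functional, the constant left over by completing the
  square.\<close>

definition residual :: "real \<Rightarrow> real" where
  "residual \<eta> = (LINT \<xi>|\<mu>. \<eta> * \<zeta> \<xi> * M \<xi> / (\<eta> * \<zeta> \<xi> + M \<xi>) * (cmod (T \<phi> \<xi>))\<^sup>2)"

text \<open>Plancherel writes the data term as the integral of
  \<open>M \<xi> * (cmod (T \<phi> \<xi> - T \<psi> \<xi>))\<^sup>2\<close>; then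
  \<open>complete_square\<close> applies pointwise, and the pieces are integrated separately because
  each of them is integrable.\<close>

lemma tikhonov_eq:
  assumes \<eta>: "\<eta> > 0" and \<psi>: "\<psi> \<in> H_space \<alpha> \<zeta>"
  shows "integrable \<mu> (\<lambda>\<xi>. (\<eta> * \<zeta> \<xi> + M \<xi>) * (cmod (T \<psi> \<xi> - w \<eta> \<xi>))\<^sup>2)"
    and "tikhonov \<alpha> m \<sigma> \<zeta> \<eta> (multiplier_op \<alpha> m \<sigma> \<phi>) \<psi> =
      (LINT \<xi>|\<mu>. (\<eta> * \<zeta> \<xi> + M \<xi>) * (cmod (T \<psi> \<xi> - w \<eta> \<xi>))\<^sup>2) + residual \<eta>"
proof -
  let ?h = "multiplier_op \<alpha> m \<sigma>"
  let ?r = "\<lambda>\<xi>. \<eta> * \<zeta> \<xi> * M \<xi> / (\<eta> * \<zeta> \<xi> + M \<xi>) * (cmod (T \<phi> \<xi>))\<^sup>2"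
  have \<psi>S: "sqint \<mu> \<psi>" and \<psi>I: "integrable \<mu> (\<lambda>\<xi>. \<zeta> \<xi> * (cmod (T \<psi> \<xi>))\<^sup>2)"
    using \<psi> by (auto simp: H_space_iff)
  have aS: "sqint \<mu> (T \<psi>)" by (rule weinstein_transform_sqint[OF \<psi>S])
  have [measurable]: "T \<psi> \<in> borel_measurable \<mu>" using aS by (simp add: sqint_def)
  have dS: "sqint \<mu> (\<lambda>\<xi>. ms \<xi> * (T \<phi> \<xi> - T \<psi> \<xi>))"
    by (intro sqint_ms_mult sqint_diff p_sqint aS)
  have sq: "(cmod (ms \<xi> * (T \<phi> \<xi> - T \<psi> \<xi>)))\<^sup>2 = M \<xi> * (cmod (T \<phi> \<xi> - T \<psi> \<xi>))\<^sup>2" for \<xi>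
    by (simp add: M_def norm_mult power_mult_distrib)
  have dI: "integrable \<mu> (\<lambda>\<xi>. M \<xi> * (cmod (T \<phi> \<xi> - T \<psi> \<xi>))\<^sup>2)"
    using sqint_integrable[OF dS] unfolding sq .
  have "L2_norm \<alpha> (\<lambda>x. ?h \<phi> x - ?h \<psi> x) = nrm2 \<mu> (\<lambda>\<xi>. T (?h \<phi>) \<xi> - T (?h \<psi>) \<xi>)"
    unfolding L2_norm_altdef
    by (rule nrm2_weinstein_transform_diff[OF multiplier_op_sqint[OF \<phi>_sqint] multiplier_op_sqint[OF \<psi>S], symmetric])
  also have "\<dots> = nrm2 \<mu> (\<lambda>\<xi>. ms \<xi> * (T \<phi> \<xi> - T \<psi> \<xi>))"
  proof (rule nrm2_cong_AE)
    show "AE \<xi> in \<mu>. T (?h \<phi>) \<xi> - T (?h \<psi>) \<xi> = ms \<xi> * (T \<phi> \<xi> - T \<psi> \<xi>)"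
      using transform_multiplier_op[OF \<phi>_sqint] transform_multiplier_op[OF \<psi>S]
      by eventually_elim (simp add: right_diff_distrib)
    show "(\<lambda>\<xi>. T (?h \<phi>) \<xi> - T (?h \<psi>) \<xi>) \<in> borel_measurable \<mu>"
      using sqint_diff[OF weinstein_transform_sqint[OF multiplier_op_sqint[OF \<phi>_sqint]]
          weinstein_transform_sqint[OF multiplier_op_sqint[OF \<psi>S]]] by (simp add: sqint_def)
  qed measurable
  finally have L: "(L2_norm \<alpha> (\<lambda>x. ?h \<phi> x - ?h \<psi> x))\<^sup>2 = (LINT \<xi>|\<mu>. M \<xi> * (cmod (T \<phi> \<xi> - T \<psi> \<xi>))\<^sup>2)"
    by (simp only: nrm2_square sq)
  have H: "\<eta> * (H_norm \<alpha> \<zeta> \<psi>)\<^sup>2 = (LINT \<xi>|\<mu>. \<eta> * (\<zeta> \<xi> * (cmod (T \<psi> \<xi>))\<^sup>2))"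
  proof -
    have "(LINT \<xi>|\<mu>. \<zeta> \<xi> * (cmod (T \<psi> \<xi>))\<^sup>2) \<ge> 0"
      by (rule integral_nonneg_AE, rule AE_I2) (use \<zeta>1 in \<open>force\<close>)
    then show ?thesis by (simp add: H_norm_def)
  qed
  have \<eta>I: "integrable \<mu> (\<lambda>\<xi>. \<eta> * (\<zeta> \<xi> * (cmod (T \<psi> \<xi>))\<^sup>2))"
    by (rule Bochner_Integration.integrable_mult_right[OF \<psi>I])
  have rI: "integrable \<mu> ?r"
  proof (rule Bochner_Integration.integrable_bound)
    show "integrable \<mu> (\<lambda>\<xi>. \<eta> * (\<zeta> \<xi> * (cmod (T \<phi> \<xi>))\<^sup>2))"
      by (rule Bochner_Integration.integrable_mult_right[OF p_weighted])
    show "AE \<xi> in \<mu>. norm (?r \<xi>) \<le> norm (\<eta> * (\<zeta> \<xi> * (cmod (T \<phi> \<xi>))\<^sup>2))"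
    proof (rule AE_I2)
      fix \<xi> assume "\<xi> \<in> space \<mu>"
      then have x: "\<xi> \<in> half_space" and z: "\<zeta> \<xi> \<ge> 1" using \<zeta>1 by auto
      let ?c = "\<eta> * (\<zeta> \<xi> * (cmod (T \<phi> \<xi>))\<^sup>2)"
      have c: "?c \<ge> 0" using \<eta> z by simp
      have r: "?r \<xi> = b \<eta> \<xi> * ?c" by (simp add: b_def)
      have "b \<eta> \<xi> * ?c \<le> 1 * ?c" using b_bounds[OF \<eta> x] c by (intro mult_right_mono) auto
      then show "norm (?r \<xi>) \<le> norm ?c"
        unfolding r real_norm_def abs_mult[of "b \<eta> \<xi>"] abs_of_nonneg[OF c] using b_bounds[OF \<eta> x] by simp
    qed
  qed measurable
  have eq: "(\<eta> * \<zeta> \<xi> + M \<xi>) * (cmod (T \<psi> \<xi> - w \<eta> \<xi>))\<^sup>2 =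
      \<eta> * (\<zeta> \<xi> * (cmod (T \<psi> \<xi>))\<^sup>2) + M \<xi> * (cmod (T \<phi> \<xi> - T \<psi> \<xi>))\<^sup>2 - ?r \<xi>" if "\<xi> \<in> space \<mu>" for \<xi>
    using complete_square[OF denominator_pos[OF \<eta>], of \<xi> "T \<psi> \<xi>" "T \<phi> \<xi>"] that
    by (simp add: w_def b_def mult.assoc)
  have I: "integrable \<mu> (\<lambda>\<xi>. \<eta> * (\<zeta> \<xi> * (cmod (T \<psi> \<xi>))\<^sup>2) + M \<xi> * (cmod (T \<phi> \<xi> - T \<psi> \<xi>))\<^sup>2 - ?r \<xi>)"
    by (intro Bochner_Integration.integrable_diff Bochner_Integration.integrable_add \<eta>I dI rI)
  then show "integrable \<mu> (\<lambda>\<xi>. (\<eta> * \<zeta> \<xi> + M \<xi>) * (cmod (T \<psi> \<xi> - w \<eta> \<xi>))\<^sup>2)"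
    by (subst Bochner_Integration.integrable_cong[OF refl eq])
  have "(LINT \<xi>|\<mu>. (\<eta> * \<zeta> \<xi> + M \<xi>) * (cmod (T \<psi> \<xi> - w \<eta> \<xi>))\<^sup>2) =
      (LINT \<xi>|\<mu>. \<eta> * (\<zeta> \<xi> * (cmod (T \<psi> \<xi>))\<^sup>2) + M \<xi> * (cmod (T \<phi> \<xi> - T \<psi> \<xi>))\<^sup>2 - ?r \<xi>)"
    by (rule Bochner_Integration.integral_cong[OF refl eq])
  also have "\<dots> = (LINT \<xi>|\<mu>. \<eta> * (\<zeta> \<xi> * (cmod (T \<psi> \<xi>))\<^sup>2)) + (LINT \<xi>|\<mu>. M \<xi> * (cmod (T \<phi> \<xi> - T \<psi> \<xi>))\<^sup>2) - residual \<eta>"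
    unfolding residual_def
    by (simp only: Bochner_Integration.integral_diff[OF Bochner_Integration.integrable_add[OF \<eta>I dI] rI]
        Bochner_Integration.integral_add[OF \<eta>I dI])
  finally show "tikhonov \<alpha> m \<sigma> \<zeta> \<eta> (?h \<phi>) \<psi> =
      (LINT \<xi>|\<mu>. (\<eta> * \<zeta> \<xi> + M \<xi>) * (cmod (T \<psi> \<xi> - w \<eta> \<xi>))\<^sup>2) + residual \<eta>"
    by (simp only: tikhonov_def L H)
qed

text \<open>The weighted square vanishes for \<open>star \<eta>\<close>. Its weight is strictly
  positive, so it vanishes for another \<open>\<psi>\<close> only if the transforms agree almost
  everywhere, and injectivity finishes.\<close>

theorem phi_star_extremal:
  assumes \<eta>: "\<eta> > 0"
  shows "is_extremal \<alpha> m \<sigma> \<zeta> \<eta> (multiplier_op \<alpha> m \<sigma> \<phi>) (star \<eta>)"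
proof -
  let ?f = "star \<eta>" and ?J = "tikhonov \<alpha> m \<sigma> \<zeta> \<eta> (multiplier_op \<alpha> m \<sigma> \<phi>)"
  let ?Q = "\<lambda>\<psi> \<xi>. (\<eta> * \<zeta> \<xi> + M \<xi>) * (cmod (T \<psi> \<xi> - w \<eta> \<xi>))\<^sup>2"
  have Q0: "AE \<xi> in \<mu>. ?Q \<psi> \<xi> \<ge> 0" for \<psi>
    using denominator_pos[OF \<eta>] by (intro AE_I2 mult_nonneg_nonneg) (auto intro: less_imp_le)
  have "(LINT \<xi>|\<mu>. ?Q ?f \<xi>) = 0"
    by (rule integral_eq_zero_AE, use transform_phi_star[OF \<eta>] in eventually_elim) simp
  then have Jf: "?J ?f = residual \<eta>"
    using tikhonov_eq(2)[OF \<eta> phi_star_H_space[OF \<eta>]] by simp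
  show ?thesis
    unfolding is_extremal_def
  proof (intro conjI ballI impI phi_star_H_space \<eta>)
    fix \<psi> assume \<psi>: "\<psi> \<in> H_space \<alpha> \<zeta>"
    show "?J ?f \<le> ?J \<psi>"
      unfolding Jf tikhonov_eq(2)[OF \<eta> \<psi>] using integral_nonneg_AE[OF Q0] by simp
    assume "?J \<psi> = ?J ?f"
    then have "(LINT \<xi>|\<mu>. ?Q \<psi> \<xi>) = 0"
      unfolding Jf tikhonov_eq(2)[OF \<eta> \<psi>] by simp
    then have "AE \<xi> in \<mu>. ?Q \<psi> \<xi> = 0"
      using integral_nonneg_eq_0_iff_AE[OF tikhonov_eq(1)[OF \<eta> \<psi>] Q0] by simp
    then have "AE \<xi> in \<mu>. T \<psi> \<xi> = T ?f \<xi>"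
      using transform_phi_star[OF \<eta>] AE_space
    proof eventually_elim
      fix \<xi> assume "?Q \<psi> \<xi> = 0" "T ?f \<xi> = w \<eta> \<xi>" "\<xi> \<in> space \<mu>"
      then show "T \<psi> \<xi> = T ?f \<xi>" using denominator_pos[OF \<eta>, of \<xi>] by simp
    qed
    then show "AE x in \<mu>. \<psi> x = ?f x"
      using \<psi> by (subst weinstein_transform_cong_AE[OF _ phi_star_sqint[OF \<eta>]]) (auto simp: H_space_iff)
  qed
qed

section \<open>Convergence as \<eta> tends to 0\<close>

lemma tendsto_w:
  assumes S: "\<And>n. S n > 0" "S \<longlonglongrightarrow> 0"
  shows "AE \<xi> in \<mu>. (\<lambda>n::nat. w (S n) \<xi>) \<longlonglongrightarrow> T \<phi> \<xi>"
  using ms_nonzero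
proof eventually_elim
  fix \<xi> assume "ms \<xi> \<noteq> 0"
  then have M: "M \<xi> \<noteq> 0" by (simp add: M_def)
  \<comment> \<open>The nonvanishing of \<open>m\<close> enters here: at \<eta> = 0 the filter
    factor is \<open>M \<xi> / M \<xi> = 1\<close>.\<close>
  then have "(\<lambda>n. complex_of_real (M \<xi> / (S n * \<zeta> \<xi> + M \<xi>)) * T \<phi> \<xi>) \<longlonglongrightarrow>
      complex_of_real (M \<xi> / (0 * \<zeta> \<xi> + M \<xi>)) * T \<phi> \<xi>"
    by (intro tendsto_intros S) simp
  then show "(\<lambda>n. w (S n) \<xi>) \<longlonglongrightarrow> T \<phi> \<xi>" using M by (simp add: w_def b_def)
qed

lemma w_diff_bound:
  assumes "\<eta> > 0" "\<xi> \<in> half_space"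
  shows "cmod (w \<eta> \<xi> - T \<phi> \<xi>) \<le> cmod (T \<phi> \<xi>)"
proof -
  have "w \<eta> \<xi> - T \<phi> \<xi> = complex_of_real (b \<eta> \<xi> - 1) * T \<phi> \<xi>"
    by (simp add: w_def left_diff_distrib)
  then have "cmod (w \<eta> \<xi> - T \<phi> \<xi>) = \<bar>b \<eta> \<xi> - 1\<bar> * cmod (T \<phi> \<xi>)"
    by (simp only: norm_mult norm_of_real)
  also have "\<dots> \<le> 1 * cmod (T \<phi> \<xi>)"
    using b_bounds[OF assms] by (intro mult_right_mono) auto
  finally show ?thesis by simp
qed

theorem H_norm_phi_star_tendsto:
  "((\<lambda>\<eta>. H_norm \<alpha> \<zeta> (\<lambda>y. star \<eta> y - \<phi> y)) \<longlongrightarrow> 0) (at_right 0)"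
\<comment> \<open>Dominated convergence is applied along sequences; 1 is an arbitrary right endpoint
  for them.\<close>
proof (rule tendsto_at_right_sequentially[of 0 1])
  fix S :: "nat \<Rightarrow> real" assume S: "\<And>n. 0 < S n" "S \<longlonglongrightarrow> 0"
  have eq: "H_norm \<alpha> \<zeta> (\<lambda>y. star (S n) y - \<phi> y) = sqrt (LINT \<xi>|\<mu>. \<zeta> \<xi> * (cmod (w (S n) \<xi> - T \<phi> \<xi>))\<^sup>2)" for n
  proof -
    have fS: "sqint \<mu> (star (S n))" by (rule phi_star_sqint[OF S(1)])
    have [measurable]: "T (\<lambda>y. star (S n) y - \<phi> y) \<in> borel_measurable \<mu>"
      using weinstein_transform_sqint[OF sqint_diff[OF fS \<phi>_sqint]] by (simp add: sqint_def)
    have "AE \<xi> in \<mu>. T (\<lambda>y. star (S n) y - \<phi> y) \<xi> = w (S n) \<xi> - T \<phi> \<xi>"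
      using weinstein_transform_diff[OF fS \<phi>_sqint] transform_phi_star[OF S(1)]
      by eventually_elim simp
    then show ?thesis
      unfolding H_norm_def by (intro arg_cong[where f = sqrt] integral_cong_AE) (measurable, auto)
  qed
  have "(\<lambda>n. LINT \<xi>|\<mu>. \<zeta> \<xi> * (cmod (w (S n) \<xi> - T \<phi> \<xi>))\<^sup>2) \<longlonglongrightarrow> (LINT \<xi>|\<mu>. 0)"
  proof (rule integral_dominated_convergence[OF _ _ p_weighted])
    show "AE \<xi> in \<mu>. (\<lambda>n. \<zeta> \<xi> * (cmod (w (S n) \<xi> - T \<phi> \<xi>))\<^sup>2) \<longlonglongrightarrow> 0"
      using tendsto_w[OF S]
    proof eventually_elim
      fix \<xi> assume "(\<lambda>n. w (S n) \<xi>) \<longlonglongrightarrow> T \<phi> \<xi>"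
      then have "(\<lambda>n. \<zeta> \<xi> * (cmod (w (S n) \<xi> - T \<phi> \<xi>))\<^sup>2) \<longlonglongrightarrow> \<zeta> \<xi> * (cmod (T \<phi> \<xi> - T \<phi> \<xi>))\<^sup>2"
        by (intro tendsto_intros)
      then show "(\<lambda>n. \<zeta> \<xi> * (cmod (w (S n) \<xi> - T \<phi> \<xi>))\<^sup>2) \<longlonglongrightarrow> 0" by simp
    qed
    show "AE \<xi> in \<mu>. norm (\<zeta> \<xi> * (cmod (w (S n) \<xi> - T \<phi> \<xi>))\<^sup>2) \<le> \<zeta> \<xi> * (cmod (T \<phi> \<xi>))\<^sup>2" for n
    proof (rule AE_I2)
      fix \<xi> assume "\<xi> \<in> space \<mu>"
      then have "\<xi> \<in> half_space" and z: "\<zeta> \<xi> \<ge> 1" using \<zeta>1 by auto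
      then have "(cmod (w (S n) \<xi> - T \<phi> \<xi>))\<^sup>2 \<le> (cmod (T \<phi> \<xi>))\<^sup>2"
        by (intro power_mono w_diff_bound S) auto
      then show "norm (\<zeta> \<xi> * (cmod (w (S n) \<xi> - T \<phi> \<xi>))\<^sup>2) \<le> \<zeta> \<xi> * (cmod (T \<phi> \<xi>))\<^sup>2"
        using z by (simp add: abs_mult)
    qed
  qed measurable
  from tendsto_real_sqrt[OF this]
  show "(\<lambda>n. H_norm \<alpha> \<zeta> (\<lambda>y. star (S n) y - \<phi> y)) \<longlonglongrightarrow> 0"
    unfolding eq by simp
qed simp

text \<open>Both functions are inversion integrals at the same point, and the kernel is bounded by
  1. Their difference is therefore at most the \<open>L1\<close> distance of \<open>w \<eta>\<close>
  from \<open>T \<phi>\<close>, which does not depend on \<open>y\<close>.\<close>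

theorem phi_star_uniform_limit:
  "uniform_limit half_space (star) (continuous_rep \<alpha> \<phi>) (at_right 0)"
proof -
  let ?e = "\<lambda>\<eta>. LINT \<xi>|\<mu>. cmod (w \<eta> \<xi> - T \<phi> \<xi>)"
  have "(?e \<longlongrightarrow> 0) (at_right 0)"
  proof (rule tendsto_at_right_sequentially[of 0 1])
    fix S :: "nat \<Rightarrow> real" assume S: "\<And>n. 0 < S n" "S \<longlonglongrightarrow> 0"
    have pI: "integrable \<mu> (\<lambda>\<xi>. cmod (T \<phi> \<xi>))" using p_integrable by simp
    have "(\<lambda>n. ?e (S n)) \<longlonglongrightarrow> (LINT \<xi>|\<mu>. 0)"
    proof (rule integral_dominated_convergence[OF _ _ pI])
      show "AE \<xi> in \<mu>. (\<lambda>n. cmod (w (S n) \<xi> - T \<phi> \<xi>)) \<longlonglongrightarrow> 0"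
        using tendsto_w[OF S]
      proof eventually_elim
        fix \<xi> assume "(\<lambda>n. w (S n) \<xi>) \<longlonglongrightarrow> T \<phi> \<xi>"
        then have "(\<lambda>n. cmod (w (S n) \<xi> - T \<phi> \<xi>)) \<longlonglongrightarrow> cmod (T \<phi> \<xi> - T \<phi> \<xi>)"
          by (intro tendsto_intros)
        then show "(\<lambda>n. cmod (w (S n) \<xi> - T \<phi> \<xi>)) \<longlonglongrightarrow> 0" by simp
      qed
      show "AE \<xi> in \<mu>. norm (cmod (w (S n) \<xi> - T \<phi> \<xi>)) \<le> cmod (T \<phi> \<xi>)" for n
        using w_diff_bound[OF S(1)] by (intro AE_I2) simp
    qed measurable
    then show "(\<lambda>n. ?e (S n)) \<longlonglongrightarrow> 0" by simp
  qed simp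
  note lim = this
  show ?thesis
  proof (rule uniform_limitI)
    fix e :: real assume "e > 0"
    then have "\<forall>\<^sub>F \<eta> in at_right 0. ?e \<eta> < e" by (rule order_tendstoD(2)[OF lim])
    moreover have "\<forall>\<^sub>F \<eta> in at_right (0::real). \<eta> > 0" by (rule eventually_at_right_less)
    ultimately show "\<forall>\<^sub>F \<eta> in at_right 0. \<forall>y\<in>half_space. dist (star \<eta> y) (continuous_rep \<alpha> \<phi> y) < e"
    proof eventually_elim
      fix \<eta> :: real assume e: "?e \<eta> < e" and \<eta>: "\<eta> > 0"
      have wI: "integrable \<mu> (w \<eta>)" by (rule L12_D(1)[OF w_L12[OF \<eta>]])
      show "\<forall>y\<in>half_space. dist (star \<eta> y) (continuous_rep \<alpha> \<phi> y) < e"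
      proof
        fix y :: "(real ^ 'n) \<times> real"
        have "continuous_rep \<alpha> \<phi> y = F (T \<phi>) (reflect y)"
          by (simp add: continuous_rep_def weinstein_transform_L1_def)
        then have "star \<eta> y - continuous_rep \<alpha> \<phi> y = F (\<lambda>\<xi>. w \<eta> \<xi> - T \<phi> \<xi>) (reflect y)"
          by (simp add: phi_star_eq[OF \<eta>] weinstein_transform_L1_diff[OF wI p_integrable])
        then have "cmod (star \<eta> y - continuous_rep \<alpha> \<phi> y) \<le> ?e \<eta>"
          using cmod_weinstein_transform_L1_le[OF Bochner_Integration.integrable_diff[OF wI p_integrable]] by simp
        then show "dist (star \<eta> y) (continuous_rep \<alpha> \<phi> y) < e"
          using e by (simp add: dist_norm)
      qed
    qed
  qed
qed

end

theorem theorem3p8: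
  fixes \<alpha> \<sigma> :: real
    and \<zeta> :: "(real ^ 'n::finite) \<times> real \<Rightarrow> real"
    and m \<phi> :: "(real ^ 'n) \<times> real \<Rightarrow> complex"
  assumes "\<alpha> > - 1 / 2" and "\<sigma> > 0"
    and "\<zeta> \<in> borel_measurable (weinstein_measure \<alpha>)"
    and "\<And>\<xi>. \<xi> \<in> half_space \<Longrightarrow> \<zeta> \<xi> \<ge> 1"
    and "(\<lambda>\<xi>. complex_of_real (1 / \<zeta> \<xi>)) \<in> L1 \<alpha>"
    and "m \<in> Linfty \<alpha>"
    and m_nonzero: "AE \<xi> in weinstein_measure \<alpha>. m \<xi> \<noteq> 0"
    and "\<phi> \<in> H_space \<alpha> \<zeta>"
  shows "(\<forall>\<eta>>0. is_extremal \<alpha> m \<sigma> \<zeta> \<eta> (multiplier_op \<alpha> m \<sigma> \<phi>) (phi_star \<alpha> m \<sigma> \<zeta> \<phi> \<eta>)) \<and>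
    ((\<lambda>\<eta>. H_norm \<alpha> \<zeta> (\<lambda>y. phi_star \<alpha> m \<sigma> \<zeta> \<phi> \<eta> y - \<phi> y)) \<longlongrightarrow> 0) (at_right 0) \<and>
    uniform_limit half_space (phi_star \<alpha> m \<sigma> \<zeta> \<phi>) (continuous_rep \<alpha> \<phi>) (at_right 0)"
proof -
  interpret tikhonov_regularization \<alpha> \<sigma> \<zeta> m \<phi>
    using assms by unfold_locales
  show ?thesis
    using phi_star_extremal H_norm_phi_star_tendsto phi_star_uniform_limit by blast
qed

end
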